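(* Let $d\in\mathbb{N}$, $1\le i\le l$, and let $u\in C^1(\widetilde\Omega_i)$ be the classical solution of the heat problem, where $\widetilde\Omega_i=D\times[0,t_i]$ and $\widetilde\Omega_{*i}=\partial D\times[0,t_i]$. Let $u_{\theta_1},\dots,u_{\theta_i}$ be HLConcPINNs with parameters $\theta_1,\dots,\theta_i$, let $\hat u_i=u_{\theta_i}-u$, and let $t_{i-1}\le\tau\le t_i$. Then $$\int_D|\hat u_i(x,\tau)|^2\,dx\le C_{G_i}\exp(\Delta t),\qquad \int_{t_{i-1}}^{t_i}\int_D|\hat u_i(x,t)|^2\,dx\,dt\le C_{G_i}\,\Delta t\,\exp(\Delta t),$$ where $C_{G_0}=0$, $C_{G_i}=\widetilde C_{G_i}+2C_{G_{i-1}}\exp(\Delta t)$, $$\widetilde C_{G_i}=2\sum_{j=1}^{i}\int_D|R_{tb_i}(x,t_{j-1})|^2dx+\int_{t_{i-1}}^{t_i}\int_D|R_{int_i}|^2dx\,dt+2C_{\partial D_i}|\Delta t|^{1/2}\Big(\int_{t_{i-1}}^{t_i}\int_{\partial D}|R_{sb_i}|^2ds(x)\,dt\Big)^{1/2},$$ and $C_{\partial D_i}=|\partial D|^{1/2}\big(\|u\|_{C^1(\widetilde\Omega_{*i})}+\|u_{\theta_i}\|_{C^1(\widetilde\Omega_{*i})}\big)$.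
   Context: Heat problem. $D\subset\mathbb{R}^d$ is an open connected bounded domain with $C^k$ boundary $\partial D$, $T>0$, and $u:D\times[0,T]\to\mathbb{R}$ solves $\partial_t u-\Delta u=f$ in $D\times[0,T]$, $u(x,0)=u_{in}(x)$ in $D$, $u=u_d$ on $\partial D\times[0,T]$, for given data $f,u_{in},u_d$. Time blocks. For an integer $l\ge1$ put $\Delta t=T/l$ and $t_i=i\Delta t$, $0\le i\le l$. HLConcPINN (hidden-layer concatenated neural network). With $L\ge 3$, input dimension $l_0$, output dimension $l_L$ and hidden widths $l_1,\dots,l_{L-1}$, it is a map $z\in\mathbb{R}^{l_0}\mapsto\sum_{m=1}^{L-1}M_m h_m(z)+b_L$, where $h_0(z)=z$ and $h_m(z)=\sigma_m(W_m h_{m-1}(z)+b_m)$, with $W_m\in\mathbb{R}^{l_m\times l_{m-1}}$, $b_m\in\mathbb{R}^{l_m}$, $M_m\in\mathbb{R}^{l_L\times l_m}$, $b_L\in\mathbb{R}^{l_L}$; activations act componentwise, $\sigma_1=\sigma_2=\tanh$, and $\sigma_m$ for $m\ge3$ are smooth activation functions. $\theta$ denotes the collection of all parameters. Here $l_0=d+1$ (input $(x,t)$), $l_L=1$, and $u_{\theta_i}$ is considered on $D\times[0,t_i]$. Residuals. $R_{int_i}=\partial_t u_{\theta_i}-\Delta u_{\theta_i}-f$; $R_{tb_i}(x,t_{j-1})=u_{\theta_i}(x,t_{j-1})-u_{\theta_{j-1}}(x,t_{j-1})$ for $x\in D$, $1\le j\le i$, with the convention $u_{\theta_0}(x,t_0)=u_{in}(x)$;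 $R_{sb_i}=u_{\theta_i}-u_d$ on $\partial D$. $|\partial D|$ is the surface measure of $\partial D$, and $\|v\|_{C^1(S)}$ is the usual $C^1$ norm on $S$ (sum of the sup norms over $S$ of $v$ and its first-order partial derivatives). *)

theory Defs
  imports "HOL-Analysis.Analysis"
begin

section \<open>Domains with \<open>C\<^sup>k\<close> boundary and their surface measure\<close>

primrec Ck_fun :: "nat \<Rightarrow> ('a::euclidean_space \<Rightarrow> real) \<Rightarrow> bool" where
  "Ck_fun 0 g \<longleftrightarrow> continuous_on UNIV g"
| "Ck_fun (Suc k) g \<longleftrightarrow>
     (\<forall>x. g differentiable (at x)) \<and> (\<forall>b\<in>Basis. Ck_fun k (\<lambda>x. frechet_derivative g (at x) b))"

text \<open>A relabelled and possibly reversed coordinate axis is a vector \<open>e\<close> with \<open>e\<close> or \<open>-e\<close> in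
  \<^term>\<open>Basis\<close>. A function of the remaining \<open>d - 1\<close> coordinates is represented by
  \<open>\<gamma> :: 'a \<Rightarrow> real\<close>, which is only ever evaluated on the hyperplane orthogonal to \<open>e\<close>.\<close>

definition boundary_chart ::
  "nat \<Rightarrow> 'a::euclidean_space set \<Rightarrow> 'a \<Rightarrow> real \<Rightarrow> 'a \<Rightarrow> ('a \<Rightarrow> real) \<Rightarrow> bool" where
  "boundary_chart k D x0 r e \<gamma> \<longleftrightarrow>
     0 < r \<and> e \<in> Basis \<union> uminus ` Basis \<and> Ck_fun k \<gamma> \<and>
     D \<inter> ball x0 r = {x \<in> ball x0 r. x \<bullet> e > \<gamma> (x - (x \<bullet> e) *\<^sub>R e)}"

definition Ck_boundary :: "nat \<Rightarrow> 'a::euclidean_space set \<Rightarrow> bool" where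
  "Ck_boundary k D \<longleftrightarrow> (\<forall>x0\<in>frontier D. \<exists>r e \<gamma>. boundary_chart k D x0 r e \<gamma>)"

text \<open>The \<open>(d - 1)\<close>-dimensional Lebesgue measure on the hyperplane orthogonal to \<open>e\<close>, as a Borel
  measure on the whole space (the unit mass at \<open>0\<close> if \<open>d = 1\<close>).\<close>

definition hyperplane_lborel :: "'a::euclidean_space \<Rightarrow> 'a measure" where
  "hyperplane_lborel e =
     distr (\<Pi>\<^sub>M b\<in>Basis - {e, -e}. (lborel :: real measure)) borel
       (\<lambda>c. \<Sum>b\<in>Basis - {e, -e}. c b *\<^sub>R b)"

text \<open>The surface element \<open>sqrt (1 + |grad \<gamma>|\<^sup>2) dy\<close> on the part of the graph of \<open>\<gamma>\<close> lying in
  \<open>ball x0 r\<close>, which is \<open>frontier D \<inter> ball x0 r\<close> for a chart.\<close>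

definition graph_surface_measure ::
  "'a::euclidean_space \<Rightarrow> real \<Rightarrow> 'a \<Rightarrow> ('a \<Rightarrow> real) \<Rightarrow> 'a measure" where
  "graph_surface_measure x0 r e \<gamma> =
     distr
       (density (hyperplane_lborel e)
         (\<lambda>y. ennreal (sqrt (1 + (\<Sum>b\<in>Basis - {e, -e}. (frechet_derivative \<gamma> (at y) b)\<^sup>2))) *
              indicator (ball x0 r) (y + \<gamma> y *\<^sub>R e)))
       borel (\<lambda>y. y + \<gamma> y *\<^sub>R e)"

text \<open>The measures of two charts agree on the overlap of the charts; their supremum in the lattice
  of measures is therefore the measure on \<^term>\<open>frontier D\<close> that restricts to the surface element
  in every chart.\<close>

definition surface_measure :: "'a::euclidean_space set \<Rightarrow> 'a measure" where
  "surface_measure D =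
     Sup {graph_surface_measure x0 r e \<gamma> | x0 r e \<gamma>. boundary_chart 1 D x0 r e \<gamma>}"


section \<open>\<open>C\<^sup>1\<close> functions up to the boundary\<close>

text \<open>\<open>Q\<close> is an open set. Derivatives on the boundary of \<open>Q\<close> are understood as continuous extensions
  of the derivatives in \<open>Q\<close>.\<close>

definition C1_closure :: "'b::euclidean_space set \<Rightarrow> ('b \<Rightarrow> real) \<Rightarrow> bool" where
  "C1_closure Q v \<longleftrightarrow>
     continuous_on (closure Q) v \<and> (\<forall>z\<in>Q. v differentiable (at z)) \<and>
     (\<forall>b\<in>Basis. \<exists>g. continuous_on (closure Q) g \<and> (\<forall>z\<in>Q. g z = frechet_derivative v (at z) b))"

definition partial_ext :: "'b::euclidean_space set \<Rightarrow> ('b \<Rightarrow> real) \<Rightarrow> 'b \<Rightarrow> 'b \<Rightarrow> real" where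
  "partial_ext Q v b z = Lim (at z within Q) (\<lambda>w. frechet_derivative v (at w) b)"

definition C1_norm :: "'b::euclidean_space set \<Rightarrow> 'b set \<Rightarrow> ('b \<Rightarrow> real) \<Rightarrow> real" where
  "C1_norm Q S v = (SUP z\<in>S. \<bar>v z\<bar>) + (\<Sum>b\<in>Basis. SUP z\<in>S. \<bar>partial_ext Q v b z\<bar>)"


section \<open>The heat problem\<close>

definition dt :: "('a::euclidean_space \<times> real \<Rightarrow> real) \<Rightarrow> 'a \<times> real \<Rightarrow> real" where
  "dt v z = deriv (\<lambda>s. v (fst z, s)) (snd z)"

definition dx :: "'a::euclidean_space \<Rightarrow> ('a \<times> real \<Rightarrow> real) \<Rightarrow> 'a \<times> real \<Rightarrow> real" where
  "dx b v z = frechet_derivative (\<lambda>y. v (y, snd z)) (at (fst z)) b"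

definition laplace :: "('a::euclidean_space \<times> real \<Rightarrow> real) \<Rightarrow> 'a \<times> real \<Rightarrow> real" where
  "laplace v z = (\<Sum>b\<in>Basis. dx b (dx b v) z)"

definition C21_on :: "('a::euclidean_space \<times> real) set \<Rightarrow> ('a \<times> real \<Rightarrow> real) \<Rightarrow> bool" where
  "C21_on Q v \<longleftrightarrow>
     (\<forall>(x, t)\<in>Q. (\<lambda>s. v (x, s)) field_differentiable (at t)) \<and>
     (\<forall>(x, t)\<in>Q. (\<lambda>y. v (y, t)) differentiable (at x)) \<and>
     (\<forall>b\<in>Basis. \<forall>(x, t)\<in>Q. (\<lambda>y. dx b v (y, t)) differentiable (at x)) \<and>
     continuous_on Q v \<and> continuous_on Q (dt v) \<and>
     (\<forall>b\<in>Basis. continuous_on Q (dx b v)) \<and>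
     (\<forall>b\<in>Basis. \<forall>c\<in>Basis. continuous_on Q (dx c (dx b v)))"

text \<open>The equation is only imposed for \<open>0 < t < T\<close>, so that no one-sided time derivatives occur.\<close>

definition classical_heat_solution ::
  "'a::euclidean_space set \<Rightarrow> real \<Rightarrow> ('a \<times> real \<Rightarrow> real) \<Rightarrow> ('a \<Rightarrow> real) \<Rightarrow> ('a \<times> real \<Rightarrow> real) \<Rightarrow>
   ('a \<times> real \<Rightarrow> real) \<Rightarrow> bool" where
  "classical_heat_solution D T f u_in u_d u \<longleftrightarrow>
     C21_on (D \<times> {0<..<T}) u \<and>
     (\<forall>z \<in> D \<times> {0<..<T}. dt u z - laplace u z = f z) \<and>
     (\<forall>x\<in>D. u (x, 0) = u_in x) \<and>
     (\<forall>z \<in> frontier D \<times> {0..T}. u z = u_d z)"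


section \<open>Hidden-layer concatenated networks\<close>

text \<open>Vectors and matrices are functions on indices starting at \<open>0\<close>, of which only the entries below
  the widths are used; layers are numbered from \<open>1\<close>.\<close>

record hlconc =
  depth :: nat
  width :: "nat \<Rightarrow> nat"
  activation :: "nat \<Rightarrow> real \<Rightarrow> real"
  weight :: "nat \<Rightarrow> nat \<Rightarrow> nat \<Rightarrow> real"
  bias :: "nat \<Rightarrow> nat \<Rightarrow> real"
  out_weight :: "nat \<Rightarrow> nat \<Rightarrow> nat \<Rightarrow> real"
  out_bias :: "nat \<Rightarrow> real"

text \<open>The order of the input coordinates is irrelevant: it only permutes the columns of the first
  weight matrix.\<close>

definition coordinate :: "'b::euclidean_space \<Rightarrow> nat \<Rightarrow> real" where
  "coordinate z j = z \<bullet> ((SOME bs. distinct bs \<and> set bs = (Basis :: 'b set)) ! j)"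

primrec hidden :: "hlconc \<Rightarrow> nat \<Rightarrow> 'b::euclidean_space \<Rightarrow> nat \<Rightarrow> real" where
  "hidden \<theta> 0 z p = coordinate z p"
| "hidden \<theta> (Suc m) z p =
     activation \<theta> (Suc m)
       ((\<Sum>q<width \<theta> m. weight \<theta> (Suc m) p q * hidden \<theta> m z q) + bias \<theta> (Suc m) p)"

definition hlconc_output :: "hlconc \<Rightarrow> 'b::euclidean_space \<Rightarrow> nat \<Rightarrow> real" where
  "hlconc_output \<theta> z p =
     (\<Sum>m = 1..depth \<theta> - 1. \<Sum>q<width \<theta> m. out_weight \<theta> m p q * hidden \<theta> m z q) + out_bias \<theta> p"

definition smooth_real :: "(real \<Rightarrow> real) \<Rightarrow> bool" where
  "smooth_real g \<longleftrightarrow> (\<forall>n x. (deriv ^^ n) g field_differentiable (at x))"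

definition is_HLConcPINN :: "nat \<Rightarrow> nat \<Rightarrow> hlconc \<Rightarrow> bool" where
  "is_HLConcPINN d_in d_out \<theta> \<longleftrightarrow>
     3 \<le> depth \<theta> \<and> width \<theta> 0 = d_in \<and> width \<theta> (depth \<theta>) = d_out \<and>
     activation \<theta> 1 = tanh \<and> activation \<theta> 2 = tanh \<and>
     (\<forall>m. 3 \<le> m \<and> m < depth \<theta> \<longrightarrow> smooth_real (activation \<theta> m))"

definition net :: "hlconc \<Rightarrow> 'a::euclidean_space \<times> real \<Rightarrow> real" where
  "net \<theta> z = hlconc_output \<theta> z 0"


section \<open>Residuals and constants of the error estimate\<close>

text \<open>Below, \<open>h\<close> is the block length, so that \<open>t\<^sub>j = j h\<close>, and \<open>v j\<close> is the approximation on the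
  \<open>j\<close>-th block.\<close>

definition block_time :: "real \<Rightarrow> nat \<Rightarrow> real" where
  "block_time h j = real j * h"

definition R_int :: "('a::euclidean_space \<times> real \<Rightarrow> real) \<Rightarrow> (nat \<Rightarrow> 'a \<times> real \<Rightarrow> real) \<Rightarrow>
    nat \<Rightarrow> 'a \<times> real \<Rightarrow> real" where
  "R_int f v i z = dt (v i) z - laplace (v i) z - f z"

text \<open>\<open>R_tb u_in v h i j x\<close> is the initial residual of the \<open>i\<close>-th block at \<open>(x, t\<^sub>j\<^sub>-\<^sub>1)\<close>, for
  \<open>1 \<le> j \<le> i\<close>.\<close>

definition R_tb :: "('a::euclidean_space \<Rightarrow> real) \<Rightarrow> (nat \<Rightarrow> 'a \<times> real \<Rightarrow> real) \<Rightarrow> real \<Rightarrow>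
    nat \<Rightarrow> nat \<Rightarrow> 'a \<Rightarrow> real" where
  "R_tb u_in v h i j x =
     v i (x, block_time h (j - 1)) -
     (if j = 1 then u_in x else v (j - 1) (x, block_time h (j - 1)))"

definition R_sb :: "('a::euclidean_space \<times> real \<Rightarrow> real) \<Rightarrow> (nat \<Rightarrow> 'a \<times> real \<Rightarrow> real) \<Rightarrow>
    nat \<Rightarrow> 'a \<times> real \<Rightarrow> real" where
  "R_sb u_d v i z = v i z - u_d z"

definition C_bd :: "'a::euclidean_space set \<Rightarrow> ('a \<times> real \<Rightarrow> real) \<Rightarrow>
    (nat \<Rightarrow> 'a \<times> real \<Rightarrow> real) \<Rightarrow> real \<Rightarrow> nat \<Rightarrow> real" where
  "C_bd D u v h i =
     (let Q = D \<times> {0<..<block_time h i}; S = frontier D \<times> {0..block_time h i}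
      in sqrt (measure (surface_measure D) (frontier D)) * (C1_norm Q S u + C1_norm Q S (v i)))"

text \<open>Integrals of squares are taken in \<open>[0, \<infinity>]\<close>, since \<open>f\<close> need not be square integrable. The
  lateral residual is bounded, so the real-valued integral is used under the square root.\<close>

definition C_G_tilde :: "'a::euclidean_space set \<Rightarrow> ('a \<times> real \<Rightarrow> real) \<Rightarrow> ('a \<Rightarrow> real) \<Rightarrow>
    ('a \<times> real \<Rightarrow> real) \<Rightarrow> ('a \<times> real \<Rightarrow> real) \<Rightarrow> (nat \<Rightarrow> 'a \<times> real \<Rightarrow> real) \<Rightarrow>
    real \<Rightarrow> nat \<Rightarrow> ennreal" where
  "C_G_tilde D f u_in u_d u v h i =
     2 * (\<Sum>j = 1..i. \<integral>\<^sup>+x\<in>D. ennreal (\<bar>R_tb u_in v h i j x\<bar>\<^sup>2) \<partial>lborel) +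
     (\<integral>\<^sup>+t\<in>{block_time h (i - 1)..block_time h i}.
        (\<integral>\<^sup>+x\<in>D. ennreal (\<bar>R_int f v i (x, t)\<bar>\<^sup>2) \<partial>lborel) \<partial>lborel) +
     ennreal (2 * C_bd D u v h i * sqrt \<bar>h\<bar> *
       sqrt (LINT t:{block_time h (i - 1)..block_time h i}|lborel.
               LINT y:frontier D|surface_measure D. \<bar>R_sb u_d v i (y, t)\<bar>\<^sup>2))"

primrec C_G :: "'a::euclidean_space set \<Rightarrow> ('a \<times> real \<Rightarrow> real) \<Rightarrow> ('a \<Rightarrow> real) \<Rightarrow>
    ('a \<times> real \<Rightarrow> real) \<Rightarrow> ('a \<times> real \<Rightarrow> real) \<Rightarrow> (nat \<Rightarrow> 'a \<times> real \<Rightarrow> real) \<Rightarrow>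
    real \<Rightarrow> nat \<Rightarrow> ennreal" where
  "C_G D f u_in u_d u v h 0 = 0"
| "C_G D f u_in u_d u v h (Suc i) =
     C_G_tilde D f u_in u_d u v h (Suc i) + 2 * C_G D f u_in u_d u v h i * ennreal (exp h)"

end

theory Submission
  imports Defs "HOL-Computational_Algebra.Polynomial"
begin

text \<open>
  On a block, \<open>w = v - u\<close> satisfies \<open>w\<^sub>t - \<Delta>w = R\<close> with the interior residual \<open>R\<close>, so that
  \<open>(\<integral>w\<^sup>2)' = 2\<integral>w \<Delta>w + 2\<integral>w R \<le> 2\<integral>\<^sub>\<partial>\<^sub>D |w||\<nabla>w| + \<integral>w\<^sup>2 + \<integral>R\<^sup>2\<close>, and Gronwall's inequality gives the
  estimate in terms of \<open>\<integral>w\<^sup>2\<close> at the initial time of the block. That integral is at most twice the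
  initial residual plus twice the error of the previous block.

  Since \<open>w\<close> is \<open>C\<^sup>1\<close> up to the boundary and \<open>C\<^sup>2\<close> only inside, \<open>\<Delta>w = w\<^sub>t - R\<close> is known to be integrable
  only at the times at which \<open>R\<close> is square integrable. The boundary term therefore needs the divergence theorem for
  fields that are continuous up to the boundary and have integrable divergence. In a chart it
  follows by multiplying the field with a cutoff that vanishes in a thin collar of the boundary: the
  derivative of the cutoff tends to the surface element. The inequality \<open>\<integral>\<^sub>D div F \<le> \<integral>\<^sub>\<partial>\<^sub>D |F|\<close> is
  additive under splittings \<open>F = \<eta>F + (1 - \<eta>)F\<close> and hence passes from charts to \<open>D\<close>; it only uses
  that the surface measure dominates the measure of each chart. The surface measure is a
  supremum over uncountably many charts, and its real-valued measure and integrals would be \<open>0\<close> if it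
  were infinite; it is finite because any chart measure is locally at most twice any other.
\<close>

section \<open>Smoothness of the networks\<close>

text \<open>An infinite residual integral makes the right-hand side infinite, so the work concerns
  finite ones; the residual is then square integrable at almost every time, but perhaps not at all
  times. The energy identity is therefore obtained by integrating the time derivative of
  \<open>w\<^sup>2\<close> for each fixed x and exchanging the integrals, and Gronwall enters in
  integral form. The constants arise as follows. The spatial gradient of w on the boundary is
  bounded by the sum of the two \<open>C1_norm\<close> values, which plays the role of
  \<open>K\<close>. Cauchy-Schwarz on the boundary contributes the root of its measure, and
  Cauchy-Schwarz in time the root of the block length. The factor 2 at the initial residuals and in
  the recursion is that of (a + b)^2 <= 2 a^2 + 2 b^2. Chart measures are compared without a change
  of coordinates between charts: testing with fields of constant direction loses a constant factor,
  which is harmless because only finiteness of the supremum is wanted.\<close>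

lemma Ck_fun_SucI:
  assumes "\<And>x. (f has_derivative f' x) (at x)" "\<And>b. b \<in> Basis \<Longrightarrow> Ck_fun k (\<lambda>x. f' x b)"
  shows "Ck_fun (Suc k) f"
proof -
  have *: "frechet_derivative f (at x) = f' x" for x
    by (rule frechet_derivative_at[OF assms(1), symmetric])
  show ?thesis
    unfolding Ck_fun.simps(2) * using assms(2) differentiableI[OF assms(1)] by blast
qed

lemma Ck_fun_SucD:
  assumes "Ck_fun (Suc k) f"
  shows "(f has_derivative frechet_derivative f (at x)) (at x)"
    and "b \<in> Basis \<Longrightarrow> Ck_fun k (\<lambda>x. frechet_derivative f (at x) b)"
proof -
  have "f differentiable (at x)" and *: "\<forall>b\<in>Basis. Ck_fun k (\<lambda>x. frechet_derivative f (at x) b)"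
    using assms unfolding Ck_fun.simps(2) by blast+
  then show "(f has_derivative frechet_derivative f (at x)) (at x)"
    using frechet_derivative_works by blast
  show "Ck_fun k (\<lambda>x. frechet_derivative f (at x) b)" if "b \<in> Basis"
    using * that by blast
qed

lemma Ck_fun_lower: "Ck_fun (Suc k) f \<Longrightarrow> Ck_fun k f"
proof (induction k arbitrary: f)
  case 0
  then have "\<And>x. f differentiable (at x)" unfolding Ck_fun.simps(2) by blast
  then show ?case
    unfolding Ck_fun.simps(1) by (meson continuous_at_imp_continuous_on differentiable_imp_continuous_within)
next
  case (Suc k)
  have "\<forall>b\<in>Basis. Ck_fun k (\<lambda>x. frechet_derivative f (at x) b)"
    using Suc.prems by (intro ballI Suc.IH) simp
  with Suc.prems show ?case unfolding Ck_fun.simps(2) by blast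
qed

lemma Ck_fun_antimono: "j \<le> k \<Longrightarrow> Ck_fun k f \<Longrightarrow> Ck_fun j f"
proof (induction k rule: dec_induct)
  case (step n)
  show ?case by (rule step.IH[OF Ck_fun_lower[OF step.prems]])
qed

lemma Ck_fun_continuous_on: "Ck_fun k f \<Longrightarrow> continuous_on S f"
  using Ck_fun_antimono[of 0 k f] continuous_on_subset[of UNIV f S] by auto

lemma Ck_fun_const: "Ck_fun k (\<lambda>x. c)"
proof (induction k arbitrary: c)
  case (Suc k)
  show ?case by (rule Ck_fun_SucI[OF has_derivative_const Suc.IH])
qed simp

lemma Ck_fun_linear: "bounded_linear f \<Longrightarrow> Ck_fun k f"
proof (induction k)
  case 0
  then show ?case by (simp add: linear_continuous_on)
next
  case (Suc k)
  show ?case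
    by (rule Ck_fun_SucI[where f' = "\<lambda>x. f"])
      (intro bounded_linear_imp_has_derivative Suc.prems Ck_fun_const)+
qed

lemma Ck_fun_add: "Ck_fun k f \<Longrightarrow> Ck_fun k g \<Longrightarrow> Ck_fun k (\<lambda>x. f x + g x)"
proof (induction k arbitrary: f g)
  case 0
  then show ?case by (simp add: continuous_on_add)
next
  case (Suc k)
  show ?case
    by (rule Ck_fun_SucI[OF has_derivative_add[OF Ck_fun_SucD(1)[OF Suc.prems(1)]
            Ck_fun_SucD(1)[OF Suc.prems(2)]]])
      (intro Suc.IH Ck_fun_SucD(2)[OF Suc.prems(1)] Ck_fun_SucD(2)[OF Suc.prems(2)])
qed

lemma Ck_fun_mult: "Ck_fun k f \<Longrightarrow> Ck_fun k g \<Longrightarrow> Ck_fun k (\<lambda>x. f x * g x)"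
proof (induction k arbitrary: f g)
  case 0
  then show ?case by (simp add: continuous_on_mult)
next
  case (Suc k)
  show ?case
    by (rule Ck_fun_SucI[OF has_derivative_mult[OF Ck_fun_SucD(1)[OF Suc.prems(1)]
            Ck_fun_SucD(1)[OF Suc.prems(2)]]])
      (intro Ck_fun_add Suc.IH Ck_fun_lower[OF Suc.prems(1)] Ck_fun_lower[OF Suc.prems(2)]
        Ck_fun_SucD(2)[OF Suc.prems(1)] Ck_fun_SucD(2)[OF Suc.prems(2)])
qed

lemma Ck_fun_sum: "(\<And>i. i \<in> I \<Longrightarrow> Ck_fun k (f i)) \<Longrightarrow> Ck_fun k (\<lambda>x. \<Sum>i\<in>I. f i x)"
  by (induction I rule: infinite_finite_induct) (simp_all add: Ck_fun_const Ck_fun_add del: Ck_fun.simps)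

lemma smooth_real_deriv: "smooth_real g \<Longrightarrow> smooth_real (deriv g)"
  unfolding smooth_real_def by (metis funpow_Suc_right o_apply)

text \<open>Differentiation replaces \<open>g\<close> by \<open>deriv g\<close> and leaves a product
  with a derivative of \<open>f\<close>, so the induction has to run over all smooth
  \<open>g\<close> at once.\<close>

lemma Ck_fun_compose: "smooth_real g \<Longrightarrow> Ck_fun k f \<Longrightarrow> Ck_fun k (\<lambda>x. g (f x))"
proof (induction k arbitrary: f g)
  case (0 f g)
  have "g field_differentiable at x" for x
    using 0 unfolding smooth_real_def by (metis funpow_0)
  then have "continuous_on UNIV g"
    using field_differentiable_imp_continuous_at by (auto simp: continuous_on_eq_continuous_at)
  with 0 show ?case
    using continuous_on_compose2[of UNIV g UNIV f] by auto
next
  case (Suc k)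
  have "g field_differentiable at x" for x
    using Suc.prems unfolding smooth_real_def by (metis funpow_0)
  then have g: "(g has_derivative (*) (deriv g x)) (at x)" for x
    using field_differentiable_derivI has_field_derivative_def by blast
  show ?case
    by (rule Ck_fun_SucI[OF has_derivative_compose[OF Ck_fun_SucD(1)[OF Suc.prems(2)] g]])
      (rule Ck_fun_mult[OF Suc.IH[OF smooth_real_deriv[OF Suc.prems(1)]
            Ck_fun_lower[OF Suc.prems(2)]] Ck_fun_SucD(2)[OF Suc.prems(2)]])
qed

text \<open>Because tanh' = 1 - tanh^2, the polynomials in tanh are closed under differentiation:
  \<open>p\<close> turns into p' * (1 - X^2).\<close>

lemma funpow_deriv_tanh: "\<exists>p. (deriv ^^ n) (tanh :: real \<Rightarrow> real) = (\<lambda>x. poly p (tanh x))"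
proof (induction n)
  case 0
  show ?case by (rule exI[of _ "[:0, 1:]"]) auto
next
  case (Suc n)
  then obtain p where p: "(deriv ^^ n) (tanh :: real \<Rightarrow> real) = (\<lambda>x. poly p (tanh x))" by blast
  have "((\<lambda>x. poly p (tanh x)) has_field_derivative
      poly (pderiv p * [:1, 0, -1:]) (tanh x)) (at x)" for x :: real
    by (rule derivative_eq_intros refl | simp add: power2_eq_square algebra_simps)+
  then have "deriv (\<lambda>x. poly p (tanh x)) = (\<lambda>x::real. poly (pderiv p * [:1, 0, -1:]) (tanh x))"
    by (intro ext DERIV_imp_deriv)
  with p show ?case by (metis comp_apply funpow.simps(2))
qed

lemma smooth_real_tanh: "smooth_real tanh"
  unfolding smooth_real_def
proof (intro allI)
  fix n and x :: real
  obtain p where p: "(deriv ^^ n) (tanh :: real \<Rightarrow> real) = (\<lambda>x. poly p (tanh x))"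
    using funpow_deriv_tanh by blast
  have "((\<lambda>x. poly p (tanh x)) has_field_derivative
      poly (pderiv p * [:1, 0, -1:]) (tanh x)) (at x)" for x :: real
    by (rule derivative_eq_intros refl | simp add: power2_eq_square algebra_simps)+
  then show "(deriv ^^ n) tanh field_differentiable at x"
    unfolding p field_differentiable_def by blast
qed

lemma Ck_fun_hidden:
  assumes "is_HLConcPINN n1 n2 \<theta>"
  shows "m < depth \<theta> \<Longrightarrow> Ck_fun k (\<lambda>z::'b::euclidean_space. hidden \<theta> m z p)"
proof (induction m arbitrary: p)
  case 0
  show ?case
    unfolding hidden.simps coordinate_def by (intro Ck_fun_linear bounded_linear_inner_left)
next
  case (Suc m)
  have "smooth_real (activation \<theta> (Suc m))"
  proof -
    have "Suc m = 1 \<or> Suc m = 2 \<or> 3 \<le> Suc m" by linarith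
    then show ?thesis
      using assms Suc.prems smooth_real_tanh unfolding is_HLConcPINN_def by metis
  qed
  moreover have "Ck_fun k (\<lambda>z::'b. hidden \<theta> m z q)" for q
    by (rule Suc.IH[OF Suc_lessD[OF Suc.prems]])
  ultimately show ?case
    unfolding hidden.simps
    by (intro Ck_fun_compose[of "activation \<theta> (Suc m)"] Ck_fun_add Ck_fun_sum Ck_fun_mult Ck_fun_const)
qed

lemma Ck_fun_net:
  assumes "is_HLConcPINN n1 n2 \<theta>"
  shows "Ck_fun k (net \<theta>)"
proof -
  \<comment> \<open>The output reads the layers up to \<open>depth \<theta> - 1\<close>, exactly the
    range in which the activations are known to be smooth.\<close>
  have "m < depth \<theta>" if "m \<in> {1..depth \<theta> - 1}" for m
    using that assms by (auto simp: is_HLConcPINN_def)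
  then show ?thesis
    unfolding net_def[abs_def] hlconc_output_def
    by (intro Ck_fun_add Ck_fun_sum Ck_fun_mult Ck_fun_const Ck_fun_hidden[OF assms]) auto
qed

section \<open>Divergences of compactly supported fields\<close>

text \<open>Difference quotients integrate to 0 by translation invariance, and they converge to the
  derivative under an integrable bound.\<close>

lemma integral_partial_derivative_eq_0:
  fixes \<psi> :: "'a::euclidean_space \<Rightarrow> real"
  assumes der: "\<And>x. (\<psi> has_derivative \<psi>' x) (at x)"
    and cont: "continuous_on UNIV (\<lambda>x. \<psi>' x b)"
    and supp: "\<And>x. R < norm x \<Longrightarrow> \<psi> x = 0"
  shows "integrable lborel (\<lambda>x. \<psi>' x b)" and "integral\<^sup>L lborel (\<lambda>x. \<psi>' x b) = 0"
proof -
  define g where "g = (\<lambda>x. \<psi>' x b)"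
  have g0: "g x = 0" if "R < norm x" for x
  proof -
    have "open {x::'a. R < norm x}" by (intro open_Collect_less continuous_intros)
    then have "((\<lambda>_. 0) has_derivative \<psi>' x) (at x)"
      using that supp by (intro has_derivative_transform_within_open[OF der]) auto
    then have "\<psi>' x = (\<lambda>h. 0)"
      using has_derivative_unique has_derivative_const by blast
    then show ?thesis by (simp add: g_def)
  qed
  have cont_g: "continuous_on UNIV g" using cont by (simp add: g_def)
  have intS: "integrable lborel f" if "continuous_on UNIV f" "\<And>x. r < norm x \<Longrightarrow> f x = 0"
    for f :: "'a \<Rightarrow> real" and r
  proof -
    have "integrable lborel (\<lambda>x. indicator (cball 0 r) x *\<^sub>R f x)"
      using that(1) by (intro borel_integrable_compact) (auto intro: continuous_on_subset)
    moreover have "(\<lambda>x. indicator (cball 0 r) x *\<^sub>R f x) = f"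
      using that(2) by (force simp: indicator_def fun_eq_iff)
    ultimately show ?thesis by simp
  qed
  show int_g: "integrable lborel (\<lambda>x. \<psi>' x b)"
    using intS[OF cont_g g0] by (simp add: g_def)
  have cont_psi: "continuous_on UNIV \<psi>"
    using der by (meson continuous_at_imp_continuous_on has_derivative_continuous)
  obtain C where C: "\<And>x. \<bar>g x\<bar> \<le> C"
  proof -
    obtain C where C: "0 \<le> C" "\<And>x. x \<in> cball 0 R \<Longrightarrow> norm (g x) \<le> C"
      by (rule continuous_on_compact_bound[OF compact_cball[of 0 R] continuous_on_subset[OF cont_g subset_UNIV]]) (rule that)
    have "\<bar>g x\<bar> \<le> C" for x
      using C(1) C(2)[of x] g0[of x] by (cases "norm x \<le> R") auto
    then show thesis by (rule that)
  qed
  define h where "h = (\<lambda>n::nat. 1 / real (Suc n))"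
  define f where "f = (\<lambda>n x. (\<psi> (x + h n *\<^sub>R b) - \<psi> x) / h n)"
  have hpos: "0 < h n" "h n \<le> 1" for n by (auto simp: h_def)
  have line: "((\<lambda>s. \<psi> (x + s *\<^sub>R b)) has_real_derivative g (x + s *\<^sub>R b)) (at s)" for x s
  proof -
    have "((\<lambda>s. \<psi> (x + s *\<^sub>R b)) has_derivative (\<lambda>r. \<psi>' (x + s *\<^sub>R b) (r *\<^sub>R b))) (at s)"
      by (rule has_derivative_compose[OF _ der, where f = "\<lambda>s. x + s *\<^sub>R b"])
        (auto intro!: derivative_eq_intros)
    moreover have "\<psi>' y (r *\<^sub>R b) = g y * r" for y r
      using linear_cmul[OF has_derivative_linear[OF der]] by (simp add: g_def)
    ultimately show ?thesis by (simp add: has_field_derivative_def)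
  qed
  have lim: "(\<lambda>n. f n x) \<longlonglongrightarrow> g x" for x
  proof -
    have "((\<lambda>s. (\<psi> (x + s *\<^sub>R b) - \<psi> x) / s) \<longlongrightarrow> g x) (at 0)"
      using line[of x 0] by (simp add: DERIV_def)
    moreover have "filterlim h (at 0) sequentially"
      unfolding filterlim_at using LIMSEQ_Suc[OF lim_1_over_n, where ?'a1 = real] hpos
      by (auto simp: h_def intro!: always_eventually)
    ultimately show ?thesis
      unfolding f_def using filterlim_compose by blast
  qed
  \<comment> \<open>The mean value theorem bounds the quotient by the maximum of the derivative.
    Since \<open>h n \<le> 1\<close>, the support grows by at most \<open>norm b\<close>.\<close>
  have bd: "norm (f n x) \<le> C * indicator (cball 0 (R + norm b)) x" for n x
  proof (cases "norm x \<le> R + norm b")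
    case True
    obtain s where "0 < s" "s < h n" and s: "\<psi> (x + h n *\<^sub>R b) - \<psi> (x + 0 *\<^sub>R b) = (h n - 0) * g (x + s *\<^sub>R b)"
      using MVT2[OF hpos(1)[of n], of "\<lambda>s. \<psi> (x + s *\<^sub>R b)" "\<lambda>s. g (x + s *\<^sub>R b)"] line by blast
    then have "f n x = g (x + s *\<^sub>R b)"
      using hpos[of n] by (simp add: f_def)
    then show ?thesis using C[of "x + s *\<^sub>R b"] True by simp
  next
    case False
    have "norm (h n *\<^sub>R b) \<le> norm b"
      using hpos[of n] by (simp add: mult_left_le_one_le)
    then have "R < norm (x + h n *\<^sub>R b)"
      using False norm_triangle_ineq2[of x "- (h n *\<^sub>R b)"] by simp
    moreover have "R < norm x" using False norm_ge_zero[of b] by linarith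
    ultimately show ?thesis using False supp by (simp add: f_def)
  qed
  have int_psi: "integrable lborel \<psi>" by (rule intS[OF cont_psi supp])
  have "integral\<^sup>L lborel (f n) = 0" for n
  proof -
    have meas: "\<psi> \<in> borel_measurable borel"
      using cont_psi borel_measurable_continuous_onI by blast
    have eq: "distr lborel borel (\<lambda>x. x + h n *\<^sub>R b) = lborel"
      using lborel_distr_plus[of "h n *\<^sub>R b"] unfolding add.commute[of "h n *\<^sub>R b"] .
    have "integrable (distr lborel borel (\<lambda>x. x + h n *\<^sub>R b)) \<psi>"
      using int_psi eq by simp
    then have 1: "integrable lborel (\<lambda>x. \<psi> (x + h n *\<^sub>R b))"
      by (subst (asm) integrable_distr_eq) (use meas in auto)
    have 2: "integral\<^sup>L lborel (\<lambda>x. \<psi> (x + h n *\<^sub>R b)) = integral\<^sup>L lborel \<psi>"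
      using integral_distr[of "\<lambda>x. x + h n *\<^sub>R b" lborel borel \<psi>] meas eq by simp
    show ?thesis unfolding f_def using 1 2 int_psi by simp
  qed
  moreover have "(\<lambda>n. integral\<^sup>L lborel (f n)) \<longlonglongrightarrow> integral\<^sup>L lborel g"
  proof (rule integral_dominated_convergence[where w = "\<lambda>x. C * indicator (cball 0 (R + norm b)) x"])
    show "integrable lborel (\<lambda>x. C * indicator (cball 0 (R + norm b)) x)"
      using integrable_real_indicator[of "cball 0 (R + norm b)" lborel] emeasure_lborel_cball_finite[of 0 "R + norm b"]
      by (intro integrable_mult_right) auto
    have [measurable]: "\<psi> \<in> borel_measurable borel"
      using cont_psi borel_measurable_continuous_onI by blast
    show "f n \<in> borel_measurable lborel" for n
      unfolding f_def by measurable
    show "g \<in> borel_measurable lborel"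
      using cont_g borel_measurable_continuous_onI by auto
  qed (use lim bd in auto)
  ultimately have "integral\<^sup>L lborel g = 0"
    by (simp add: LIMSEQ_const_iff)
  then show "integral\<^sup>L lborel (\<lambda>x. \<psi>' x b) = 0" by (simp add: g_def)
qed

text \<open>A field that vanishes in \<open>D\<close> near the frontier stays differentiable when
  extended by 0 to the whole space. Each diagonal entry of the derivative of the extension then
  integrates to 0.\<close>

lemma set_integral_divergence_eq_0:
  fixes H :: "'a::euclidean_space \<Rightarrow> 'a"
  assumes D: "open D" "bounded D" and N: "open N" "frontier D \<subseteq> N"
    and der: "\<And>x. x \<in> D \<Longrightarrow> (H has_derivative H' x) (at x)"
    and cont: "\<And>b. b \<in> Basis \<Longrightarrow> continuous_on D (\<lambda>x. H' x b \<bullet> b)"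
    and zero: "\<And>x. x \<in> D \<Longrightarrow> x \<in> N \<Longrightarrow> H x = 0"
  shows "set_integrable lborel D (\<lambda>x. \<Sum>b\<in>Basis. H' x b \<bullet> b)"
    and "(LINT x:D|lborel. \<Sum>b\<in>Basis. H' x b \<bullet> b) = 0"
proof -
  define K where "K = (\<lambda>x. if x \<in> D then H x else 0)"
  define K' where "K' = (\<lambda>x h. if x \<in> D then H' x h else 0)"
  \<comment> \<open>A point outside \<open>D\<close> lies on the frontier or outside the closure, so
    this open set and \<open>D\<close> cover the space, and the extension vanishes on it.\<close>
  define E where "E = N \<union> (- closure D)"
  have E: "open E" "D \<union> E = UNIV" using N D by (auto simp: E_def frontier_def interior_open)
  have zeroE: "K x = 0" if "x \<in> E" for x
    using that zero closure_subset[of D] by (auto simp: K_def E_def)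
  have derE: "K' x = (\<lambda>h. 0)" if "x \<in> E" for x
  proof (cases "x \<in> D")
    case True
    have "((\<lambda>_. 0) has_derivative H' x) (at x)"
    proof (rule has_derivative_transform_within_open[OF der[OF True], of "D \<inter> E"])
      show "H y = 0" if "y \<in> D \<inter> E" for y
        using zeroE[of y] that by (simp add: K_def)
    qed (use that True E D in auto)
    then have "H' x = (\<lambda>h. 0)"
      using has_derivative_unique has_derivative_const by blast
    then show ?thesis by (auto simp: K'_def fun_eq_iff)
  qed (simp add: K'_def)
  have derK: "(K has_derivative K' x) (at x)" for x
  proof (cases "x \<in> D")
    case True
    have "(K has_derivative H' x) (at x)"
      by (rule has_derivative_transform_within_open[OF der[OF True] D(1) True]) (simp add: K_def)
    then show ?thesis using True by (simp add: K'_def)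
  next
    case False
    then have x: "x \<in> E" using E by blast
    have "((\<lambda>x. 0) has_derivative K' x) (at x)"
      using derE[OF x] by simp
    then show ?thesis
      by (rule has_derivative_transform_within_open[OF _ E(1) x]) (simp add: zeroE)
  qed
  obtain R where R: "\<And>x. x \<in> D \<Longrightarrow> norm x \<le> R"
    using D(2) by (auto simp: bounded_iff)
  have b: "integrable lborel (\<lambda>x. K' x b \<bullet> b) \<and> integral\<^sup>L lborel (\<lambda>x. K' x b \<bullet> b) = 0"
    if "b \<in> Basis" for b
  proof -
    have "continuous_on D (\<lambda>x. K' x b \<bullet> b)"
      using cont[OF that] by (rule continuous_on_eq) (simp add: K'_def)
    moreover have "continuous_on E (\<lambda>x. K' x b \<bullet> b)"
      by (rule continuous_on_eq[of _ "\<lambda>x. 0"]) (auto simp: derE)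
    ultimately have c: "continuous_on UNIV (\<lambda>x. K' x b \<bullet> b)"
      using continuous_on_open_Un[OF D(1) E(1)] E(2) by metis
    have "((\<lambda>x. K x \<bullet> b) has_derivative (\<lambda>h. K' x h \<bullet> b)) (at x)" for x
      by (intro has_derivative_inner_left derK)
    moreover have "K x \<bullet> b = 0" if "R < norm x" for x
      using R[of x] that by (auto simp: K_def)
    ultimately show ?thesis
      using integral_partial_derivative_eq_0[of "\<lambda>x. K x \<bullet> b" "\<lambda>x h. K' x h \<bullet> b" b R] c by blast
  qed
  have eq: "indicat_real D x *\<^sub>R (\<Sum>b\<in>Basis. H' x b \<bullet> b) = (\<Sum>b\<in>Basis. K' x b \<bullet> b)" for x
    by (auto simp: K'_def indicator_def)
  have b1: "integrable lborel (\<lambda>x. K' x b \<bullet> b)" if "b \<in> Basis" for b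
    using b[OF that] ..
  show "set_integrable lborel D (\<lambda>x. \<Sum>b\<in>Basis. H' x b \<bullet> b)"
    unfolding set_integrable_def eq by (rule Bochner_Integration.integrable_sum[OF b1])
  show "(LINT x:D|lborel. \<Sum>b\<in>Basis. H' x b \<bullet> b) = 0"
    unfolding set_lebesgue_integral_def eq
    by (rule trans[OF Bochner_Integration.integral_sum[OF b1] sum.neutral]) (use b in simp_all)
qed

section \<open>Slicing Lebesgue measure along a coordinate axis\<close>

lemma axis_norm: "e \<in> Basis \<union> uminus ` Basis \<Longrightarrow> norm e = 1"
  by auto

text \<open>The negative of a basis vector is never a basis vector, so removing \<open>e\<close> and
  \<open>- e\<close> deletes one coordinate. Arguments about a chart axis of either sign can thus be
  made for a genuine basis vector.\<close>

lemma axis_Basis: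
  fixes e :: "'a::euclidean_space"
  assumes "e \<in> Basis \<union> uminus ` Basis"
  obtains e0 where "e0 \<in> Basis" "e = e0 \<or> e = - e0" "Basis - {e, - e} = Basis - {e0}"
proof -
  obtain e0 where e0: "e0 \<in> Basis" "e = e0 \<or> e = - e0" using assms by auto
  have "- e0 \<notin> Basis"
  proof
    assume "- e0 \<in> Basis"
    then have "- e0 \<bullet> e0 = (if - e0 = e0 then 1 else 0)" using e0(1) by (rule inner_Basis)
    then show False using e0(1) by (auto split: if_splits)
  qed
  then have "Basis - {e, - e} = Basis - {e0}" using e0(2) by auto
  with e0 that show thesis by blast
qed

lemma sets_hyperplane_lborel [simp, measurable_cong]: "sets (hyperplane_lborel e) = sets borel"
  by (simp add: hyperplane_lborel_def)

lemma space_hyperplane_lborel [simp]: "space (hyperplane_lborel e) = UNIV"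
  by (simp add: hyperplane_lborel_def)

lemma measurable_hyperplane_embedding [measurable]:
  "(\<lambda>c. \<Sum>b\<in>B. c b *\<^sub>R (b::'a::euclidean_space)) \<in> borel_measurable (\<Pi>\<^sub>M b\<in>B. (lborel :: real measure))"
proof (intro borel_measurable_sum borel_measurable_scaleR borel_measurable_const)
  show "(\<lambda>c. c b) \<in> borel_measurable (\<Pi>\<^sub>M b\<in>B. (lborel :: real measure))" if "b \<in> B" for b
    using measurable_component_singleton[OF that, of "\<lambda>_. lborel :: real measure"] by simp
qed

text \<open>The hyperplane measure lives on the whole space; this is how its concentration on the
  hyperplane becomes available. Chart facts that require \<open>y \<bullet> e = 0\<close> are used
  almost everywhere through it.\<close>

lemma AE_hyperplane_lborel: "AE y in hyperplane_lborel (e::'a::euclidean_space). y \<bullet> e = 0"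
  if "e \<in> Basis \<union> uminus ` Basis"
proof -
  obtain e0 where e0: "e0 \<in> Basis" "e = e0 \<or> e = - e0" "Basis - {e, - e} = Basis - {e0}"
    using axis_Basis[OF \<open>e \<in> _\<close>] .
  have "(\<Sum>b\<in>Basis - {e0}. c b *\<^sub>R b) \<bullet> e0 = 0" for c :: "'a \<Rightarrow> real"
    using e0(1) by (auto simp: inner_sum_left inner_Basis intro!: sum.neutral)
  then have *: "(\<Sum>b\<in>Basis - {e0}. c b *\<^sub>R b) \<bullet> e = 0" for c :: "'a \<Rightarrow> real"
    using e0(2) by auto
  show ?thesis
    unfolding hyperplane_lborel_def e0(3)
    by (subst AE_distr_iff) (auto simp: *)
qed

text \<open>Lebesgue measure is the image of a product measure in coordinates; Tonelli splits off
  the coordinate of the chart axis.\<close>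

lemma nn_integral_lborel_hyperplane:
  fixes f :: "'a::euclidean_space \<Rightarrow> ennreal"
  assumes e: "e \<in> Basis \<union> uminus ` Basis" and [measurable]: "f \<in> borel_measurable borel"
  shows "(\<integral>\<^sup>+x. f x \<partial>lborel) = (\<integral>\<^sup>+y. \<integral>\<^sup>+s. f (y + s *\<^sub>R e) \<partial>lborel \<partial>hyperplane_lborel e)"
proof -
  interpret product_sigma_finite "\<lambda>_::'a. lborel :: real measure" by standard
  obtain e0 where e0: "e0 \<in> Basis" "e = e0 \<or> e = - e0" "Basis - {e, - e} = Basis - {e0}"
    using axis_Basis[OF e] .
  define B where "B = Basis - {e0}"
  have B: "finite B" "e0 \<notin> B" "insert e0 B = Basis" using e0 by (auto simp: B_def)
  have "(\<integral>\<^sup>+x. f x \<partial>lborel) = (\<integral>\<^sup>+c. f (\<Sum>b\<in>Basis. c b *\<^sub>R b) \<partial>(\<Pi>\<^sub>M b\<in>Basis. (lborel :: real measure)))"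
    by (subst lborel_def) (simp add: nn_integral_distr lborel_eq_real[symmetric])
  also have "\<dots> = (\<integral>\<^sup>+c. \<integral>\<^sup>+s. f (\<Sum>b\<in>insert e0 B. (c(e0 := s)) b *\<^sub>R b) \<partial>lborel \<partial>(\<Pi>\<^sub>M b\<in>B. (lborel :: real measure)))"
    unfolding B(3)[symmetric] by (rule product_nn_integral_insert) (use B in auto)
  also have "\<dots> = (\<integral>\<^sup>+c. \<integral>\<^sup>+s. f ((\<Sum>b\<in>B. c b *\<^sub>R b) + s *\<^sub>R e0) \<partial>lborel \<partial>(\<Pi>\<^sub>M b\<in>B. (lborel :: real measure)))"
  proof -
    have "(\<Sum>b\<in>insert e0 B. (c(e0 := s)) b *\<^sub>R b) = (\<Sum>b\<in>B. c b *\<^sub>R b) + s *\<^sub>R e0" for c s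
      using B(1,2) by (subst sum.insert) (auto simp: add.commute intro!: sum.cong arg_cong2[where f = "(+)"])
    then show ?thesis by simp
  qed
  also have "\<dots> = (\<integral>\<^sup>+y. \<integral>\<^sup>+s. f (y + s *\<^sub>R e0) \<partial>lborel \<partial>hyperplane_lborel e)"
    unfolding hyperplane_lborel_def e0(3) B_def[symmetric] by (subst nn_integral_distr) auto
  also have "\<dots> = (\<integral>\<^sup>+y. \<integral>\<^sup>+s. f (y + s *\<^sub>R e) \<partial>lborel \<partial>hyperplane_lborel e)"
  proof -
    \<comment> \<open>The reflection of the real line takes care of an axis with reversed
      sign.\<close>
    have "(\<integral>\<^sup>+s. f (y + s *\<^sub>R e0) \<partial>lborel) = (\<integral>\<^sup>+s. f (y + s *\<^sub>R (- e0)) \<partial>lborel)" for y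
      using nn_integral_real_affine[of "\<lambda>s. f (y + s *\<^sub>R e0)" "-1" 0] by simp
    then show ?thesis using e0(2) by auto
  qed
  finally show ?thesis .
qed

text \<open>Thickening the disc by the unit interval along \<open>e\<close> gives a set of the same
  measure inside the ball of radius \<open>r + 1\<close>, which has finite Lebesgue measure.\<close>

lemma emeasure_hyperplane_cball_finite:
  fixes e :: "'a::euclidean_space"
  assumes e: "e \<in> Basis \<union> uminus ` Basis"
  shows "emeasure (hyperplane_lborel e) (cball 0 r) < \<infinity>"
proof -
  have "emeasure (hyperplane_lborel e) (cball 0 r) =
      (\<integral>\<^sup>+y. indicator (cball 0 r) y * (\<integral>\<^sup>+s. indicator {0..1::real} s \<partial>lborel) \<partial>hyperplane_lborel e)"
    by simp
  also have "\<dots> \<le> (\<integral>\<^sup>+y. \<integral>\<^sup>+s. indicator (cball 0 (r + 1)) (y + s *\<^sub>R e) \<partial>lborel \<partial>hyperplane_lborel e)"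
  proof (rule nn_integral_mono)
    fix y :: 'a
    have "norm (y + s *\<^sub>R e) \<le> r + 1" if "norm y \<le> r" "0 \<le> s" "s \<le> 1" for s
      using norm_triangle_ineq[of y "s *\<^sub>R e"] axis_norm[OF e] that by simp
    then have "indicator (cball 0 r) y * indicator {0..1::real} s
        \<le> (indicator (cball 0 (r + 1)) (y + s *\<^sub>R e) :: ennreal)" for s
      by (auto simp: indicator_def)
    then have "(\<integral>\<^sup>+s. indicator (cball 0 r) y * indicator {0..1::real} s \<partial>lborel)
        \<le> (\<integral>\<^sup>+s. indicator (cball 0 (r + 1)) (y + s *\<^sub>R e) \<partial>lborel)"
      by (rule nn_integral_mono)
    then show "indicator (cball 0 r) y * (\<integral>\<^sup>+s. indicator {0..1::real} s \<partial>lborel)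
        \<le> (\<integral>\<^sup>+s. indicator (cball 0 (r + 1)) (y + s *\<^sub>R e) \<partial>lborel)"
      by (subst (asm) nn_integral_cmult) auto
  qed
  also have "\<dots> = emeasure lborel (cball 0 (r + 1) :: 'a set)"
    by (subst nn_integral_lborel_hyperplane[OF e, symmetric])
      (auto intro: borel_measurable_indicator)
  also have "\<dots> < \<infinity>"
    using emeasure_bounded_finite[OF bounded_cball, of "0::'a" "r + 1"] by simp
  finally show ?thesis .
qed

lemma sigma_finite_hyperplane:
  fixes e :: "'a::euclidean_space"
  assumes e: "e \<in> Basis \<union> uminus ` Basis"
  shows "sigma_finite_measure (hyperplane_lborel e)"
proof
  have "\<exists>n. norm x \<le> real n" for x :: 'a by (rule real_arch_simple)
  then show "\<exists>A. countable A \<and> A \<subseteq> sets (hyperplane_lborel e) \<and> \<Union> A = space (hyperplane_lborel e) \<and>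
      (\<forall>a\<in>A. emeasure (hyperplane_lborel e) a \<noteq> \<infinity>)"
    using emeasure_hyperplane_cball_finite[OF e]
    by (intro exI[of _ "range (\<lambda>n. cball 0 (real n))"]) (auto simp: less_top[symmetric])
qed

text \<open>Collar coordinates: the second variable is the height above the graph in units of
  \<epsilon>. A collar whose width is proportional to \<epsilon> thus occupies a fixed region of
  coordinates while \<epsilon> tends to 0.\<close>

definition graph_shift :: "'a::euclidean_space \<Rightarrow> ('a \<Rightarrow> real) \<Rightarrow> real \<Rightarrow> 'a \<times> real \<Rightarrow> 'a" where
  "graph_shift e \<gamma> \<epsilon> = (\<lambda>(y, r). y + (\<gamma> y + \<epsilon> * r) *\<^sub>R e)"

lemma measurable_graph_shift [measurable]:
  assumes [measurable]: "\<gamma> \<in> borel_measurable borel"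
  shows "graph_shift e \<gamma> \<epsilon> \<in> borel_measurable (hyperplane_lborel e \<Otimes>\<^sub>M lborel)"
  unfolding graph_shift_def by measurable

text \<open>On each line in direction \<open>e\<close> the map is an affine substitution with slope
  \<epsilon>; the translation by \<open>\<gamma> y\<close> does not change the measure.\<close>

lemma lborel_eq_graph_shift:
  fixes e :: "'a::euclidean_space"
  assumes e: "e \<in> Basis \<union> uminus ` Basis" and [measurable]: "\<gamma> \<in> borel_measurable borel" and eps: "0 < \<epsilon>"
  shows "lborel = density (distr (hyperplane_lborel e \<Otimes>\<^sub>M lborel) borel (graph_shift e \<gamma> \<epsilon>)) (\<lambda>_. ennreal \<epsilon>)"
proof (rule measure_eqI)
  interpret sigma_finite_measure "hyperplane_lborel e" by (rule sigma_finite_hyperplane[OF e])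
  fix A :: "'a set" assume "A \<in> sets lborel"
  then have A [measurable]: "A \<in> sets borel" by simp
  have "emeasure lborel A = (\<integral>\<^sup>+x. indicator A x \<partial>lborel)" by simp
  also have "\<dots> = (\<integral>\<^sup>+y. \<integral>\<^sup>+s. indicator A (y + s *\<^sub>R e) \<partial>lborel \<partial>hyperplane_lborel e)"
    by (rule nn_integral_lborel_hyperplane[OF e]) auto
  also have "\<dots> = (\<integral>\<^sup>+y. ennreal \<epsilon> * (\<integral>\<^sup>+r. indicator A (graph_shift e \<gamma> \<epsilon> (y, r)) \<partial>lborel) \<partial>hyperplane_lborel e)"
  proof (rule nn_integral_cong)
    fix y
    show "(\<integral>\<^sup>+s. indicator A (y + s *\<^sub>R e) \<partial>lborel) =
        ennreal \<epsilon> * (\<integral>\<^sup>+r. indicator A (graph_shift e \<gamma> \<epsilon> (y, r)) \<partial>lborel)"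
      using eps by (subst nn_integral_real_affine[of _ \<epsilon> "\<gamma> y"]) (auto simp: graph_shift_def)
  qed
  also have "\<dots> = ennreal \<epsilon> * (\<integral>\<^sup>+y. \<integral>\<^sup>+r. indicator A (graph_shift e \<gamma> \<epsilon> (y, r)) \<partial>lborel \<partial>hyperplane_lborel e)"
    by (rule nn_integral_cmult) measurable
  also have "\<dots> = ennreal \<epsilon> * (\<integral>\<^sup>+z. indicator A (graph_shift e \<gamma> \<epsilon> z) \<partial>(hyperplane_lborel e \<Otimes>\<^sub>M lborel))"
    by (subst lborel.nn_integral_fst) auto
  also have "\<dots> = ennreal \<epsilon> * (\<integral>\<^sup>+x. indicator A x \<partial>distr (hyperplane_lborel e \<Otimes>\<^sub>M lborel) borel (graph_shift e \<gamma> \<epsilon>))"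
    by (subst nn_integral_distr) auto
  also have "\<dots> = emeasure (density (distr (hyperplane_lborel e \<Otimes>\<^sub>M lborel) borel (graph_shift e \<gamma> \<epsilon>)) (\<lambda>_. ennreal \<epsilon>)) A"
    by (simp add: emeasure_density nn_integral_cmult)
  finally show "emeasure lborel A = \<dots>" .
qed simp

lemma graph_shift_integral:
  fixes e :: "'a::euclidean_space" and f :: "'a \<Rightarrow> real"
  assumes e: "e \<in> Basis \<union> uminus ` Basis" and [measurable]: "\<gamma> \<in> borel_measurable borel" and eps: "0 < \<epsilon>"
    and [measurable]: "f \<in> borel_measurable borel"
  shows "integral\<^sup>L lborel f =
    \<epsilon> * integral\<^sup>L (hyperplane_lborel e \<Otimes>\<^sub>M lborel) (\<lambda>z. f (graph_shift e \<gamma> \<epsilon> z))"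
  using eps
  by (subst lborel_eq_graph_shift[OF e _ eps, of \<gamma>]) (simp_all add: integral_density integral_distr)

section \<open>Boundary charts\<close>

definition smooth_step :: "real \<Rightarrow> real" where
  "smooth_step s = 2 * (max 0 s)\<^sup>2 - 4 * (max 0 (s - 1/2))\<^sup>2 + 2 * (max 0 (s - 1))\<^sup>2"

text \<open>The triangle over [0, 1] with peak 2 at 1/2, hence of area 1, and the derivative of
  \<open>smooth_step\<close>. Writing both with positive parts makes continuity and the derivative
  formula uniform in \<open>s\<close>.\<close>

definition tent :: "real \<Rightarrow> real" where
  "tent s = 4 * max 0 s - 8 * max 0 (s - 1/2) + 4 * max 0 (s - 1)"

lemma smooth_step_nonpos: "s \<le> 0 \<Longrightarrow> smooth_step s = 0"
  by (simp add: smooth_step_def max_def)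

lemma smooth_step_ge_1: "1 \<le> s \<Longrightarrow> smooth_step s = 1"
  by (simp add: smooth_step_def max_def power2_eq_square algebra_simps)

lemma has_real_derivative_max_sq: "((\<lambda>s::real. (max 0 s)\<^sup>2) has_real_derivative 2 * max 0 s) (at s)"
proof -
  consider "s = 0" | "0 < s" | "s < 0" by linarith
  then show ?thesis
  proof cases
    case 1
    have "((\<lambda>t::real. (max 0 t)\<^sup>2 / t) \<longlongrightarrow> 0) (at 0)"
    proof (rule Lim_null_comparison[where g = "\<lambda>t. \<bar>t\<bar>"])
      show "\<forall>\<^sub>F t::real in at 0. norm ((max 0 t)\<^sup>2 / t) \<le> \<bar>t\<bar>"
        by (intro always_eventually allI) (simp add: max_def power2_eq_square)
      show "((\<lambda>t::real. \<bar>t\<bar>) \<longlongrightarrow> 0) (at 0)" by (simp add: tendsto_rabs_zero)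
    qed
    with 1 show ?thesis by (simp add: DERIV_def)
  next
    case 2
    have "((\<lambda>s. s\<^sup>2) has_real_derivative 2 * s) (at s)" by (auto intro!: derivative_eq_intros)
    then have "((\<lambda>s. (max 0 s)\<^sup>2) has_real_derivative 2 * s) (at s)"
      by (rule has_field_derivative_transform_within_open[of _ _ _ "{0<..}"]) (use 2 in auto)
    with 2 show ?thesis by simp
  next
    case 3
    have "((\<lambda>s. 0) has_real_derivative 0) (at s)" by simp
    then have "((\<lambda>s. (max 0 s)\<^sup>2) has_real_derivative 0) (at s)"
      by (rule has_field_derivative_transform_within_open[of _ _ _ "{..<0}"]) (use 3 in auto)
    with 3 show ?thesis by simp
  qed
qed

lemma smooth_step_has_derivative: "(smooth_step has_real_derivative tent s) (at s)"
proof -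
  have *: "((\<lambda>s. (max 0 (s - c))\<^sup>2) has_real_derivative 2 * max 0 (s - c)) (at s)" for c
  proof -
    have "((\<lambda>s. s - c) has_real_derivative 1) (at s)" by (auto intro!: derivative_eq_intros)
    from DERIV_chain2[OF has_real_derivative_max_sq this] show ?thesis by simp
  qed
  have "(smooth_step has_real_derivative
      2 * (2 * max 0 s) - 4 * (2 * max 0 (s - 1/2)) + 2 * (2 * max 0 (s - 1))) (at s)"
    unfolding smooth_step_def[abs_def] by (intro DERIV_add DERIV_diff DERIV_cmult * has_real_derivative_max_sq)
  then show ?thesis by (simp add: tent_def)
qed

lemma tent_nonneg: "0 \<le> tent s" and tent_le_2: "tent s \<le> 2"
  and tent_outside: "s \<notin> {0<..<1} \<Longrightarrow> tent s = 0"
  by (auto simp: tent_def max_def)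

lemma continuous_on_tent [continuous_intros]:
  "continuous_on S f \<Longrightarrow> continuous_on S (\<lambda>x. tent (f x))"
  unfolding tent_def by (intro continuous_intros)

lemma continuous_on_smooth_step [continuous_intros]:
  "continuous_on S f \<Longrightarrow> continuous_on S (\<lambda>x. smooth_step (f x))"
  unfolding smooth_step_def by (intro continuous_intros)

lemma smooth_step_bounds: "0 \<le> smooth_step s" "smooth_step s \<le> 1"
proof -
  have mono: "smooth_step a \<le> smooth_step b" if "a \<le> b" for a b
    using DERIV_nonneg_imp_nondecreasing[OF that, of smooth_step] smooth_step_has_derivative tent_nonneg
    by blast
  show "0 \<le> smooth_step s" using mono[of "min s 0" s] smooth_step_nonpos[of "min s 0"] by simp
  show "smooth_step s \<le> 1" using mono[of s "max s 1"] smooth_step_ge_1[of "max s 1"] by simp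
qed

lemma tent_measurable [measurable]: "tent \<in> borel_measurable borel"
  by (intro borel_measurable_continuous_onI continuous_on_tent continuous_on_id)

text \<open>In collar coordinates the limit integrand carries the weight \<open>tent (s - 1)\<close>
  in the normal variable. Its mass 1 is what makes the limit exactly the surface integral.\<close>

lemma integral_tent_shift: "integral\<^sup>L lborel (\<lambda>s. tent (s - 1)) = 1"
proof -
  have "has_bochner_integral lborel (\<lambda>s. tent (s - 1) * indicator {1..2} s) (smooth_step (2 - 1) - smooth_step (1 - 1))"
  proof (rule has_bochner_integral_FTC_Icc_real)
    have sub1: "((\<lambda>s. s - 1) has_real_derivative 1) (at s)" for s :: real
      by (auto intro!: derivative_eq_intros)
    show "((\<lambda>s. smooth_step (s - 1)) has_real_derivative tent (s - 1)) (at s)" for s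
      using DERIV_chain2[OF smooth_step_has_derivative sub1] by simp
    show "isCont (\<lambda>s. tent (s - 1)) s" for s
      using continuous_on_tent[of UNIV "\<lambda>s. s - 1"]
      by (auto intro!: continuous_intros simp: continuous_on_eq_continuous_at)
  qed simp
  moreover have "tent (s - 1) * indicator {1..2} s = tent (s - 1)" for s
    using tent_outside[of "s - 1"] by (cases "s - 1 \<in> {0<..<1}") (auto simp: indicator_def)
  ultimately have "has_bochner_integral lborel (\<lambda>s. tent (s - 1)) 1"
    by (simp add: smooth_step_nonpos smooth_step_ge_1)
  then show ?thesis by (rule has_bochner_integral_integral_eq)
qed

section \<open>Geometry of a single chart\<close>

definition axis_proj :: "'a::euclidean_space \<Rightarrow> 'a \<Rightarrow> 'a" where
  "axis_proj e x = x - (x \<bullet> e) *\<^sub>R e"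

text \<open>The normal of the graph that points into \<open>D\<close>, not normalised: its length is
  the density of the surface element.\<close>

definition graph_normal :: "'a::euclidean_space \<Rightarrow> ('a \<Rightarrow> real) \<Rightarrow> 'a \<Rightarrow> 'a" where
  "graph_normal e \<gamma> y = e - (\<Sum>b\<in>Basis - {e, - e}. frechet_derivative \<gamma> (at y) b *\<^sub>R b)"

definition graph_point :: "'a::euclidean_space \<Rightarrow> ('a \<Rightarrow> real) \<Rightarrow> 'a \<Rightarrow> 'a" where
  "graph_point e \<gamma> y = y + \<gamma> y *\<^sub>R e"

locale C1_chart =
  fixes D :: "'a::euclidean_space set" and x0 :: 'a and r :: real and e :: 'a and \<gamma> :: "'a \<Rightarrow> real"
  assumes chart: "boundary_chart 1 D x0 r e \<gamma>" and open_D: "open D" and bounded_D: "bounded D"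
begin

lemma r_pos: "0 < r" and e_axis: "e \<in> Basis \<union> uminus ` Basis"
  and chart_mem: "x \<in> ball x0 r \<Longrightarrow> x \<in> D \<longleftrightarrow> \<gamma> (axis_proj e x) < x \<bullet> e"
  using chart unfolding boundary_chart_def axis_proj_def by auto

lemma norm_e: "norm e = 1" by (rule axis_norm[OF e_axis])

lemma e_inner_e: "e \<bullet> e = 1" using norm_e by (simp add: norm_eq_1)

lemma Ck_gamma: "Ck_fun (Suc 0) \<gamma>" using chart by (simp add: boundary_chart_def)

lemma gamma_derivative: "(\<gamma> has_derivative frechet_derivative \<gamma> (at y)) (at y)"
  using Ck_gamma frechet_derivative_works unfolding Ck_fun.simps by blast

lemma continuous_frechet_gamma:
  "b \<in> Basis \<Longrightarrow> continuous_on UNIV (\<lambda>y. frechet_derivative \<gamma> (at y) b)"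
  using Ck_gamma unfolding Ck_fun.simps by blast

lemma continuous_gamma: "continuous_on UNIV \<gamma>"
  by (meson continuous_at_imp_continuous_on has_derivative_continuous gamma_derivative)

lemma measurable_gamma [measurable]: "\<gamma> \<in> borel_measurable borel"
  using continuous_gamma by (rule borel_measurable_continuous_onI)

lemma continuous_graph_normal: "continuous_on UNIV (graph_normal e \<gamma>)"
  unfolding graph_normal_def by (intro continuous_intros continuous_frechet_gamma) auto

lemma measurable_graph_normal [measurable]: "graph_normal e \<gamma> \<in> borel_measurable borel"
  using continuous_graph_normal by (rule borel_measurable_continuous_onI)

lemma continuous_graph_point: "continuous_on UNIV (graph_point e \<gamma>)"
  unfolding graph_point_def by (intro continuous_intros continuous_gamma)

lemma measurable_graph_point [measurable]: "graph_point e \<gamma> \<in> borel_measurable borel"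
  using continuous_graph_point by (rule borel_measurable_continuous_onI)

lemma axis_proj_linear: "bounded_linear (axis_proj e)"
  unfolding axis_proj_def[abs_def]
  by (intro bounded_linear_sub bounded_linear_ident bounded_linear_scaleR_const bounded_linear_inner_left)

lemma continuous_axis_proj [continuous_intros]: "continuous_on S f \<Longrightarrow> continuous_on S (\<lambda>x. axis_proj e (f x))"
  unfolding axis_proj_def by (intro continuous_intros)

lemma axis_proj_inner_e: "axis_proj e x \<bullet> e = 0"
  by (simp add: axis_proj_def inner_diff_left e_inner_e)

lemma axis_proj_shift: "y \<bullet> e = 0 \<Longrightarrow> axis_proj e (y + s *\<^sub>R e) = y"
  by (simp add: axis_proj_def inner_add_left e_inner_e)

lemma norm_axis_proj_le: "norm (axis_proj e x) \<le> norm x"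
proof -
  have "(norm x)\<^sup>2 = (norm (axis_proj e x + (x \<bullet> e) *\<^sub>R e))\<^sup>2"
    by (simp add: axis_proj_def)
  also have "\<dots> = (norm (axis_proj e x))\<^sup>2 + (norm ((x \<bullet> e) *\<^sub>R e))\<^sup>2"
    by (rule norm_add_Pythagorean) (simp add: orthogonal_def axis_proj_inner_e)
  finally have "(norm (axis_proj e x))\<^sup>2 \<le> (norm x)\<^sup>2" by simp
  then show ?thesis by (simp add: power2_le_iff_abs_le)
qed

text \<open>The projection has no component along the axis and keeps the other coordinates, so
  expanding it in the basis turns the directional derivative of \<gamma> into the sum in
  \<open>graph_normal\<close>. In this form the normal appears as the gradient of
  \<open>height\<close>.\<close>

lemma graph_normal_inner:
  "graph_normal e \<gamma> y \<bullet> h = h \<bullet> e - frechet_derivative \<gamma> (at y) (axis_proj e h)"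
proof -
  obtain e0 where e0: "e0 \<in> Basis" "e = e0 \<or> e = - e0" "Basis - {e, - e} = Basis - {e0}"
    using axis_Basis[OF e_axis] .
  let ?g = "frechet_derivative \<gamma> (at y)"
  have lin: "linear ?g" using gamma_derivative has_derivative_linear by blast
  have b: "axis_proj e h \<bullet> b = (if b = e0 then 0 else h \<bullet> b)" if "b \<in> Basis" for b
  proof (cases "b = e0")
    case True
    have "axis_proj e h \<bullet> e0 = 0"
      using e0(2)
    proof
      assume "e = e0" then show ?thesis using axis_proj_inner_e[of h] by simp
    next
      assume "e = - e0" then show ?thesis using axis_proj_inner_e[of h] by simp
    qed
    then show ?thesis using True by simp
  next
    case False
    then have "e0 \<bullet> b = 0" by (intro inner_not_same_Basis e0(1) that) simp
    with e0(2) have "e \<bullet> b = 0" by (elim disjE) simp_all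
    then show ?thesis using False by (simp add: axis_proj_def inner_diff_left)
  qed
  have "?g (axis_proj e h) = ?g (\<Sum>b\<in>Basis. (axis_proj e h \<bullet> b) *\<^sub>R b)"
    by (simp add: euclidean_representation)
  also have "\<dots> = (\<Sum>b\<in>Basis. (axis_proj e h \<bullet> b) * ?g b)"
    unfolding linear_sum[OF lin] linear_cmul[OF lin] real_scaleR_def ..
  also have "\<dots> = (\<Sum>b\<in>Basis - {e0}. (h \<bullet> b) * ?g b)"
    using e0(1) by (subst sum.remove[of _ e0]) (simp_all add: b)
  finally have 1: "?g (axis_proj e h) = (\<Sum>b\<in>Basis - {e0}. (h \<bullet> b) * ?g b)" .
  have "(h \<bullet> b) * ?g b = ?g b * (b \<bullet> h)" for b
    by (metis inner_commute mult.commute)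
  then have "?g (axis_proj e h) = (\<Sum>b\<in>Basis - {e0}. ?g b * (b \<bullet> h))"
    unfolding 1 by (intro sum.cong refl)
  then show ?thesis
    unfolding graph_normal_def e0(3) by (simp only: inner_diff_left inner_sum_left inner_scaleR_left inner_commute[of e h])
qed

text \<open>The gradient of \<gamma> is orthogonal to \<open>e\<close>, so the length follows from
  Pythagoras. The right-hand side is the density in \<open>graph_surface_measure\<close>.\<close>

lemma norm_graph_normal:
  "norm (graph_normal e \<gamma> y) = sqrt (1 + (\<Sum>b\<in>Basis - {e, - e}. (frechet_derivative \<gamma> (at y) b)\<^sup>2))"
proof -
  obtain e0 where e0: "e0 \<in> Basis" "e = e0 \<or> e = - e0" "Basis - {e, - e} = Basis - {e0}"
    using axis_Basis[OF e_axis] .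
  let ?g = "frechet_derivative \<gamma> (at y)"
  define S where "S = (\<Sum>b\<in>Basis - {e0}. ?g b *\<^sub>R b)"
  have Sb: "S \<bullet> b = (if b = e0 then 0 else ?g b)" if "b \<in> Basis" for b
  proof -
    have "S \<bullet> b = (\<Sum>c\<in>Basis - {e0}. if c = b then ?g c else 0)"
      unfolding S_def inner_sum_left using that by (intro sum.cong) (auto simp: inner_Basis)
    also have "\<dots> = (if b = e0 then 0 else ?g b)"
      using that by (simp add: sum.delta)
    finally show ?thesis .
  qed
  have "S \<bullet> e = 0" using e0(1,2) Sb[of e0] by auto
  then have "(norm (e - S))\<^sup>2 = 1 + S \<bullet> S"
    by (simp add: power2_norm_eq_inner inner_diff_left inner_diff_right inner_commute[of e S] e_inner_e)
  also have "S \<bullet> S = (\<Sum>b\<in>Basis. (S \<bullet> b)\<^sup>2)"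
    by (subst euclidean_inner) (simp add: power2_eq_square)
  also have "\<dots> = (\<Sum>b\<in>Basis - {e0}. (?g b)\<^sup>2)"
    using e0(1) by (subst sum.remove[of _ e0]) (auto simp: Sb intro!: sum.cong)
  finally have "(norm (e - S))\<^sup>2 = 1 + (\<Sum>b\<in>Basis - {e0}. (?g b)\<^sup>2)" .
  then show ?thesis
    unfolding graph_normal_def e0(3) S_def by (rule real_sqrt_unique[symmetric, OF _ norm_ge_zero])
qed

definition height :: "'a \<Rightarrow> real" where "height x = x \<bullet> e - \<gamma> (axis_proj e x)"

lemma height_derivative: "(height has_derivative (\<lambda>h. graph_normal e \<gamma> (axis_proj e x) \<bullet> h)) (at x)"
  unfolding height_def[abs_def] graph_normal_inner
  by (intro has_derivative_diff has_derivative_compose[OF _ gamma_derivative] has_derivative_inner_left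
      has_derivative_ident bounded_linear_imp_has_derivative axis_proj_linear)

lemma continuous_height: "continuous_on S height"
  unfolding height_def[abs_def]
  by (intro continuous_intros continuous_on_compose2[OF continuous_gamma]) auto

lemma mem_D_iff_height: "x \<in> ball x0 r \<Longrightarrow> x \<in> D \<longleftrightarrow> 0 < height x"
  using chart_mem by (simp add: height_def)

lemma height_shift: "y \<bullet> e = 0 \<Longrightarrow> height (y + (\<gamma> y + s) *\<^sub>R e) = s"
  by (simp add: height_def axis_proj_shift inner_add_left e_inner_e)

text \<open>A frontier point is outside the open set \<open>D\<close>, so its height is not
  positive. Were it negative, a neighbourhood inside the ball would miss \<open>D\<close>,
  contradicting membership in the closure.\<close>

lemma height_frontier: "x \<in> frontier D \<Longrightarrow> x \<in> ball x0 r \<Longrightarrow> height x = 0"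
proof (rule ccontr)
  assume x: "x \<in> frontier D" "x \<in> ball x0 r" "height x \<noteq> 0"
  have "x \<notin> D" using x(1) open_D by (simp add: frontier_def interior_open)
  then have neg: "height x < 0" using x mem_D_iff_height[of x] by linarith
  have "open {y. height y < 0}"
    by (intro open_Collect_less continuous_height continuous_on_const)
  then have op: "open ({y. height y < 0} \<inter> ball x0 r)" by auto
  have "({y. height y < 0} \<inter> ball x0 r) \<inter> D = {}" using mem_D_iff_height by force
  moreover have "x \<in> closure D" using x(1) by (simp add: frontier_def)
  ultimately show False using open_Int_closure_eq_empty[OF op] neg x(2) by blast
qed

text \<open>Points slightly above the graph lie in \<open>D\<close> and converge to it, while the
  graph itself has height 0 and so lies outside \<open>D\<close>.\<close>

lemma graph_point_frontier:
  assumes "y \<bullet> e = 0" "graph_point e \<gamma> y \<in> ball x0 r"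
  shows "graph_point e \<gamma> y \<in> frontier D"
proof -
  let ?p = "graph_point e \<gamma> y"
  have h: "height (y + (\<gamma> y + s) *\<^sub>R e) = s" for s by (rule height_shift[OF assms(1)])
  have "height ?p = 0" using h[of 0] by (simp add: graph_point_def)
  then have "?p \<notin> D" using mem_D_iff_height[OF assms(2)] by simp
  moreover have "?p \<in> closure D"
  proof -
    obtain d where d: "0 < d" "ball ?p d \<subseteq> ball x0 r"
      using assms(2) open_ball open_contains_ball by blast
    \<comment> \<open>Dividing by at least 2 keeps every point strictly within distance
      \<open>d\<close>, also for \<open>n = 0\<close>.\<close>
    define z where "z = (\<lambda>n. y + (\<gamma> y + d / real (Suc (Suc n))) *\<^sub>R e)"
    have "dist ?p (z n) < d" for n
    proof -
      have "?p - z n = (- (d / real (Suc (Suc n)))) *\<^sub>R e"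
        by (simp add: z_def graph_point_def scaleR_left_distrib)
      then have "dist ?p (z n) = d / real (Suc (Suc n))"
        using d(1) norm_e unfolding dist_norm by simp
      also have "\<dots> < d / 1" using d(1) by (intro divide_strict_left_mono) auto
      finally show ?thesis by simp
    qed
    then have "z n \<in> ball x0 r" for n using d(2) by (meson mem_ball subsetD)
    then have zD: "z n \<in> D" for n
      using mem_D_iff_height[of "z n"] h d(1) by (simp add: z_def)
    have "(\<lambda>n. d / real (Suc (Suc n))) \<longlonglongrightarrow> 0"
      using LIMSEQ_Suc[OF LIMSEQ_Suc[OF lim_const_over_n[of d]]] by simp
    then have "z \<longlonglongrightarrow> y + (\<gamma> y + 0) *\<^sub>R e" unfolding z_def by (intro tendsto_intros)
    then have "z \<longlonglongrightarrow> ?p" by (simp add: graph_point_def)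
    with zD show ?thesis unfolding closure_sequential by blast
  qed
  ultimately show ?thesis using open_D by (simp add: frontier_def interior_open)
qed

lemma nn_integral_graph_surface_measure:
  assumes [measurable]: "f \<in> borel_measurable borel"
  shows "(\<integral>\<^sup>+x. f x \<partial>graph_surface_measure x0 r e \<gamma>) =
    (\<integral>\<^sup>+y. ennreal (norm (graph_normal e \<gamma> y)) * indicator (ball x0 r) (graph_point e \<gamma> y) *
        f (graph_point e \<gamma> y) \<partial>hyperplane_lborel e)"
proof -
  have *: "graph_surface_measure x0 r e \<gamma> = distr (density (hyperplane_lborel e)
      (\<lambda>y. ennreal (norm (graph_normal e \<gamma> y)) * indicator (ball x0 r) (graph_point e \<gamma> y))) borel (graph_point e \<gamma>)"
    by (simp add: graph_surface_measure_def norm_graph_normal graph_point_def[abs_def])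
  have [measurable]: "ball x0 r \<in> sets borel" by simp
  have [measurable]: "f \<in> borel_measurable (distr N borel g)" for N and g :: "'a \<Rightarrow> 'a" by simp
  show ?thesis unfolding *
    by (subst nn_integral_distr, simp, simp, subst nn_integral_density, measurable)
qed

end

lemma sets_graph_surface_measure [simp]: "sets (graph_surface_measure x0 r e \<gamma>) = sets borel"
  by (simp add: graph_surface_measure_def)

lemma set_integrable_mult_bounded:
  fixes f g :: "'a \<Rightarrow> real"
  assumes f: "set_integrable M D f" and g: "(\<lambda>x. indicator D x *\<^sub>R g x) \<in> borel_measurable M"
    and bd: "\<And>x. x \<in> D \<Longrightarrow> \<bar>g x\<bar> \<le> C"
  shows "set_integrable M D (\<lambda>x. g x * f x)"
  unfolding set_integrable_def
proof (rule Bochner_Integration.integrable_bound)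
  have int: "integrable M (\<lambda>x. indicator D x *\<^sub>R f x)" using f by (simp add: set_integrable_def)
  show "integrable M (\<lambda>x. C * (indicator D x *\<^sub>R f x))" by (rule integrable_mult_right[OF int])
  have "(\<lambda>x. (indicator D x *\<^sub>R g x) * (indicator D x *\<^sub>R f x)) \<in> borel_measurable M"
    by (rule borel_measurable_times[OF g borel_measurable_integrable[OF int]])
  also have "(\<lambda>x. (indicator D x *\<^sub>R g x) * (indicator D x *\<^sub>R f x)) = (\<lambda>x. indicator D x *\<^sub>R (g x * f x))"
    by (auto simp: fun_eq_iff indicator_def)
  finally show "(\<lambda>x. indicator D x *\<^sub>R (g x * f x)) \<in> borel_measurable M" .
  show "AE x in M. norm (indicator D x *\<^sub>R (g x * f x)) \<le> norm (C * (indicator D x *\<^sub>R f x))"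
  proof (rule AE_I2)
    fix x
    show "norm (indicator D x *\<^sub>R (g x * f x)) \<le> norm (C * (indicator D x *\<^sub>R f x))"
    proof (cases "x \<in> D")
      case True
      have "\<bar>g x\<bar> * \<bar>f x\<bar> \<le> \<bar>C\<bar> * \<bar>f x\<bar>"
        using bd[OF True] by (intro mult_right_mono) auto
      then show ?thesis using True by (simp add: abs_mult)
    qed simp
  qed
qed

lemma set_integral_ge_0:
  fixes f :: "'a \<Rightarrow> real"
  assumes "\<And>x. x \<in> A \<Longrightarrow> 0 \<le> f x"
  shows "0 \<le> (LINT x:A|M. f x)"
  unfolding set_lebesgue_integral_def
  by (intro integral_nonneg_AE AE_I2) (simp add: indicator_def assms)

section \<open>The divergence theorem in a chart\<close>

definition divergence :: "('a::euclidean_space \<Rightarrow> 'a \<Rightarrow> 'a) \<Rightarrow> 'a \<Rightarrow> real" where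
  "divergence G' x = (\<Sum>b\<in>Basis. G' x b \<bullet> b)"

text \<open>Derivatives may blow up at the boundary, so integrability of the divergence has to be
  part of the notion. The derivative is an explicit argument, with arbitrary values outside
  \<open>D\<close>, so that split fields come with an explicit split of their divergence.\<close>

definition C1_field :: "'a::euclidean_space set \<Rightarrow> ('a \<Rightarrow> 'a) \<Rightarrow> ('a \<Rightarrow> 'a \<Rightarrow> 'a) \<Rightarrow> bool" where
  "C1_field D G G' \<longleftrightarrow> continuous_on (closure D) G \<and> (\<forall>x\<in>D. (G has_derivative G' x) (at x)) \<and>
     (\<forall>b\<in>Basis. continuous_on D (\<lambda>x. G' x b \<bullet> b)) \<and> set_integrable lborel D (divergence G')"

lemma C1_fieldD:
  assumes "C1_field D G G'"
  shows "continuous_on (closure D) G" "\<And>x. x \<in> D \<Longrightarrow> (G has_derivative G' x) (at x)"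
    "\<And>b. b \<in> Basis \<Longrightarrow> continuous_on D (\<lambda>x. G' x b \<bullet> b)" "set_integrable lborel D (divergence G')"
  using assms unfolding C1_field_def by blast+

context C1_chart
begin

lemma measurable_axis_proj [measurable]: "axis_proj e \<in> borel_measurable borel"
  by (intro borel_measurable_continuous_onI continuous_axis_proj continuous_on_id)

lemma measurable_height [measurable]: "height \<in> borel_measurable borel"
  by (intro borel_measurable_continuous_onI continuous_height)

text \<open>It is 0 for heights up to \<open>h\<close> and 1 for heights from \<open>2 * h\<close>
  on. The shift by 1 makes it vanish in a whole layer next to the graph, as extension by 0
  requires.\<close>

definition collar_cutoff :: "real \<Rightarrow> 'a \<Rightarrow> real" where
  "collar_cutoff h x = smooth_step (height x / h - 1)"

definition collar_slope :: "real \<Rightarrow> 'a \<Rightarrow> real" where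
  "collar_slope h x = tent (height x / h - 1) / h"

lemma measurable_collar [measurable]:
  "collar_cutoff h \<in> borel_measurable borel" "collar_slope h \<in> borel_measurable borel"
proof -
  show "collar_cutoff h \<in> borel_measurable borel"
    unfolding collar_cutoff_def[abs_def] divide_inverse
    by (intro borel_measurable_continuous_onI continuous_intros continuous_height)
  show "collar_slope h \<in> borel_measurable borel"
    unfolding collar_slope_def[abs_def] by measurable
qed

lemma collar_cutoff_derivative:
  "(collar_cutoff h has_derivative (\<lambda>k. collar_slope h x * (graph_normal e \<gamma> (axis_proj e x) \<bullet> k))) (at x)"
proof -
  have "((\<lambda>x. height x / h - 1) has_derivative (\<lambda>k. (graph_normal e \<gamma> (axis_proj e x) \<bullet> k) / h - 0)) (at x)"
    by (intro has_derivative_diff has_derivative_const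
        bounded_linear.has_derivative[OF bounded_linear_divide height_derivative])
  then have "(collar_cutoff h has_derivative (\<lambda>k. tent (height x / h - 1) *
      ((graph_normal e \<gamma> (axis_proj e x) \<bullet> k) / h - 0))) (at x)"
    unfolding collar_cutoff_def[abs_def]
    by (rule has_derivative_compose[OF _ smooth_step_has_derivative[unfolded has_field_derivative_def]])
  then show ?thesis by (simp add: collar_slope_def)
qed

text \<open>The product of cutoff and field vanishes near the frontier, so its divergence integrates
  to 0; the product rule splits that integral into the two sides.\<close>

lemma chart_divergence_cutoff:
  assumes G: "C1_field D G G'" and r': "r' < r"
    and zero: "\<And>x. x \<in> closure D \<Longrightarrow> x \<notin> cball x0 r' \<Longrightarrow> G x = 0" and h: "0 < h"
  shows "(LINT x:D|lborel. collar_cutoff h x * divergence G' x) =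
    - (LINT x|lborel. indicator D x * (collar_slope h x * (graph_normal e \<gamma> (axis_proj e x) \<bullet> G x)))"
proof -
  let ?c = "collar_cutoff h" and ?t = "collar_slope h"
  let ?n = "\<lambda>x. graph_normal e \<gamma> (axis_proj e x)"
  define H' where "H' = (\<lambda>x k. ?c x *\<^sub>R G' x k + (?t x * (?n x \<bullet> k)) *\<^sub>R G x)"
  \<comment> \<open>Near the graph the cutoff vanishes, and away from the smaller closed ball the
    field does. Inside that ball the frontier has height 0, so \<open>N\<close> contains all of
    it.\<close>
  define N where "N = {x. height x < h} \<union> - cball x0 r'"
  have op: "open N"
    unfolding N_def by (intro open_Un open_Collect_less continuous_height continuous_on_const) auto
  have sub: "frontier D \<subseteq> N"
  proof
    fix x assume x: "x \<in> frontier D"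
    show "x \<in> N"
    proof (cases "x \<in> cball x0 r'")
      case True
      then have "x \<in> ball x0 r" using r' by simp
      then show ?thesis using height_frontier[OF x] h by (simp add: N_def)
    qed (simp add: N_def)
  qed
  have der: "((\<lambda>x. ?c x *\<^sub>R G x) has_derivative H' x) (at x)" if "x \<in> D" for x
    unfolding H'_def
    by (rule has_derivative_scaleR[OF collar_cutoff_derivative C1_fieldD(2)[OF G that]])
  have contG: "continuous_on D G"
    using continuous_on_subset[OF C1_fieldD(1)[OF G] closure_subset] .
  have contc: "continuous_on D ?c"
    unfolding collar_cutoff_def[abs_def] divide_inverse
    by (intro continuous_intros continuous_height)
  have contt: "continuous_on D ?t"
    unfolding collar_slope_def[abs_def] divide_inverse
    by (intro continuous_intros continuous_height)
  have contn: "continuous_on D ?n"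
    by (intro continuous_on_compose2[OF continuous_graph_normal] continuous_intros) auto
  have cont: "continuous_on D (\<lambda>x. H' x b \<bullet> b)" if "b \<in> Basis" for b
    unfolding H'_def inner_add_left inner_scaleR_left
    by (intro continuous_on_add continuous_on_mult continuous_on_inner continuous_on_const
        contG contc contt contn C1_fieldD(3)[OF G that])
  have z: "?c x *\<^sub>R G x = 0" if "x \<in> D" "x \<in> N" for x
  proof (cases "x \<in> cball x0 r'")
    case True
    then have "height x / h \<le> 1" using that h by (simp add: N_def)
    then show ?thesis by (simp add: collar_cutoff_def smooth_step_nonpos)
  next
    case False
    then show ?thesis using zero closure_subset that by (metis scaleR_zero_right subsetD)
  qed
  have div: "(\<Sum>b\<in>Basis. H' x b \<bullet> b) = ?c x * divergence G' x + ?t x * (?n x \<bullet> G x)" for x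
  proof -
    have "?n x \<bullet> G x = (\<Sum>b\<in>Basis. (?n x \<bullet> b) * (G x \<bullet> b))" by (rule euclidean_inner)
    then show ?thesis
      unfolding H'_def divergence_def by (simp add: inner_add_left sum.distrib sum_distrib_left mult.assoc)
  qed
  note zero_int = set_integral_divergence_eq_0[OF open_D bounded_D op sub der cont z, unfolded div]
  have I1: "set_integrable lborel D (\<lambda>x. ?c x * divergence G' x)"
  proof (rule set_integrable_mult_bounded[OF C1_fieldD(4)[OF G]])
    show "(\<lambda>x. indicator D x *\<^sub>R ?c x) \<in> borel_measurable lborel"
      using borel_measurable_continuous_on_indicator[OF _ contc] open_D by simp
    show "\<bar>?c x\<bar> \<le> 1" for x by (simp add: collar_cutoff_def smooth_step_bounds)
  qed
  have I2: "set_integrable lborel D (\<lambda>x. ?t x * (?n x \<bullet> G x))"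
    using set_integral_diff(1)[OF zero_int(1) I1] by simp
  have "(LINT x:D|lborel. ?c x * divergence G' x) + (LINT x:D|lborel. ?t x * (?n x \<bullet> G x)) = 0"
    using zero_int(2) set_integral_add(2)[OF I1 I2] by simp
  then show ?thesis by (simp add: set_lebesgue_integral_def)
qed

text \<open>Let the collar width in the preceding identity tend to 0. On the left the cutoff tends
  to 1; on the right, collar coordinates turn the collar integral into a fixed-size integral whose
  limit separates into the mass of \<open>tent\<close> and the graph integral. The minus sign
  reflects that the normal points inward.\<close>

lemma chart_divergence:
  assumes G: "C1_field D G G'" and r': "r' < r"
    and zero: "\<And>x. x \<in> closure D \<Longrightarrow> x \<notin> cball x0 r' \<Longrightarrow> G x = 0"
  defines "\<phi> \<equiv> \<lambda>y. indicator (frontier D \<inter> ball x0 r) (graph_point e \<gamma> y) *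
      (graph_normal e \<gamma> y \<bullet> G (graph_point e \<gamma> y))"
  shows "integrable (hyperplane_lborel e) \<phi>"
    and "(LINT x:D|lborel. divergence G' x) = - (LINT y|hyperplane_lborel e. \<phi> y)"
proof -
  interpret hyp: sigma_finite_measure "hyperplane_lborel e" by (rule sigma_finite_hyperplane[OF e_axis])
  interpret pair_sigma_finite "hyperplane_lborel e" "lborel :: real measure" ..
  let ?M = "hyperplane_lborel e \<Otimes>\<^sub>M (lborel :: real measure)"
  let ?p = "graph_point e \<gamma>" and ?N = "graph_normal e \<gamma>"
  \<comment> \<open>Extension by 0 makes the field Borel measurable on the whole space;
    \<open>G\<close> is arbitrary outside the closure.\<close>
  define g where "g = (\<lambda>x. indicator (closure D) x *\<^sub>R G x)"
  have g_meas [measurable]: "g \<in> borel_measurable borel"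
    unfolding g_def using C1_fieldD(1)[OF G]
    by (intro borel_measurable_continuous_on_indicator) auto
  have [measurable]: "D \<in> sets borel" using open_D by auto
  have [measurable]: "frontier D \<inter> ball x0 r \<in> sets borel"
    by (intro sets.Int) (auto simp: closed_Int)
  have g_closure: "g x = G x" if "x \<in> closure D" for x using that by (simp add: g_def)
  have phi: "\<phi> = (\<lambda>y. indicator (frontier D \<inter> ball x0 r) (?p y) * (?N y \<bullet> g (?p y)))"
    unfolding \<phi>_def by (auto simp: fun_eq_iff indicator_def g_closure frontier_def)
  have phi_meas [measurable]: "\<phi> \<in> borel_measurable borel" unfolding phi by measurable
  obtain CG where CG: "\<And>x. norm (g x) \<le> CG" "0 \<le> CG"
  proof -
    obtain C where C: "0 \<le> C" "\<And>x. x \<in> closure D \<Longrightarrow> norm (G x) \<le> C"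
      by (rule continuous_on_compact_bound[OF compact_closure[THEN iffD2, OF bounded_D] C1_fieldD(1)[OF G]]) (rule that)
    have "norm (g x) \<le> C" for x
      using C(1) C(2)[of x] by (cases "x \<in> closure D") (auto simp: g_def)
    then show thesis by (rule that[OF _ C(1)])
  qed
  define R where "R = norm x0 + r"
  obtain CN where "0 \<le> CN" "\<And>y. y \<in> cball 0 R \<Longrightarrow> norm (?N y) \<le> CN"
    by (rule continuous_on_compact_bound[OF compact_cball[of 0 R] continuous_on_subset[OF continuous_graph_normal subset_UNIV]]) (rule that)
  then have CN: "norm (?N y) \<le> CN" if "norm y \<le> R" for y using that by simp
  define h where "h = (\<lambda>n::nat. 1 / real (Suc n))"
  have hpos: "0 < h n" for n by (simp add: h_def)
  have hlim: "h \<longlonglongrightarrow> 0"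
    unfolding h_def using LIMSEQ_Suc[OF lim_1_over_n] by simp
  \<comment> \<open>The factor \<open>h n\<close> of the substitution cancels the 1/h in
    \<open>collar_slope\<close>, and the height divided by \<open>h n\<close> becomes the coordinate
    s.\<close>
  define F where "F = (\<lambda>n z. tent (snd z - 1) *
      (indicator D (graph_shift e \<gamma> (h n) z) * (?N (fst z) \<bullet> g (graph_shift e \<gamma> (h n) z))))"
  define Fl where "Fl = (\<lambda>z. tent (snd z - 1) * \<phi> (fst z))"
  have AE0: "AE z in ?M. fst z \<bullet> e = 0"
  proof (rule AE_pair_measure)
    show "AE y in hyperplane_lborel e. AE s in (lborel :: real measure). fst (y, s) \<bullet> e = 0"
      using AE_hyperplane_lborel[OF e_axis] by eventually_elim simp
  qed measurable
  have gs [simp]: "graph_shift e \<gamma> \<epsilon> (y, s) = y + (\<gamma> y + \<epsilon> * s) *\<^sub>R e" for \<epsilon> y s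
    by (simp add: graph_shift_def)
  have I: "(LINT x|lborel. indicator D x * (collar_slope (h n) x * (?N (axis_proj e x) \<bullet> G x))) = integral\<^sup>L ?M (F n)" for n
  proof -
    let ?f = "\<lambda>x. indicator D x * (collar_slope (h n) x * (?N (axis_proj e x) \<bullet> g x))"
    have "(LINT x|lborel. indicator D x * (collar_slope (h n) x * (?N (axis_proj e x) \<bullet> G x))) = integral\<^sup>L lborel ?f"
      using closure_subset[of D]
      by (intro Bochner_Integration.integral_cong) (auto simp: g_closure indicator_def)
    also have "\<dots> = h n * integral\<^sup>L ?M (\<lambda>z. ?f (graph_shift e \<gamma> (h n) z))"
      by (rule graph_shift_integral[OF e_axis measurable_gamma hpos]) measurable
    also have "\<dots> = integral\<^sup>L ?M (\<lambda>z. h n * ?f (graph_shift e \<gamma> (h n) z))"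
      by simp
    also have "\<dots> = integral\<^sup>L ?M (F n)"
    proof (rule integral_cong_AE)
      show "AE z in ?M. h n * ?f (graph_shift e \<gamma> (h n) z) = F n z"
        using AE0
      proof eventually_elim
        case (elim z)
        obtain y s where zy: "z = (y, s)" by force
        with elim have y: "y \<bullet> e = 0" by simp
        show ?case
          using hpos[of n] unfolding zy gs F_def collar_slope_def height_shift[OF y] axis_proj_shift[OF y] fst_conv snd_conv
          by (simp add: field_simps)
      qed
    qed (unfold F_def, measurable)
    finally show ?thesis .
  qed
  have lim: "AE z in ?M. (\<lambda>n. F n z) \<longlonglongrightarrow> Fl z"
    using AE0
  proof eventually_elim
    case (elim z)
    obtain y s where zy: "z = (y, s)" by force
    with elim have y: "y \<bullet> e = 0" by simp
    show ?case
    \<comment> \<open>Outside this interval the weight is 0. Inside it s is positive, so graph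
      points are approached from within \<open>D\<close>.\<close>
    proof (cases "s \<in> {1<..<2}")
      case False
      then have "tent (s - 1) = 0" by (intro tent_outside) auto
      then show ?thesis by (simp add: F_def Fl_def zy)
    next
      case True
      define x where "x = (\<lambda>n. y + (\<gamma> y + h n * s) *\<^sub>R e)"
      have "x \<longlonglongrightarrow> y + (\<gamma> y + 0 * s) *\<^sub>R e"
        unfolding x_def by (intro tendsto_intros hlim)
      then have x: "x \<longlonglongrightarrow> ?p y" by (simp add: graph_point_def)
      have "(\<lambda>n. indicat_real D (x n) * (?N y \<bullet> g (x n))) \<longlonglongrightarrow> \<phi> y"
      proof (cases "?p y \<in> ball x0 r")
        case True
        have pf: "?p y \<in> frontier D" by (rule graph_point_frontier[OF y True])
        then have pc: "?p y \<in> closure D" by (simp add: frontier_def)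
        have ev: "\<forall>\<^sub>F n in sequentially. x n \<in> D"
          using topological_tendstoD[OF x open_ball True]
        proof eventually_elim
          case (elim n)
          have "0 < h n * s" using \<open>s \<in> _\<close> hpos[of n] by simp
          then show ?case
            using mem_D_iff_height[OF elim] height_shift[OF y, of "h n * s"] by (simp add: x_def)
        qed
        have "((\<lambda>n. G (x n)) \<longlonglongrightarrow> G (?p y))"
        proof (rule continuous_on_tendsto_compose[OF C1_fieldD(1)[OF G] x pc])
          show "\<forall>\<^sub>F n in sequentially. x n \<in> closure D"
            using ev closure_subset[of D] by (auto elim: eventually_mono)
        qed
        then have "(\<lambda>n. ?N y \<bullet> G (x n)) \<longlonglongrightarrow> ?N y \<bullet> G (?p y)"
          by (intro tendsto_intros)
        moreover have "\<forall>\<^sub>F n in sequentially. ?N y \<bullet> G (x n) = indicat_real D (x n) * (?N y \<bullet> g (x n))"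
          using ev
        proof eventually_elim
          case (elim n)
          then have "x n \<in> closure D" using closure_subset by blast
          then show ?case using elim by (simp add: g_closure)
        qed
        moreover have "\<phi> y = ?N y \<bullet> G (?p y)" using pf True by (simp add: \<phi>_def)
        ultimately show ?thesis by (simp add: tendsto_cong)
      next
        \<comment> \<open>The limit point is outside the larger ball, hence has a neighbourhood that
          avoids the smaller closed ball; there the field vanishes and so does the sequence,
          eventually.\<close>
        case False
        then have "?p y \<in> - cball x0 r'" using r' by simp
        then have "\<forall>\<^sub>F n in sequentially. x n \<in> - cball x0 r'"
          by (intro topological_tendstoD[OF x]) auto
        then have "\<forall>\<^sub>F n in sequentially. indicat_real D (x n) * (?N y \<bullet> g (x n)) = 0"
        proof eventually_elim
          case (elim n)
          then have "g (x n) = 0" using zero[of "x n"] by (simp add: g_def indicator_def)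
          then show ?case by simp
        qed
        then have "(\<lambda>n. indicat_real D (x n) * (?N y \<bullet> g (x n))) \<longlonglongrightarrow> 0"
          by (rule tendsto_eventually)
        moreover have "\<phi> y = 0" using False by (simp add: \<phi>_def)
        ultimately show ?thesis by simp
      qed
      then have "(\<lambda>n. tent (s - 1) * (indicat_real D (x n) * (?N y \<bullet> g (x n)))) \<longlonglongrightarrow> tent (s - 1) * \<phi> y"
        by (rule tendsto_mult_left)
      then show ?thesis by (simp add: F_def Fl_def zy x_def)
    qed
  qed
  \<comment> \<open>The 2 is the peak of \<open>tent\<close>. Where the integrand is nonzero, the
    point lies in the chart ball, and projecting it onto the hyperplane does not increase its norm,
    so \<open>y\<close> stays in \<open>cball 0 R\<close>.\<close>
  define w where "w = (\<lambda>z::'a \<times> real. (2 * (CN * CG)) * indicat_real (cball 0 R \<times> {0..2}) z :: real)"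
  have wset: "cball 0 R \<times> {0..2} \<in> sets ?M" by (intro pair_measureI) auto
  have "emeasure ?M (cball 0 R \<times> {0..2}) < \<infinity>"
    using emeasure_hyperplane_cball_finite[OF e_axis, of R]
    by (subst lborel.emeasure_pair_measure_Times) (auto simp: ennreal_mult_less_top)
  then have w_int: "integrable ?M w"
    unfolding w_def by (intro integrable_mult_right integrable_real_indicator wset)
  have bound: "AE z in ?M. norm (F n z) \<le> w z" for n
    using AE0
  proof eventually_elim
    case (elim z)
    obtain y s where zy: "z = (y, s)" by force
    with elim have y: "y \<bullet> e = 0" by simp
    let ?x = "y + (\<gamma> y + h n * s) *\<^sub>R e"
    show ?case
    proof (cases "F n z = 0")
      case True
      have "norm (?N 0) \<le> CN" using CN[of 0] r_pos by (simp add: R_def)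
      then have "0 \<le> CN" by (rule order_trans[OF norm_ge_zero])
      then show ?thesis using True CG(2) by (simp add: w_def)
    next
      case False
      then have s: "s - 1 \<in> {0<..<1}" and xD: "?x \<in> D" and gx: "g ?x \<noteq> 0"
        using tent_outside[of "s - 1"] by (auto simp: F_def zy indicator_def split: if_splits)
      from gx have "?x \<in> cball x0 r'"
        using zero[of ?x] by (auto simp: g_def indicator_def split: if_splits)
      then have "dist x0 ?x \<le> r" using r' by simp
      then have nx: "norm ?x \<le> R" using norm_triangle_ineq2[of ?x x0] by (simp add: R_def dist_norm norm_minus_commute)
      have "norm y \<le> norm ?x"
        using norm_axis_proj_le[of ?x] axis_proj_shift[OF y] by simp
      then have ny: "norm y \<le> R" using nx by simp
      have "\<bar>?N y \<bullet> g ?x\<bar> \<le> norm (?N y) * norm (g ?x)" by (rule Cauchy_Schwarz_ineq2)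
      also have "\<dots> \<le> CN * CG" by (intro mult_mono CN[OF ny] CG order_trans[OF norm_ge_zero CN[OF ny]]) auto
      finally have 1: "\<bar>?N y \<bullet> g ?x\<bar> \<le> CN * CG" .
      have "norm (F n z) = tent (s - 1) * \<bar>?N y \<bullet> g ?x\<bar>"
        using xD tent_nonneg by (simp add: F_def zy abs_mult)
      also have "\<dots> \<le> 2 * (CN * CG)" by (intro mult_mono 1 tent_le_2) auto
      also have "\<dots> = w z" using ny s by (simp add: w_def zy)
      finally show ?thesis .
    qed
  qed
  have Fl_meas: "Fl \<in> borel_measurable ?M" unfolding Fl_def by measurable
  have F_meas: "F n \<in> borel_measurable ?M" for n unfolding F_def by measurable
  have Fl_int: "integrable ?M Fl" by (rule integrable_dominated_convergence[OF Fl_meas F_meas w_int lim bound])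
  have F_lim: "(\<lambda>n. integral\<^sup>L ?M (F n)) \<longlonglongrightarrow> integral\<^sup>L ?M Fl"
    by (rule integral_dominated_convergence[OF Fl_meas F_meas w_int lim bound])
  have Fl_eq: "(LINT s|lborel. Fl (y, s)) = \<phi> y" for y
    using integral_tent_shift by (simp add: Fl_def)
  have "integrable (hyperplane_lborel e) (\<lambda>y. LINT s|lborel. Fl (y, s))"
    using integrable_fst'[OF Fl_int] .
  then show "integrable (hyperplane_lborel e) \<phi>" unfolding Fl_eq .
  have Fl_val: "integral\<^sup>L ?M Fl = (LINT y|hyperplane_lborel e. \<phi> y)"
    using integral_fst'[OF Fl_int] unfolding Fl_eq by simp
  have "(\<lambda>n. LINT x:D|lborel. collar_cutoff (h n) x * divergence G' x) \<longlonglongrightarrow> (LINT x:D|lborel. divergence G' x)"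
    unfolding set_lebesgue_integral_def
  proof (rule integral_dominated_convergence[where w = "\<lambda>x. norm (indicat_real D x *\<^sub>R divergence G' x)"])
    have int: "integrable lborel (\<lambda>x. indicat_real D x *\<^sub>R divergence G' x)"
      using C1_fieldD(4)[OF G] by (simp add: set_integrable_def)
    then show "integrable lborel (\<lambda>x. norm (indicat_real D x *\<^sub>R divergence G' x))" by (rule integrable_norm)
    show m: "(\<lambda>x. indicat_real D x *\<^sub>R divergence G' x) \<in> borel_measurable lborel"
      using int by (rule borel_measurable_integrable)
    then have "(\<lambda>x. collar_cutoff (h n) x * (indicat_real D x *\<^sub>R divergence G' x)) \<in> borel_measurable lborel" for n
      by (intro borel_measurable_times) auto
    then show "(\<lambda>x. indicat_real D x *\<^sub>R (collar_cutoff (h n) x * divergence G' x)) \<in> borel_measurable lborel" for n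
      by (simp add: mult.left_commute)
    show "AE x in lborel. norm (indicat_real D x *\<^sub>R (collar_cutoff (h n) x * divergence G' x))
        \<le> norm (indicat_real D x *\<^sub>R divergence G' x)" for n
      by (intro AE_I2) (simp add: indicator_def abs_mult collar_cutoff_def smooth_step_bounds mult_left_le_one_le)
    show "AE x in lborel. (\<lambda>n. indicat_real D x *\<^sub>R (collar_cutoff (h n) x * divergence G' x))
        \<longlonglongrightarrow> indicat_real D x *\<^sub>R divergence G' x"
    proof (rule AE_I2)
      fix x :: 'a
      show "(\<lambda>n. indicat_real D x *\<^sub>R (collar_cutoff (h n) x * divergence G' x))
          \<longlonglongrightarrow> indicat_real D x *\<^sub>R divergence G' x"
      proof (cases "x \<in> D \<and> x \<in> cball x0 r'")
        case True
        then have "x \<in> ball x0 r" using r' by simp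
        then have pos: "0 < height x" using mem_D_iff_height True by blast
        have "\<forall>\<^sub>F n in sequentially. h n < height x / 2"
          using order_tendstoD(2)[OF hlim, of "height x / 2"] pos by simp
        then have "\<forall>\<^sub>F n in sequentially. collar_cutoff (h n) x = 1"
        proof eventually_elim
          case (elim n)
          then have "2 \<le> height x / h n" using hpos[of n] by (simp add: field_simps)
          then show ?case by (simp add: collar_cutoff_def smooth_step_ge_1)
        qed
        then have "(\<lambda>n. collar_cutoff (h n) x) \<longlonglongrightarrow> 1" by (rule tendsto_eventually)
        then have "(\<lambda>n. indicat_real D x *\<^sub>R (collar_cutoff (h n) x * divergence G' x))
            \<longlonglongrightarrow> indicat_real D x *\<^sub>R (1 * divergence G' x)"
          by (intro tendsto_intros)
        then show ?thesis by simp
      next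
        case False
        \<comment> \<open>Off the smaller ball the chart says nothing about the height, but there
          the field vanishes on an open set and so does its divergence.\<close>
        have "indicat_real D x *\<^sub>R divergence G' x = 0"
        proof (cases "x \<in> D")
          case True
          have "((\<lambda>_. 0) has_derivative G' x) (at x)"
          proof (rule has_derivative_transform_within_open[OF C1_fieldD(2)[OF G True], of "D \<inter> - cball x0 r'"])
            show "open (D \<inter> - cball x0 r')" using open_D by auto
            show "x \<in> D \<inter> - cball x0 r'" using True False by auto
            show "G y = 0" if "y \<in> D \<inter> - cball x0 r'" for y
              using zero[of y] closure_subset[of D] that by auto
          qed
          then have "G' x = (\<lambda>h. 0)"
            using has_derivative_unique has_derivative_const by blast
          then show ?thesis by (simp add: divergence_def)
        qed simp
        then show ?thesis by (auto simp: indicator_def)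
      qed
    qed
  qed
  moreover have "(LINT x:D|lborel. collar_cutoff (h n) x * divergence G' x) = - integral\<^sup>L ?M (F n)" for n
    using chart_divergence_cutoff[OF G r' zero hpos] I by simp
  ultimately have "(\<lambda>n. - integral\<^sup>L ?M (F n)) \<longlonglongrightarrow> (LINT x:D|lborel. divergence G' x)"
    by simp
  moreover have "(\<lambda>n. - integral\<^sup>L ?M (F n)) \<longlonglongrightarrow> - integral\<^sup>L ?M Fl"
    by (intro tendsto_minus F_lim)
  ultimately show "(LINT x:D|lborel. divergence G' x) = - (LINT y|hyperplane_lborel e. \<phi> y)"
    using LIMSEQ_unique unfolding Fl_val by blast
qed

end

section \<open>The flux through the boundary\<close>

lemma Ck_fun_smooth_step:
  assumes "Ck_fun (Suc 0) f"
  shows "Ck_fun (Suc 0) (\<lambda>x. smooth_step (f x))"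
proof (rule Ck_fun_SucI)
  show "((\<lambda>x. smooth_step (f x)) has_derivative (\<lambda>h. tent (f x) * frechet_derivative f (at x) h)) (at x)" for x
    by (rule has_derivative_compose[OF Ck_fun_SucD(1)[OF assms]
          smooth_step_has_derivative[unfolded has_field_derivative_def]])
  show "Ck_fun 0 (\<lambda>x. tent (f x) * frechet_derivative f (at x) b)" if "b \<in> Basis" for b
  proof -
    have "continuous_on UNIV (\<lambda>x. frechet_derivative f (at x) b)"
      using Ck_fun_continuous_on[OF Ck_fun_SucD(2)[OF assms that]] .
    then show ?thesis
      unfolding Ck_fun.simps(1)
      by (intro continuous_on_mult continuous_on_tent Ck_fun_continuous_on[OF assms])
  qed
qed

text \<open>The squared distance keeps the function C^1 at the centre. The parameter
  \<open>c\<close> is the steepness: for positive \<open>c\<close> the value 1 is reached where the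
  difference of squares is at least \<open>1 / c\<close>.\<close>

definition radial_bump :: "real \<Rightarrow> 'a::euclidean_space \<Rightarrow> real \<Rightarrow> 'a \<Rightarrow> real" where
  "radial_bump c p \<rho> x = smooth_step (c * (\<rho>\<^sup>2 - (dist p x)\<^sup>2))"

lemma Ck_fun_radial_bump: "Ck_fun (Suc 0) (radial_bump c p \<rho>)"
proof -
  have d: "((\<lambda>x. c * (\<rho>\<^sup>2 - (p - x) \<bullet> (p - x))) has_derivative (\<lambda>h. c * (0 - ((p - x) \<bullet> (- h) + (- h) \<bullet> (p - x))))) (at x)" for x
    by (rule derivative_eq_intros refl | simp)+
  have "Ck_fun (Suc 0) (\<lambda>x. c * (\<rho>\<^sup>2 - (p - x) \<bullet> (p - x)))"
    by (rule Ck_fun_SucI[OF d]) (auto intro!: continuous_intros)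
  then show ?thesis
    unfolding radial_bump_def[abs_def] dist_norm power2_norm_eq_inner by (rule Ck_fun_smooth_step)
qed

lemma radial_bump_bounds: "0 \<le> radial_bump c p \<rho> x" "radial_bump c p \<rho> x \<le> 1"
  by (simp_all add: radial_bump_def smooth_step_bounds)

lemma radial_bump_outside: "0 \<le> c \<Longrightarrow> 0 \<le> \<rho> \<Longrightarrow> x \<notin> ball p \<rho> \<Longrightarrow> radial_bump c p \<rho> x = 0"
  unfolding radial_bump_def
  by (intro smooth_step_nonpos mult_nonneg_nonpos) (auto intro: power_mono)

lemma Ck_fun_diff_one:
  assumes "Ck_fun k f"
  shows "Ck_fun k (\<lambda>x. 1 - f x)"
  using Ck_fun_add[OF Ck_fun_const[of k 1] Ck_fun_mult[OF Ck_fun_const[of k "-1"] assms]] by (simp del: Ck_fun.simps)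

lemma Ck_fun_prod: "(\<And>i. i \<in> I \<Longrightarrow> Ck_fun k (f i)) \<Longrightarrow> Ck_fun k (\<lambda>x. \<Prod>i\<in>I. f i x)"
  by (induction I rule: infinite_finite_induct) (simp_all add: Ck_fun_const Ck_fun_mult del: Ck_fun.simps)

lemma set_integrable_continuous_closure:
  fixes f :: "'a::euclidean_space \<Rightarrow> 'b::{banach, second_countable_topology}"
  assumes "open D" "bounded D" "continuous_on (closure D) f"
  shows "set_integrable lborel D f"
proof (rule set_integrable_subset)
  show "set_integrable lborel (closure D) f"
    unfolding set_integrable_def
    using assms by (intro borel_integrable_compact) (auto simp: compact_closure)
qed (use assms closure_subset in auto)

text \<open>In the divergence of the product, one term is an integrable function times a bounded
  one, and the other is continuous on the compact closure.\<close>

lemma C1_field_scaleR: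
  fixes F :: "'a::euclidean_space \<Rightarrow> 'a"
  assumes D: "open D" "bounded D" and F: "C1_field D F F'" and \<eta>: "Ck_fun (Suc 0) \<eta>"
    and bd: "\<And>x. 0 \<le> \<eta> x" "\<And>x. \<eta> x \<le> 1"
  shows "C1_field D (\<lambda>x. \<eta> x *\<^sub>R F x) (\<lambda>x h. \<eta> x *\<^sub>R F' x h + frechet_derivative \<eta> (at x) h *\<^sub>R F x)"
proof -
  let ?g = "\<lambda>x. frechet_derivative \<eta> (at x)"
  have ceta: "continuous_on S \<eta>" for S by (rule Ck_fun_continuous_on[OF \<eta>])
  have cg: "continuous_on S (\<lambda>x. ?g x b)" if "b \<in> Basis" for S b
    by (rule Ck_fun_continuous_on[OF Ck_fun_SucD(2)[OF \<eta> that]])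
  have cF: "continuous_on D F"
    by (rule continuous_on_subset[OF C1_fieldD(1)[OF F] closure_subset])
  have div: "divergence (\<lambda>x h. \<eta> x *\<^sub>R F' x h + ?g x h *\<^sub>R F x) =
      (\<lambda>x. \<eta> x * divergence F' x + (\<Sum>b\<in>Basis. ?g x b * (F x \<bullet> b)))"
    by (simp add: divergence_def fun_eq_iff inner_add_left sum.distrib sum_distrib_left)
  have "set_integrable lborel D (\<lambda>x. \<eta> x * divergence F' x)"
  proof (rule set_integrable_mult_bounded[OF C1_fieldD(4)[OF F]])
    show "(\<lambda>x. indicator D x *\<^sub>R \<eta> x) \<in> borel_measurable lborel"
      using borel_measurable_continuous_on_indicator[OF _ ceta] D(1) by simp
    show "\<bar>\<eta> x\<bar> \<le> 1" for x using bd by simp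
  qed
  moreover have "set_integrable lborel D (\<lambda>x. \<Sum>b\<in>Basis. ?g x b * (F x \<bullet> b))"
    by (intro set_integrable_continuous_closure D continuous_on_sum continuous_on_mult
        continuous_on_inner continuous_on_const C1_fieldD(1)[OF F] cg)
  ultimately have "set_integrable lborel D (divergence (\<lambda>x h. \<eta> x *\<^sub>R F' x h + ?g x h *\<^sub>R F x))"
    unfolding div by (rule set_integral_add(1))
  moreover have "continuous_on (closure D) (\<lambda>x. \<eta> x *\<^sub>R F x)"
    by (intro continuous_on_scaleR ceta C1_fieldD(1)[OF F])
  moreover have "((\<lambda>x. \<eta> x *\<^sub>R F x) has_derivative (\<lambda>h. \<eta> x *\<^sub>R F' x h + ?g x h *\<^sub>R F x)) (at x)"
    if "x \<in> D" for x
    by (rule has_derivative_scaleR[OF Ck_fun_SucD(1)[OF \<eta>] C1_fieldD(2)[OF F that]])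
  moreover have "continuous_on D (\<lambda>x. (\<eta> x *\<^sub>R F' x b + ?g x b *\<^sub>R F x) \<bullet> b)" if "b \<in> Basis" for b
    unfolding inner_add_left inner_scaleR_left
    by (intro continuous_on_add continuous_on_mult continuous_on_inner continuous_on_const
        ceta cF cg that C1_fieldD(3)[OF F])
  ultimately show ?thesis unfolding C1_field_def by blast
qed

section \<open>The flux inequality, from one chart to the domain\<close>

abbreviation boundary_integral :: "'a::euclidean_space set \<Rightarrow> 'a measure \<Rightarrow> ('a \<Rightarrow> 'a) \<Rightarrow> ennreal" where
  "boundary_integral D M F \<equiv> \<integral>\<^sup>+x. indicator (frontier D) x * ennreal (norm (F x)) \<partial>M"

lemma measurable_boundary_norm:
  assumes "C1_field D G G'"
  shows "(\<lambda>x. indicator (frontier D) x * ennreal (norm (G x))) \<in> borel_measurable borel"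
proof -
  have "continuous_on (frontier D) G"
    by (rule continuous_on_subset[OF C1_fieldD(1)[OF assms]]) (simp add: frontier_def)
  then have "(\<lambda>x. indicator (frontier D) x *\<^sub>R G x) \<in> borel_measurable borel"
    by (intro borel_measurable_continuous_on_indicator) auto
  then have "(\<lambda>x. ennreal (norm (indicator (frontier D) x *\<^sub>R G x))) \<in> borel_measurable borel"
    by measurable
  also have "(\<lambda>x. ennreal (norm (indicator (frontier D) x *\<^sub>R G x))) =
      (\<lambda>x. indicator (frontier D) x * ennreal (norm (G x)))"
    by (auto simp: fun_eq_iff indicator_def)
  finally show ?thesis .
qed

text \<open>Cauchy-Schwarz bounds the integrand on the graph by the length of the normal times that
  of the field, and the length of the normal is the surface density.\<close>

lemma (in C1_chart) chart_flux_le: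
  assumes G: "C1_field D G G'" and r': "r' < r"
    and zero: "\<And>x. x \<in> closure D \<Longrightarrow> x \<notin> cball x0 r' \<Longrightarrow> G x = 0"
  shows "ennreal (LINT x:D|lborel. divergence G' x) \<le>
    boundary_integral D (graph_surface_measure x0 r e \<gamma>) G"
proof -
  let ?p = "graph_point e \<gamma>" and ?N = "graph_normal e \<gamma>"
  define \<phi> where "\<phi> = (\<lambda>y. indicator (frontier D \<inter> ball x0 r) (?p y) * (?N y \<bullet> G (?p y)))"
  have int: "integrable (hyperplane_lborel e) \<phi>"
    and eq: "(LINT x:D|lborel. divergence G' x) = - (LINT y|hyperplane_lborel e. \<phi> y)"
    using chart_divergence[OF G r' zero] by (simp_all add: \<phi>_def)
  have "(LINT x:D|lborel. divergence G' x) = (LINT y|hyperplane_lborel e. - \<phi> y)"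
    unfolding eq by simp
  also have "\<dots> \<le> (LINT y|hyperplane_lborel e. norm (\<phi> y))"
    using int by (intro integral_mono) auto
  finally have "ennreal (LINT x:D|lborel. divergence G' x) \<le> ennreal (LINT y|hyperplane_lborel e. norm (\<phi> y))"
    by (rule ennreal_leI)
  also have "\<dots> = (\<integral>\<^sup>+y. ennreal (norm (\<phi> y)) \<partial>hyperplane_lborel e)"
    using int by (intro nn_integral_eq_integral[symmetric] integrable_norm) auto
  also have "\<dots> \<le> (\<integral>\<^sup>+y. ennreal (norm (?N y)) * indicator (ball x0 r) (?p y) *
      (indicator (frontier D) (?p y) * ennreal (norm (G (?p y)))) \<partial>hyperplane_lborel e)"
  proof (rule nn_integral_mono)
    fix y
    have "ennreal (\<bar>?N y \<bullet> G (?p y)\<bar>) \<le> ennreal (norm (?N y)) * ennreal (norm (G (?p y)))"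
      by (simp add: ennreal_mult[symmetric] ennreal_leI Cauchy_Schwarz_ineq2)
    then show "ennreal (norm (\<phi> y)) \<le> ennreal (norm (?N y)) * indicator (ball x0 r) (?p y) *
      (indicator (frontier D) (?p y) * ennreal (norm (G (?p y))))"
      by (simp add: \<phi>_def indicator_def)
  qed
  also have "\<dots> = boundary_integral D (graph_surface_measure x0 r e \<gamma>) G"
    by (rule nn_integral_graph_surface_measure[symmetric, OF measurable_boundary_norm[OF G]])
  finally show ?thesis .
qed

text \<open>The existence of a chart excludes the empty supremum, which would be the measure on the
  empty space.\<close>

lemma surface_measure_sets:
  assumes "boundary_chart 1 D x0 r e \<gamma>"
  shows "sets (surface_measure D) = sets borel" and "space (surface_measure D) = UNIV"
proof -
  let ?A = "{graph_surface_measure x0 r e \<gamma> | x0 r e \<gamma>. boundary_chart 1 D x0 r e \<gamma>}"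
  have "sets (SUP m\<in>?A. m) = sets borel"
    by (rule sets_SUP) (use assms in auto)
  then show s: "sets (surface_measure D) = sets borel" by (simp add: surface_measure_def)
  show "space (surface_measure D) = UNIV" using sets_eq_imp_space_eq[OF s] by simp
qed

lemma graph_surface_measure_le:
  assumes "boundary_chart 1 D x0 r e \<gamma>"
  shows "graph_surface_measure x0 r e \<gamma> \<le> surface_measure D"
  unfolding surface_measure_def by (rule Sup_upper) (use assms in blast)

text \<open>Induction over the charts, with the neighbourhood \<open>N\<close> of the frontier
  fixed: cutting out the bump of one chart leaves a field that vanishes in \<open>N\<close> outside
  the balls of the remaining charts. With no chart left, the field vanishes near the frontier and
  the integral of its divergence is 0.\<close>

lemma divergence_le_flux_cover:
  fixes D :: "'a::euclidean_space set"
  assumes D: "open D" "bounded D" and N: "open N" "frontier D \<subseteq> N" and fin: "finite I"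
    and ch: "\<And>p. p \<in> I \<Longrightarrow> boundary_chart 1 D p (r p) (e p) (\<gamma> p)"
  shows "C1_field D F F' \<Longrightarrow> (\<And>x. x \<in> N \<Longrightarrow> x \<notin> (\<Union>p\<in>I. cball p (r p / 4)) \<Longrightarrow> F x = 0) \<Longrightarrow>
    ennreal (LINT x:D|lborel. divergence F' x) \<le> boundary_integral D (surface_measure D) F"
  using fin ch
proof (induction I arbitrary: F F')
  case empty
  have "F x = 0" if "x \<in> N" for x
    using empty.prems that by blast
  then have "(LINT x:D|lborel. divergence F' x) = 0"
    unfolding divergence_def
    by (intro set_integral_divergence_eq_0(2)[OF D N C1_fieldD(2)[OF empty.prems(1)] C1_fieldD(3)[OF empty.prems(1)]])
  then show ?case by simp
next
  case (insert p I)
  have chp: "boundary_chart 1 D p (r p) (e p) (\<gamma> p)" using insert.prems(3) by simp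
  interpret c: C1_chart D p "r p" "e p" "\<gamma> p"
    using chp D by (simp add: C1_chart_def)
  \<comment> \<open>The constant is the reciprocal of (r/2)^2 - (r/4)^2 = 3 r^2 / 16, so the bump is
    1 on the ball of radius r/4 and 0 outside that of radius r/2, strictly inside the chart
    ball.\<close>
  define \<eta> where "\<eta> = radial_bump (16 / (3 * (r p)\<^sup>2)) p (r p / 2)"
  have C1: "Ck_fun (Suc 0) \<eta>" unfolding \<eta>_def by (rule Ck_fun_radial_bump)
  have C1': "Ck_fun (Suc 0) (\<lambda>x. 1 - \<eta> x)" by (rule Ck_fun_diff_one[OF C1])
  have bd: "0 \<le> \<eta> x" "\<eta> x \<le> 1" for x by (simp_all add: \<eta>_def radial_bump_bounds)
  have out: "\<eta> x = 0" if "x \<notin> cball p (r p / 2)" for x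
    unfolding \<eta>_def by (rule radial_bump_outside) (use c.r_pos that in auto)
  have one: "\<eta> x = 1" if "x \<in> cball p (r p / 4)" for x
  proof -
    have "(dist p x)\<^sup>2 \<le> (r p / 4)\<^sup>2" using that by (intro power_mono) auto
    then have "3 * (r p)\<^sup>2 / 16 \<le> (r p / 2)\<^sup>2 - (dist p x)\<^sup>2" by (simp add: power_divide)
    then have "16 / (3 * (r p)\<^sup>2) * (3 * (r p)\<^sup>2 / 16) \<le> 16 / (3 * (r p)\<^sup>2) * ((r p / 2)\<^sup>2 - (dist p x)\<^sup>2)"
      by (rule mult_left_mono) simp
    then have "1 \<le> 16 / (3 * (r p)\<^sup>2) * ((r p / 2)\<^sup>2 - (dist p x)\<^sup>2)" using c.r_pos by simp
    then show ?thesis unfolding \<eta>_def radial_bump_def by (rule smooth_step_ge_1)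
  qed
  note F = insert.prems(1)
  let ?F1 = "\<lambda>x. \<eta> x *\<^sub>R F x" and ?F2 = "\<lambda>x. (1 - \<eta> x) *\<^sub>R F x"
  define F1' where "F1' = (\<lambda>x h. \<eta> x *\<^sub>R F' x h + frechet_derivative \<eta> (at x) h *\<^sub>R F x)"
  define F2' where "F2' = (\<lambda>x h. (1 - \<eta> x) *\<^sub>R F' x h + frechet_derivative (\<lambda>x. 1 - \<eta> x) (at x) h *\<^sub>R F x)"
  have F1: "C1_field D ?F1 F1'"
    unfolding F1'_def by (rule C1_field_scaleR[OF D F C1 bd])
  have F2: "C1_field D ?F2 F2'"
    unfolding F2'_def by (rule C1_field_scaleR[OF D F C1']) (use bd in auto)
  have "frechet_derivative (\<lambda>x. 1 - \<eta> x) (at x) = (\<lambda>h. 0 - frechet_derivative \<eta> (at x) h)" for x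
    by (rule frechet_derivative_at[symmetric]) (intro has_derivative_diff has_derivative_const Ck_fun_SucD(1)[OF C1])
  then have F': "F1' x h + F2' x h = F' x h" for x h
    by (simp add: F1'_def F2'_def algebra_simps)
  have "divergence F' x = divergence F1' x + divergence F2' x" for x
    unfolding divergence_def by (simp add: F'[symmetric] inner_add_left sum.distrib)
  then have "(LINT x:D|lborel. divergence F' x) = (LINT x:D|lborel. divergence F1' x) + (LINT x:D|lborel. divergence F2' x)"
    using set_integral_add(2)[OF C1_fieldD(4)[OF F1] C1_fieldD(4)[OF F2]] by simp
  \<comment> \<open>Conversion to \<open>ennreal\<close> takes the positive part, which is
    subadditive.\<close>
  then have "ennreal (LINT x:D|lborel. divergence F' x) \<le>
      ennreal (LINT x:D|lborel. divergence F1' x) + ennreal (LINT x:D|lborel. divergence F2' x)"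
    by (simp add: ennreal_plus_if ennreal_leI)
  also have "\<dots> \<le> boundary_integral D (surface_measure D) ?F1 +
      boundary_integral D (surface_measure D) ?F2"
  proof (rule add_mono)
    have "ennreal (LINT x:D|lborel. divergence F1' x) \<le>
        boundary_integral D (graph_surface_measure p (r p) (e p) (\<gamma> p)) ?F1"
      by (rule c.chart_flux_le[OF F1, of "r p / 2"]) (use c.r_pos out in auto)
    also have "\<dots> \<le> boundary_integral D (surface_measure D) ?F1"
      by (rule nn_integral_mono_measure[OF _ graph_surface_measure_le[OF chp]])
        (simp add: surface_measure_sets[OF chp])
    finally show "ennreal (LINT x:D|lborel. divergence F1' x) \<le>
        boundary_integral D (surface_measure D) ?F1" .
    show "ennreal (LINT x:D|lborel. divergence F2' x) \<le>
        boundary_integral D (surface_measure D) ?F2"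
    proof (rule insert.IH[OF F2])
      fix x assume x: "x \<in> N" "x \<notin> (\<Union>p\<in>I. cball p (r p / 4))"
      show "?F2 x = 0"
      proof (cases "x \<in> cball p (r p / 4)")
        case True
        then show ?thesis using one by simp
      next
        case False
        then have "F x = 0" using x by (intro insert.prems(2)) auto
        then show ?thesis by simp
      qed
    qed (use insert.prems(3) in auto)
  qed
  also have "\<dots> = (\<integral>\<^sup>+x. indicator (frontier D) x * ennreal (norm (?F1 x)) +
      indicator (frontier D) x * ennreal (norm (?F2 x)) \<partial>surface_measure D)"
  proof (rule nn_integral_add[symmetric])
    have *: "(\<lambda>x. indicator (frontier D) x * ennreal (norm (G x))) \<in> borel_measurable (surface_measure D)"
      if "C1_field D G G'" for G G'
      by (subst measurable_cong_sets[OF surface_measure_sets(1)[OF chp] refl]) (rule measurable_boundary_norm[OF that])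
    show "(\<lambda>x. indicator (frontier D) x * ennreal (norm (?F1 x))) \<in> borel_measurable (surface_measure D)"
      by (rule *[OF F1])
    show "(\<lambda>x. indicator (frontier D) x * ennreal (norm (?F2 x))) \<in> borel_measurable (surface_measure D)"
      by (rule *[OF F2])
  qed
  also have "\<dots> = boundary_integral D (surface_measure D) F"
  proof (rule nn_integral_cong)
    fix x
    have "norm (?F1 x) + norm (?F2 x) = \<eta> x * norm (F x) + (1 - \<eta> x) * norm (F x)"
      using bd[of x] by simp
    also have "\<dots> = norm (F x)" by (simp add: algebra_simps)
    finally have "norm (?F1 x) + norm (?F2 x) = norm (F x)" .
    then have "ennreal (norm (?F1 x)) + ennreal (norm (?F2 x)) = ennreal (norm (F x))"
      by (metis ennreal_plus norm_ge_zero)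
    then show "indicator (frontier D) x * ennreal (norm (?F1 x)) + indicator (frontier D) x * ennreal (norm (?F2 x)) =
        indicator (frontier D) x * ennreal (norm (F x))"
      by (simp only: distrib_left[symmetric])
  qed
  finally show ?case .
qed

lemma boundary_chart_lower: "1 \<le> k \<Longrightarrow> boundary_chart k D x0 r e \<gamma> \<Longrightarrow> boundary_chart 1 D x0 r e \<gamma>"
  unfolding boundary_chart_def using Ck_fun_antimono[of 1 k \<gamma>] by blast

text \<open>Compactness of the frontier yields finitely many charts. Quarter radii leave room for
  bumps that are 1 on the covering balls and vanish well inside the chart balls.\<close>

lemma finite_chart_cover:
  fixes D :: "'a::euclidean_space set"
  assumes D: "bounded D" and k: "1 \<le> k" "Ck_boundary k D"
  obtains I r e \<gamma> where "finite I" "\<And>p. p \<in> I \<Longrightarrow> boundary_chart 1 D p (r p) (e p) (\<gamma> p)"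
    "frontier D \<subseteq> (\<Union>p\<in>I. ball p (r p / 4))"
proof -
  have "\<exists>r e \<gamma>. boundary_chart 1 D x0 r e \<gamma>" if "x0 \<in> frontier D" for x0
    using k that boundary_chart_lower unfolding Ck_boundary_def by blast
  then obtain r e \<gamma> where ch: "\<And>x0. x0 \<in> frontier D \<Longrightarrow> boundary_chart 1 D x0 (r x0) (e x0) (\<gamma> x0)"
    by metis
  then have rpos: "0 < r x0" if "x0 \<in> frontier D" for x0
    using that by (simp add: boundary_chart_def)
  obtain I where "I \<subseteq> frontier D" "finite I" "frontier D \<subseteq> (\<Union>p\<in>I. ball p (r p / 4))"
    by (rule compactE_image[OF compact_frontier_bounded[OF D], of "frontier D" "\<lambda>p. ball p (r p / 4)"])
      (use rpos in force)+
  with ch show thesis by (intro that[of I r e \<gamma>]) auto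
qed

lemma divergence_le_flux:
  fixes D :: "'a::euclidean_space set"
  assumes D: "open D" "bounded D" "D \<noteq> {}" and k: "1 \<le> k" "Ck_boundary k D" and F: "C1_field D F F'"
  shows "ennreal (LINT x:D|lborel. divergence F' x) \<le> boundary_integral D (surface_measure D) F"
proof -
  obtain I r e \<gamma> where I: "finite I" "\<And>p. p \<in> I \<Longrightarrow> boundary_chart 1 D p (r p) (e p) (\<gamma> p)"
    "frontier D \<subseteq> (\<Union>p\<in>I. ball p (r p / 4))"
    by (rule finite_chart_cover[OF D(2) k]) (rule that)
  let ?N = "\<Union>p\<in>I. ball p (r p / 4)"
  show ?thesis
  proof (rule divergence_le_flux_cover[OF D(1,2) _ I(3,1) _ F])
    show "open ?N" by auto
    show "boundary_chart 1 D p (r p) (e p) (\<gamma> p)" if "p \<in> I" for p by (rule I(2)[OF that])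
    \<comment> \<open>Vacuous: the neighbourhood consists of the same balls, so nothing of it lies
      outside their closures.\<close>
    show "F x = 0" if "x \<in> ?N" "x \<notin> (\<Union>p\<in>I. cball p (r p / 4))" for x
      using that by force
  qed
qed

section \<open>Finiteness of the surface measure\<close>

text \<open>The base point of a graph point in the chart ball has norm at most \<open>R\<close>, and
  on \<open>cball 0 R\<close> both the normal is bounded and the hyperplane measure is
  finite.\<close>

lemma (in C1_chart) emeasure_graph_surface_measure_finite:
  "emeasure (graph_surface_measure x0 r e \<gamma>) UNIV < \<infinity>"
proof -
  let ?N = "graph_normal e \<gamma>" and ?p = "graph_point e \<gamma>"
  define R where "R = norm x0 + r"
  obtain C where "0 \<le> C" "\<And>y. y \<in> cball 0 R \<Longrightarrow> norm (?N y) \<le> C"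
    by (rule continuous_on_compact_bound[OF compact_cball[of 0 R] continuous_on_subset[OF continuous_graph_normal subset_UNIV]]) (rule that)
  then have C: "norm (?N y) \<le> C" if "norm y \<le> R" for y using that by simp
  have "emeasure (graph_surface_measure x0 r e \<gamma>) UNIV = (\<integral>\<^sup>+x. 1 \<partial>graph_surface_measure x0 r e \<gamma>)"
    by (simp add: graph_surface_measure_def)
  also have "\<dots> = (\<integral>\<^sup>+y. ennreal (norm (?N y)) * indicator (ball x0 r) (?p y) * 1 \<partial>hyperplane_lborel e)"
    by (rule nn_integral_graph_surface_measure) simp
  also have "\<dots> \<le> (\<integral>\<^sup>+y. ennreal C * indicator (cball 0 R) y \<partial>hyperplane_lborel e)"
  proof (rule nn_integral_mono_AE)
    show "AE y in hyperplane_lborel e. ennreal (norm (?N y)) * indicator (ball x0 r) (?p y) * 1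
        \<le> ennreal C * indicator (cball 0 R) y"
      using AE_hyperplane_lborel[OF e_axis]
    proof eventually_elim
      case (elim y)
      show ?case
      proof (cases "?p y \<in> ball x0 r")
        case True
        then have "norm (?p y) \<le> R"
          using norm_triangle_ineq2[of "?p y" x0] by (simp add: R_def dist_norm norm_minus_commute)
        moreover have "norm y \<le> norm (?p y)"
          using norm_axis_proj_le[of "?p y"] axis_proj_shift[OF elim] by (simp add: graph_point_def)
        ultimately have "norm y \<le> R" by simp
        then show ?thesis using C[of y] True by (simp add: ennreal_leI)
      qed simp
    qed
  qed
  also have "\<dots> = ennreal C * emeasure (hyperplane_lborel e) (cball 0 R)"
    by (simp add: nn_integral_cmult_indicator)
  also have "\<dots> < \<infinity>"
    using emeasure_hyperplane_cball_finite[OF e_axis, of R] by (simp add: ennreal_mult_less_top)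
  finally show ?thesis .
qed

text \<open>Almost every base point whose graph point is in the ball yields a frontier point. Hence
  the chart measure is concentrated on \<open>frontier D \<inter> ball x0 r\<close>.\<close>

lemma (in C1_chart) nn_integral_graph_measure_off_frontier:
  assumes [measurable]: "f \<in> borel_measurable borel" and zero: "\<And>x. x \<in> frontier D \<inter> ball x0 r \<Longrightarrow> f x = 0"
  shows "(\<integral>\<^sup>+x. f x \<partial>graph_surface_measure x0 r e \<gamma>) = 0"
proof -
  have "AE y in hyperplane_lborel e. ennreal (norm (graph_normal e \<gamma> y)) * indicator (ball x0 r) (graph_point e \<gamma> y) *
        f (graph_point e \<gamma> y) = 0"
    using AE_hyperplane_lborel[OF e_axis]
  proof eventually_elim
    case (elim y)
    then show ?case
      using graph_point_frontier[OF elim] zero[of "graph_point e \<gamma> y"] by (simp add: indicator_def)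
  qed
  then show ?thesis
    unfolding nn_integral_graph_surface_measure[OF assms(1)] by (subst nn_integral_cong_AE[where v = "\<lambda>_. 0"]) auto
qed

text \<open>The vector measures \<open>\<nu> dS\<close> of two charts agree on the overlap because the divergence theorem
  determines them; testing in the direction of the normal at a point bounds one surface element by
  twice the other near that point.\<close>

lemma chart_measures_comparable:
  fixes D :: "'a::euclidean_space set"
  assumes c1: "C1_chart D x1 r1 e1 \<gamma>1" and c2: "C1_chart D x2 r2 e2 \<gamma>2"
    and p: "p \<in> ball x1 r1" "p \<in> ball x2 r2"
  shows "\<exists>\<delta>>0. \<forall>\<phi>. Ck_fun (Suc 0) \<phi> \<longrightarrow> (\<forall>x. 0 \<le> \<phi> x) \<longrightarrow> (\<forall>x. x \<notin> ball p \<delta> \<longrightarrow> \<phi> x = 0) \<longrightarrow>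
    (\<integral>\<^sup>+x. ennreal (\<phi> x) \<partial>graph_surface_measure x1 r1 e1 \<gamma>1)
      \<le> 2 * (\<integral>\<^sup>+x. ennreal (\<phi> x) \<partial>graph_surface_measure x2 r2 e2 \<gamma>2)"
proof -
  interpret c1: C1_chart D x1 r1 e1 \<gamma>1 by (rule c1)
  interpret c2: C1_chart D x2 r2 e2 \<gamma>2 by (rule c2)
  let ?N1 = "graph_normal e1 \<gamma>1" and ?N2 = "graph_normal e2 \<gamma>2"
  let ?p1 = "graph_point e1 \<gamma>1" and ?p2 = "graph_point e2 \<gamma>2"
  define q where "q = axis_proj e1 p"
  \<comment> \<open>The unit normal of the first graph over the base point of \<open>p\<close>, and
    the constant direction of the test fields.\<close>
  define w where "w = (1 / norm (?N1 q)) *\<^sub>R ?N1 q"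
  have "(1::real) \<le> sqrt (1 + (\<Sum>b\<in>Basis - {e1, - e1}. (frechet_derivative \<gamma>1 (at q) b)\<^sup>2))"
    by (simp add: sum_nonneg)
  then have Nq: "1 \<le> norm (?N1 q)" by (simp add: c1.norm_graph_normal)
  have Nq0: "norm (?N1 q) \<noteq> 0" using Nq by linarith
  have nw: "norm w = 1" using Nq0 by (simp add: w_def)
  \<comment> \<open>Positivity says that the normal at \<open>y\<close> makes an angle below 60
    degrees with \<open>w\<close>. This is the source of the factor 2, and it persists near
    \<open>q\<close> by continuity.\<close>
  define c where "c = (\<lambda>y. ?N1 y \<bullet> w - norm (?N1 y) / 2)"
  have cont_c: "continuous_on UNIV c"
    unfolding c_def by (intro continuous_intros c1.continuous_graph_normal) auto
  have "?N1 q \<bullet> w = norm (?N1 q)" 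
    unfolding w_def inner_scaleR_right power2_norm_eq_inner[symmetric] power2_eq_square using Nq0 by simp
  then have "0 < c q" unfolding c_def using Nq by linarith
  moreover have "open {y. 0 < c y}" by (intro open_Collect_less cont_c continuous_on_const)
  ultimately obtain d where d: "0 < d" "ball q d \<subseteq> {y. 0 < c y}"
    unfolding open_contains_ball by blast
  \<comment> \<open>The halves keep the support of test functions strictly inside both chart balls.
    The bound \<open>d\<close> keeps the base points where the angle condition holds, since
    projection does not increase distances.\<close>
  define \<delta> where "\<delta> = min d (min ((r1 - dist x1 p) / 2) ((r2 - dist x2 p) / 2))"
  have \<delta>: "0 < \<delta>" using d(1) p by (simp add: \<delta>_def)
  have sub: "dist x1 p + \<delta> < r1" "dist x2 p + \<delta> < r2"
  proof -
    have "\<delta> \<le> (r1 - dist x1 p) / 2" unfolding \<delta>_def by linarith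
    moreover have "dist x1 p < r1" using p by simp
    ultimately show "dist x1 p + \<delta> < r1" by argo
    have "\<delta> \<le> (r2 - dist x2 p) / 2" unfolding \<delta>_def by linarith
    moreover have "dist x2 p < r2" using p by simp
    ultimately show "dist x2 p + \<delta> < r2" by argo
  qed
  show ?thesis
  proof (intro exI[of _ \<delta>] conjI allI impI \<delta>)
    fix \<phi> :: "'a \<Rightarrow> real"
    assume C1: "Ck_fun (Suc 0) \<phi>" and nonneg: "\<forall>x. 0 \<le> \<phi> x" and out: "\<forall>x. x \<notin> ball p \<delta> \<longrightarrow> \<phi> x = 0"
    have cphi: "continuous_on S \<phi>" for S by (rule Ck_fun_continuous_on[OF C1])
    have mphi [measurable]: "\<phi> \<in> borel_measurable borel"
      by (rule borel_measurable_continuous_onI[OF cphi])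
    let ?G = "\<lambda>x. \<phi> x *\<^sub>R w" and ?G' = "\<lambda>x h. frechet_derivative \<phi> (at x) h *\<^sub>R w"
    have cG': "continuous_on S (\<lambda>x. ?G' x b \<bullet> b)" if "b \<in> Basis" for b S
      by (intro continuous_on_inner continuous_on_scaleR continuous_on_const
          Ck_fun_continuous_on[OF Ck_fun_SucD(2)[OF C1 that]])
    have field: "C1_field D ?G ?G'"
      unfolding C1_field_def divergence_def
    proof (intro conjI ballI)
      show "continuous_on (closure D) ?G" by (intro continuous_on_scaleR cphi continuous_on_const)
      show "(?G has_derivative ?G' x) (at x)" for x
        by (rule has_derivative_scaleR_left[OF Ck_fun_SucD(1)[OF C1]])
      show "continuous_on D (\<lambda>x. ?G' x b \<bullet> b)" if "b \<in> Basis" for b by (rule cG'[OF that])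
      show "set_integrable lborel D (\<lambda>x. \<Sum>b\<in>Basis. ?G' x b \<bullet> b)"
        by (intro set_integrable_continuous_closure c1.open_D c1.bounded_D continuous_on_sum cG')
    qed
    have z1: "?G x = 0" if "x \<notin> cball x1 (dist x1 p + \<delta>)" for x
    proof -
      have "\<not> dist p x < \<delta>" using that dist_triangle[of x1 x p] unfolding mem_cball by linarith
      then show ?thesis using out by simp
    qed
    have z2: "?G x = 0" if "x \<notin> cball x2 (dist x2 p + \<delta>)" for x
    proof -
      have "\<not> dist p x < \<delta>" using that dist_triangle[of x2 x p] unfolding mem_cball by linarith
      then show ?thesis using out by simp
    qed
    define f1 where "f1 = (\<lambda>y. indicator (frontier D \<inter> ball x1 r1) (?p1 y) * (?N1 y \<bullet> ?G (?p1 y)))"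
    define f2 where "f2 = (\<lambda>y. indicator (frontier D \<inter> ball x2 r2) (?p2 y) * (?N2 y \<bullet> ?G (?p2 y)))"
    note I1 = c1.chart_divergence[OF field sub(1) z1, folded f1_def]
    note I2 = c2.chart_divergence[OF field sub(2) z2, folded f2_def]
    \<comment> \<open>Both sides are minus the integral over \<open>D\<close> of the divergence of
      the same field.\<close>
    have eq: "(LINT y|hyperplane_lborel e1. f1 y) = (LINT y|hyperplane_lborel e2. f2 y)"
      using I1(2) I2(2) by simp
    have ae: "AE y in hyperplane_lborel e1. norm (?N1 y) * indicator (ball x1 r1) (?p1 y) * \<phi> (?p1 y) \<le> 2 * f1 y"
      using AE_hyperplane_lborel[OF c1.e_axis]
    proof eventually_elim
      case (elim y)
      show ?case
      proof (cases "\<phi> (?p1 y) = 0")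
        case True
        then show ?thesis by (simp add: f1_def)
      next
        case False
        then have near: "?p1 y \<in> ball p \<delta>" using out by blast
        then have "dist x1 (?p1 y) < r1"
          using sub(1) dist_triangle[of x1 "?p1 y" p] unfolding mem_ball by linarith
        then have inb: "?p1 y \<in> ball x1 r1" by simp
        have fr: "?p1 y \<in> frontier D" by (rule c1.graph_point_frontier[OF elim inb])
        have "q - y = axis_proj e1 (p - ?p1 y)"
          using c1.axis_proj_shift[OF elim, of "\<gamma>1 y"]
          by (simp add: q_def linear_diff[OF bounded_linear.linear[OF c1.axis_proj_linear]] graph_point_def)
        then have "dist q y \<le> dist p (?p1 y)"
          using c1.norm_axis_proj_le by (simp add: dist_norm)
        then have "y \<in> ball q d" using near by (simp add: \<delta>_def)
        then have "0 < c y" using d(2) by blast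
        then have "norm (?N1 y) * \<phi> (?p1 y) \<le> 2 * (?N1 y \<bullet> w) * \<phi> (?p1 y)"
          using nonneg unfolding c_def by (intro mult_right_mono) (linarith, blast)
        moreover have "f1 y = (?N1 y \<bullet> w) * \<phi> (?p1 y)" using inb fr by (simp add: f1_def)
        moreover have "indicat_real (ball x1 r1) (?p1 y) = 1" using inb by simp
        ultimately show ?thesis by simp
      qed
    qed
    have nonneg_lhs: "0 \<le> norm (?N1 y) * indicator (ball x1 r1) (?p1 y) * \<phi> (?p1 y)" for y
      using nonneg by simp
    have ae0: "AE y in hyperplane_lborel e1. 0 \<le> f1 y"
      using ae
    proof eventually_elim
      case (elim y)
      then show ?case using nonneg_lhs[of y] by linarith
    qed
    have "(\<integral>\<^sup>+x. ennreal (\<phi> x) \<partial>graph_surface_measure x1 r1 e1 \<gamma>1) =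
        (\<integral>\<^sup>+y. ennreal (norm (?N1 y)) * indicator (ball x1 r1) (?p1 y) * ennreal (\<phi> (?p1 y)) \<partial>hyperplane_lborel e1)"
      by (rule c1.nn_integral_graph_surface_measure) measurable
    also have "\<dots> = (\<integral>\<^sup>+y. ennreal (norm (?N1 y) * indicator (ball x1 r1) (?p1 y) * \<phi> (?p1 y)) \<partial>hyperplane_lborel e1)"
      using nonneg by (intro nn_integral_cong) (auto simp: indicator_def ennreal_mult)
    also have "\<dots> \<le> (\<integral>\<^sup>+y. ennreal (2 * f1 y) \<partial>hyperplane_lborel e1)"
      by (rule nn_integral_mono_AE, rule eventually_mono[OF ae], rule ennreal_leI)
    also have "\<dots> = ennreal (LINT y|hyperplane_lborel e1. 2 * f1 y)"
      using I1(1) ae0 by (intro nn_integral_eq_integral) auto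
    also have "(LINT y|hyperplane_lborel e1. 2 * f1 y) = 2 * (LINT y|hyperplane_lborel e2. f2 y)"
      using eq by simp
    also have "ennreal (2 * (LINT y|hyperplane_lborel e2. f2 y)) \<le> ennreal (2 * (LINT y|hyperplane_lborel e2. norm (f2 y)))"
      using I2(1) by (intro ennreal_leI mult_left_mono integral_mono) auto
    also have "\<dots> = 2 * ennreal (LINT y|hyperplane_lborel e2. norm (f2 y))"
      by (simp add: ennreal_mult)
    also have "ennreal (LINT y|hyperplane_lborel e2. norm (f2 y)) = (\<integral>\<^sup>+y. ennreal (norm (f2 y)) \<partial>hyperplane_lborel e2)"
      using I2(1) by (intro nn_integral_eq_integral[symmetric] integrable_norm) auto
    also have "2 * (\<integral>\<^sup>+y. ennreal (norm (f2 y)) \<partial>hyperplane_lborel e2)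
        \<le> 2 * (\<integral>\<^sup>+y. ennreal (norm (?N2 y)) * indicator (ball x2 r2) (?p2 y) * ennreal (\<phi> (?p2 y)) \<partial>hyperplane_lborel e2)"
    proof (intro mult_left_mono nn_integral_mono)
      fix y
      \<comment> \<open>In the second chart no angle condition enters: \<open>w\<close> has length
        1, so Cauchy-Schwarz gives the upper bound.\<close>
      have "\<bar>?N2 y \<bullet> w\<bar> \<le> norm (?N2 y)" using Cauchy_Schwarz_ineq2[of "?N2 y" w] nw by simp
      then have "\<bar>?N2 y \<bullet> w\<bar> * \<phi> (?p2 y) \<le> norm (?N2 y) * \<phi> (?p2 y)"
        using nonneg by (intro mult_right_mono) simp_all
      moreover have "\<bar>?N2 y \<bullet> ?G (?p2 y)\<bar> = \<bar>?N2 y \<bullet> w\<bar> * \<phi> (?p2 y)"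
        using nonneg by (simp add: abs_mult)
      ultimately have "\<bar>?N2 y \<bullet> ?G (?p2 y)\<bar> \<le> norm (?N2 y) * \<phi> (?p2 y)" by simp
      then have "ennreal \<bar>?N2 y \<bullet> ?G (?p2 y)\<bar> \<le> ennreal (norm (?N2 y)) * ennreal (\<phi> (?p2 y))"
        using nonneg by (simp add: ennreal_mult[symmetric] ennreal_leI)
      then show "ennreal (norm (f2 y)) \<le> ennreal (norm (?N2 y)) * indicator (ball x2 r2) (?p2 y) * ennreal (\<phi> (?p2 y))"
        by (simp add: f2_def indicator_def)
    qed simp
    also have "(\<integral>\<^sup>+y. ennreal (norm (?N2 y)) * indicator (ball x2 r2) (?p2 y) * ennreal (\<phi> (?p2 y)) \<partial>hyperplane_lborel e2)
        = (\<integral>\<^sup>+x. ennreal (\<phi> x) \<partial>graph_surface_measure x2 r2 e2 \<gamma>2)"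
      by (rule c2.nn_integral_graph_surface_measure[symmetric]) measurable
    finally show "(\<integral>\<^sup>+x. ennreal (\<phi> x) \<partial>graph_surface_measure x1 r1 e1 \<gamma>1)
      \<le> 2 * (\<integral>\<^sup>+x. ennreal (\<phi> x) \<partial>graph_surface_measure x2 r2 e2 \<gamma>2)" .
  qed
qed

section \<open>From C^1 test functions to measures of open sets\<close>

lemma sum_mult_prod_complement:
  fixes f :: "nat \<Rightarrow> real"
  shows "(\<Sum>k<n. f k * (\<Prod>j<k. 1 - f j)) = 1 - (\<Prod>k<n. 1 - f k)"
  by (induction n) (simp_all add: algebra_simps)

text \<open>The test functions are C^1 because the comparison of charts applies the divergence
  theorem to them.\<close>

abbreviation test_le_on_ball :: "'a::euclidean_space measure \<Rightarrow> 'a measure \<Rightarrow> 'a \<Rightarrow> real \<Rightarrow> bool" where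
  "test_le_on_ball \<mu> M p \<delta> \<equiv> \<forall>\<phi>. Ck_fun (Suc 0) \<phi> \<longrightarrow> (\<forall>x. 0 \<le> \<phi> x) \<longrightarrow>
     (\<forall>x. x \<notin> ball p \<delta> \<longrightarrow> \<phi> x = 0) \<longrightarrow> (\<integral>\<^sup>+x. ennreal (\<phi> x) \<partial>\<mu>) \<le> (\<integral>\<^sup>+x. ennreal (\<phi> x) \<partial>M)"

text \<open>The indicator of \<open>W\<close> is approximated from below by finite sums of C^1
  functions, each supported in one ball on which the comparison holds. Summing the local
  inequalities and applying Fatou's lemma gives the claim.\<close>

lemma emeasure_open_le_of_local_test:
  fixes \<mu> M :: "'a::euclidean_space measure"
  assumes sets: "sets \<mu> = sets borel" "sets M = sets borel" and W: "open W" "W \<noteq> {}"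
    and local: "\<And>p. p \<in> W \<Longrightarrow> \<exists>\<delta>>0. test_le_on_ball \<mu> M p \<delta>"
  shows "emeasure \<mu> W \<le> emeasure M W"
proof -
  have "\<exists>\<rho>>0. ball p \<rho> \<subseteq> W \<and> (test_le_on_ball \<mu> M p \<rho>)"
    if p: "p \<in> W" for p
  proof -
    obtain \<delta> where \<delta>: "\<delta> > 0" "\<And>\<phi>. Ck_fun (Suc 0) \<phi> \<Longrightarrow> (\<forall>x. 0 \<le> \<phi> x) \<Longrightarrow>
      (\<forall>x. x \<notin> ball p \<delta> \<longrightarrow> \<phi> x = 0) \<Longrightarrow> (\<integral>\<^sup>+x. ennreal (\<phi> x) \<partial>\<mu>) \<le> (\<integral>\<^sup>+x. ennreal (\<phi> x) \<partial>M)"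
      using local[OF p] by blast
    obtain \<epsilon> where \<epsilon>: "\<epsilon> > 0" "ball p \<epsilon> \<subseteq> W" using W(1) p open_contains_ball by blast
    show ?thesis
    proof (intro exI[of _ "min \<delta> \<epsilon>"] conjI allI impI)
      show "0 < min \<delta> \<epsilon>" using \<delta> \<epsilon> by simp
      show "ball p (min \<delta> \<epsilon>) \<subseteq> W" using \<epsilon>(2) by auto
      show "(\<integral>\<^sup>+x. ennreal (\<phi> x) \<partial>\<mu>) \<le> (\<integral>\<^sup>+x. ennreal (\<phi> x) \<partial>M)"
        if "Ck_fun (Suc 0) \<phi>" "\<forall>x. 0 \<le> \<phi> x" "\<forall>x. x \<notin> ball p (min \<delta> \<epsilon>) \<longrightarrow> \<phi> x = 0" for \<phi> :: "'a \<Rightarrow> real"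
        using that by (intro \<delta>(2)) auto
    qed
  qed
  then obtain \<rho> where \<rho>: "\<And>p. p \<in> W \<Longrightarrow> \<rho> p > 0" "\<And>p. p \<in> W \<Longrightarrow> ball p (\<rho> p) \<subseteq> W"
    and test: "\<And>p \<phi>. p \<in> W \<Longrightarrow> Ck_fun (Suc 0) \<phi> \<Longrightarrow> (\<forall>x. 0 \<le> \<phi> x) \<Longrightarrow>
      (\<forall>x. x \<notin> ball p (\<rho> p) \<longrightarrow> \<phi> x = 0) \<Longrightarrow> (\<integral>\<^sup>+x. ennreal (\<phi> x) \<partial>\<mu>) \<le> (\<integral>\<^sup>+x. ennreal (\<phi> x) \<partial>M)"
    by metis
  obtain P where P: "P \<subseteq> W" "countable P" "W = (\<Union>p\<in>P. ball p (\<rho> p))"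
  proof -
    obtain \<F> where F: "\<F> \<subseteq> (\<lambda>p. ball p (\<rho> p)) ` W" "countable \<F>" "\<Union>\<F> = \<Union>((\<lambda>p. ball p (\<rho> p)) ` W)"
      using Lindelof[of "(\<lambda>p. ball p (\<rho> p)) ` W"] by auto
    have "countable \<F> \<and> \<F> \<subseteq> (\<lambda>p. ball p (\<rho> p)) ` W" using F(1,2) by blast
    then obtain P where P: "P \<subseteq> W" "countable P" "\<F> = (\<lambda>p. ball p (\<rho> p)) ` P"
      unfolding countable_subset_image by blast
    have "W \<subseteq> \<Union>((\<lambda>p. ball p (\<rho> p)) ` W)"
    proof
      fix x assume x: "x \<in> W"
      then have "x \<in> ball x (\<rho> x)" using \<rho>(1) by simp
      with x show "x \<in> \<Union>((\<lambda>p. ball p (\<rho> p)) ` W)" by blast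
    qed
    moreover have "\<Union>((\<lambda>p. ball p (\<rho> p)) ` W) \<subseteq> W" using \<rho>(2) by blast
    ultimately have "W = \<Union>((\<lambda>p. ball p (\<rho> p)) ` W)" by (rule subset_antisym)
    then have "W = (\<Union>p\<in>P. ball p (\<rho> p))" using F(3) unfolding P(3) by (rule trans[OF _ sym])
    then show thesis by (rule that[OF P(1,2)])
  qed
  have "P \<noteq> {}"
  proof
    assume "P = {}"
    then have "W = {}" using P(3) by (metis UN_empty)
    then show False using W(2) by contradiction
  qed
  \<comment> \<open>An enumeration with repetitions is allowed, so finite and infinite covers are
    treated alike; \<open>P\<close> must be nonempty.\<close>
  define s where "s = from_nat_into P"
  have s: "range s = P" unfolding s_def by (rule range_from_nat_into[OF \<open>P \<noteq> {}\<close> P(2)])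
  have sW: "s k \<in> W" for k using s P(1) by blast
  \<comment> \<open>Number of bumps and steepness grow together: at a point of the k-th ball, the
    k-th bump is eventually used and equal to 1.\<close>
  define \<psi> where "\<psi> = (\<lambda>n k. radial_bump (real n) (s k) (\<rho> (s k)))"
  \<comment> \<open>The k-th bump takes its share of what the earlier ones leave over. The sum
    telescopes to 1 minus a product, so it stays at most 1 and equals 1 as soon as one bump
    does.\<close>
  define \<theta> where "\<theta> = (\<lambda>n k x. \<psi> n k x * (\<Prod>j<k. 1 - \<psi> n j x))"
  define \<Phi> where "\<Phi> = (\<lambda>n x. \<Sum>k<n. \<theta> n k x)"
  have psi: "0 \<le> \<psi> n k x" "\<psi> n k x \<le> 1" for n k x by (simp_all add: \<psi>_def radial_bump_bounds)
  have psi_out: "\<psi> n k x = 0" if "x \<notin> ball (s k) (\<rho> (s k))" for n k x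
    unfolding \<psi>_def using that \<rho>(1)[OF sW[of k]] by (intro radial_bump_outside) auto
  have C1psi: "Ck_fun (Suc 0) (\<psi> n k)" for n k unfolding \<psi>_def by (rule Ck_fun_radial_bump)
  have C1: "Ck_fun (Suc 0) (\<theta> n k)" for n k
    unfolding \<theta>_def by (intro Ck_fun_mult Ck_fun_prod Ck_fun_diff_one C1psi)
  have nonneg: "0 \<le> \<theta> n k x" for n k x
    unfolding \<theta>_def using psi by (intro mult_nonneg_nonneg prod_nonneg) auto
  have \<theta>_out: "\<theta> n k x = 0" if "x \<notin> ball (s k) (\<rho> (s k))" for n k x
    using psi_out[OF that] by (simp add: \<theta>_def)
  have \<Phi>: "\<Phi> n x = 1 - (\<Prod>k<n. 1 - \<psi> n k x)" for n x
    unfolding \<Phi>_def \<theta>_def by (rule sum_mult_prod_complement)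
  have \<Phi>_le: "\<Phi> n x \<le> indicator W x" for n x
  proof (cases "x \<in> W")
    case True
    have "0 \<le> (\<Prod>k<n. 1 - \<psi> n k x)" using psi by (intro prod_nonneg) auto
    then show ?thesis using True by (simp add: \<Phi>)
  next
    case False
    then have "x \<notin> ball (s k) (\<rho> (s k))" for k using \<rho>(2)[OF sW[of k]] by blast
    then have "\<Phi> n x = 0" unfolding \<Phi>_def using \<theta>_out by (intro sum.neutral) blast
    then show ?thesis by simp
  qed
  have \<Phi>_nonneg: "0 \<le> \<Phi> n x" for n x unfolding \<Phi>_def by (intro sum_nonneg nonneg)
  have cont: "continuous_on UNIV (\<theta> n k)" for n k by (rule Ck_fun_continuous_on[OF C1])
  have m\<theta> [measurable]: "\<theta> n k \<in> borel_measurable borel" for n k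
    by (rule borel_measurable_continuous_onI[OF cont])
  have m\<Phi> [measurable]: "\<Phi> n \<in> borel_measurable borel" for n unfolding \<Phi>_def by measurable
  have le: "(\<integral>\<^sup>+x. ennreal (\<Phi> n x) \<partial>\<mu>) \<le> emeasure M W" for n
  proof -
    have m\<mu>: "(\<lambda>x. ennreal (\<theta> n k x)) \<in> borel_measurable N" if "sets N = sets borel" for k N
      by (subst measurable_cong_sets[OF that refl]) measurable
    have split: "(\<integral>\<^sup>+x. ennreal (\<Phi> n x) \<partial>N) = (\<Sum>k<n. \<integral>\<^sup>+x. ennreal (\<theta> n k x) \<partial>N)" if "sets N = sets borel" for N
    proof -
      have "(\<integral>\<^sup>+x. ennreal (\<Phi> n x) \<partial>N) = (\<integral>\<^sup>+x. (\<Sum>k<n. ennreal (\<theta> n k x)) \<partial>N)"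
        unfolding \<Phi>_def by (subst sum_ennreal) (auto simp: nonneg)
      also have "\<dots> = (\<Sum>k<n. \<integral>\<^sup>+x. ennreal (\<theta> n k x) \<partial>N)"
        by (rule nn_integral_sum) (rule m\<mu>[OF that])
      finally show ?thesis .
    qed
    have "(\<integral>\<^sup>+x. ennreal (\<Phi> n x) \<partial>\<mu>) = (\<Sum>k<n. \<integral>\<^sup>+x. ennreal (\<theta> n k x) \<partial>\<mu>)" by (rule split[OF sets(1)])
    also have "\<dots> \<le> (\<Sum>k<n. \<integral>\<^sup>+x. ennreal (\<theta> n k x) \<partial>M)"
    proof (rule sum_mono)
      fix k
      show "(\<integral>\<^sup>+x. ennreal (\<theta> n k x) \<partial>\<mu>) \<le> (\<integral>\<^sup>+x. ennreal (\<theta> n k x) \<partial>M)"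
        by (rule test[OF sW[of k] C1]) (use nonneg \<theta>_out in blast)+
    qed
    also have "\<dots> = (\<integral>\<^sup>+x. ennreal (\<Phi> n x) \<partial>M)" by (rule split[OF sets(2), symmetric])
    also have "\<dots> \<le> (\<integral>\<^sup>+x. indicator W x \<partial>M)"
    proof (rule nn_integral_mono)
      fix x
      have "ennreal (\<Phi> n x) \<le> ennreal (indicator W x)" by (rule ennreal_leI[OF \<Phi>_le])
      then show "ennreal (\<Phi> n x) \<le> indicator W x" by (simp add: ennreal_indicator)
    qed
    also have "\<dots> = emeasure M W" using W(1) sets(2) by simp
    finally show ?thesis .
  qed
  have conv: "(\<lambda>n. ennreal (\<Phi> n x)) \<longlonglongrightarrow> 1" if x: "x \<in> W" for x
  proof -
    have "x \<in> (\<Union>p\<in>P. ball p (\<rho> p))" using x unfolding P(3)[symmetric] .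
    then obtain k where k: "x \<in> ball (s k) (\<rho> (s k))" unfolding s[symmetric] by blast
    define t where "t = (\<rho> (s k))\<^sup>2 - (dist (s k) x)\<^sup>2"
    have "(dist (s k) x)\<^sup>2 < (\<rho> (s k))\<^sup>2" using k by (intro power_strict_mono) auto
    then have t: "0 < t" by (simp add: t_def)
    obtain n0 where n0: "1 / t < real n0" using reals_Archimedean2 by blast
    have "\<forall>\<^sub>F n in sequentially. max (Suc k) n0 \<le> n" by (rule eventually_ge_at_top)
    then have "\<forall>\<^sub>F n in sequentially. ennreal (\<Phi> n x) = 1"
    proof eventually_elim
      case (elim n)
      have "1 \<le> real n0 * t" using n0 t by (simp add: field_simps)
      also have "\<dots> \<le> real n * t" using elim t by (intro mult_right_mono) auto
      finally have "\<psi> n k x = 1"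
        unfolding \<psi>_def radial_bump_def t_def by (rule smooth_step_ge_1)
      then have "(\<Prod>k<n. 1 - \<psi> n k x) = 0"
        using elim by (intro prod_zero) (auto intro!: bexI[of _ k])
      then show ?case by (simp add: \<Phi>)
    qed
    then show ?thesis by (rule tendsto_eventually)
  qed
  have "emeasure \<mu> W = (\<integral>\<^sup>+x. indicator W x \<partial>\<mu>)" using W(1) sets(1) by simp
  also have "\<dots> \<le> (\<integral>\<^sup>+x. liminf (\<lambda>n. ennreal (\<Phi> n x)) \<partial>\<mu>)"
  proof (rule nn_integral_mono)
    fix x
    show "indicator W x \<le> liminf (\<lambda>n. ennreal (\<Phi> n x))"
    proof (cases "x \<in> W")
      case True
      have "liminf (\<lambda>n. ennreal (\<Phi> n x)) = 1"
        using conv[OF True] by (intro lim_imp_Liminf) auto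
      then show ?thesis by (simp add: indicator_def)
    qed simp
  qed
  also have "\<dots> \<le> liminf (\<lambda>n. \<integral>\<^sup>+x. ennreal (\<Phi> n x) \<partial>\<mu>)"
    by (rule nn_integral_liminf) (subst measurable_cong_sets[OF sets(1) refl], measurable)
  also have "\<dots> \<le> liminf (\<lambda>n. emeasure M W)"
    by (rule Liminf_mono) (simp add: le)
  also have "\<dots> = emeasure M W" by (simp add: Liminf_const)
  finally show ?thesis .
qed

text \<open>A finite measure that dominates every chart measure dominates their supremum. Such a
  measure is twice the sum over a finite cover by charts: near each frontier point it contains twice
  a chart measure, which suffices by comparison.\<close>

lemma surface_measure_finite:
  fixes D :: "'a::euclidean_space set"
  assumes D: "open D" "bounded D" "D \<noteq> {}" and k: "1 \<le> k" "Ck_boundary k D"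
  shows "sets (surface_measure D) = sets borel" and "emeasure (surface_measure D) UNIV < \<infinity>"
proof -
  obtain I r e \<gamma> where I: "finite I" "\<And>p. p \<in> I \<Longrightarrow> boundary_chart 1 D p (r p) (e p) (\<gamma> p)"
    "frontier D \<subseteq> (\<Union>p\<in>I. ball p (r p / 4))"
    by (rule finite_chart_cover[OF D(2) k]) (rule that)
  \<comment> \<open>A nonempty bounded set has a nonempty frontier, so the family of charts is not
    empty.\<close>
  have "D \<noteq> UNIV" using D(2) not_bounded_UNIV by metis
  then have "frontier D \<noteq> {}" using D(3) frontier_not_empty by blast
  then obtain z where z: "z \<in> I" using I(3) by blast
  note chz = I(2)[OF z]
  show sets: "sets (surface_measure D) = sets borel" by (rule surface_measure_sets[OF chz])
  define \<mu> where "\<mu> = (\<lambda>p. graph_surface_measure p (r p) (e p) (\<gamma> p))"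
  have chart: "C1_chart D p (r p) (e p) (\<gamma> p)" if "p \<in> I" for p
    using I(2) D that by (simp add: C1_chart_def)
  have sets_mu [simp]: "sets (\<mu> p) = sets borel" for p by (simp add: \<mu>_def)
  define M where "M = measure_of UNIV (sets borel) (\<lambda>A. \<Sum>p\<in>I. 2 * emeasure (\<mu> p) A)"
  have setsM: "sets M = sets borel" unfolding M_def by (metis sets.sets_measure_of_eq sets_measure_of space_borel sets.space_closed)
  have emM: "emeasure M A = (\<Sum>p\<in>I. 2 * emeasure (\<mu> p) A)" if "A \<in> sets borel" for A
  proof (rule emeasure_measure_of[OF M_def])
    show "sets borel \<subseteq> Pow (UNIV::'a set)" by simp
    show "A \<in> sets M" using that setsM by simp
    show "positive (sets M) (\<lambda>A. \<Sum>p\<in>I. 2 * emeasure (\<mu> p) A)" by (simp add: positive_def)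
    show "countably_additive (sets M) (\<lambda>A. \<Sum>p\<in>I. 2 * emeasure (\<mu> p) A)"
      unfolding countably_additive_def
    proof (intro allI impI)
      fix B :: "nat \<Rightarrow> 'a set"
      assume B: "range B \<subseteq> sets M" "disjoint_family B"
      have "(\<Sum>n. \<Sum>p\<in>I. 2 * emeasure (\<mu> p) (B n)) = (\<Sum>p\<in>I. \<Sum>n. 2 * emeasure (\<mu> p) (B n))"
        by (rule suminf_sum) auto
      also have "\<dots> = (\<Sum>p\<in>I. 2 * emeasure (\<mu> p) (\<Union> (range B)))"
      proof (rule sum.cong[OF refl])
        fix p
        have "(\<Sum>n. emeasure (\<mu> p) (B n)) = emeasure (\<mu> p) (\<Union> (range B))"
          using B setsM by (intro suminf_emeasure) auto
        then show "(\<Sum>n. 2 * emeasure (\<mu> p) (B n)) = 2 * emeasure (\<mu> p) (\<Union> (range B))"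
          by (simp add: ennreal_suminf_cmult)
      qed
      finally show "(\<Sum>n. \<Sum>p\<in>I. 2 * emeasure (\<mu> p) (B n)) = (\<Sum>p\<in>I. 2 * emeasure (\<mu> p) (\<Union> (range B)))" .
    qed
  qed
  have finM: "emeasure M UNIV < \<infinity>"
  proof -
    have "emeasure (\<mu> p) UNIV < \<infinity>" if "p \<in> I" for p
      unfolding \<mu>_def by (rule C1_chart.emeasure_graph_surface_measure_finite[OF chart[OF that]])
    then show ?thesis
      using I(1) by (simp add: emM ennreal_mult_less_top)
  qed
  have le_M: "2 * (\<integral>\<^sup>+x. f x \<partial>\<mu> p) \<le> (\<integral>\<^sup>+x. f x \<partial>M)" if p: "p \<in> I" and f: "f \<in> borel_measurable borel" for p f
  proof -
    have "scale_measure 2 (\<mu> p) \<le> M"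
    proof (subst le_measure)
      show "sets (scale_measure 2 (\<mu> p)) = sets M" using setsM by simp
      show "\<forall>A\<in>sets (scale_measure 2 (\<mu> p)). emeasure (scale_measure 2 (\<mu> p)) A \<le> emeasure M A"
      proof
        fix A assume "A \<in> sets (scale_measure 2 (\<mu> p))"
        then have A: "A \<in> sets borel" by simp
        show "emeasure (scale_measure 2 (\<mu> p)) A \<le> emeasure M A"
          unfolding emM[OF A] using p I(1) member_le_sum[of p I "\<lambda>p. 2 * emeasure (\<mu> p) A"] by simp
      qed
    qed
    then have "(\<integral>\<^sup>+x. f x \<partial>scale_measure 2 (\<mu> p)) \<le> (\<integral>\<^sup>+x. f x \<partial>M)"
      by (intro nn_integral_mono_measure) (simp_all add: setsM)
    moreover have "(\<integral>\<^sup>+x. f x \<partial>scale_measure 2 (\<mu> p)) = 2 * (\<integral>\<^sup>+x. f x \<partial>\<mu> p)"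
      by (rule nn_integral_scale_measure) (subst measurable_cong_sets[OF sets_mu refl], rule f)
    ultimately show ?thesis by simp
  qed
  have "graph_surface_measure x1 r1 e1 \<gamma>1 \<le> M" if ch1: "boundary_chart 1 D x1 r1 e1 \<gamma>1" for x1 r1 e1 \<gamma>1
  proof -
    let ?\<nu> = "graph_surface_measure x1 r1 e1 \<gamma>1"
    interpret c: C1_chart D x1 r1 e1 \<gamma>1 using ch1 D by (simp add: C1_chart_def)
    have local: "\<exists>\<delta>>0. test_le_on_ball ?\<nu> M p \<delta>"
      if p: "p \<in> ball x1 r1" for p
    proof (cases "p \<in> frontier D")
      case True
      then obtain q where q: "q \<in> I" "dist q p < r q / 4" using I(3) by auto
      then have "p \<in> ball q (r q)" using C1_chart.r_pos[OF chart[OF q(1)]] by simp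
      note q = q(1) this
      obtain \<delta> where \<delta>: "\<delta> > 0" "\<And>\<phi>. Ck_fun (Suc 0) \<phi> \<Longrightarrow> (\<forall>x. 0 \<le> \<phi> x) \<Longrightarrow>
          (\<forall>x. x \<notin> ball p \<delta> \<longrightarrow> \<phi> x = 0) \<Longrightarrow> (\<integral>\<^sup>+x. ennreal (\<phi> x) \<partial>?\<nu>) \<le> 2 * (\<integral>\<^sup>+x. ennreal (\<phi> x) \<partial>\<mu> q)"
        using chart_measures_comparable[OF c.C1_chart_axioms chart[OF q(1)] p q(2)] unfolding \<mu>_def by blast
      have "(\<integral>\<^sup>+x. ennreal (\<phi> x) \<partial>?\<nu>) \<le> (\<integral>\<^sup>+x. ennreal (\<phi> x) \<partial>M)"
        if "Ck_fun (Suc 0) \<phi>" "\<forall>x. 0 \<le> \<phi> x" "\<forall>x. x \<notin> ball p \<delta> \<longrightarrow> \<phi> x = 0" for \<phi> :: "'a \<Rightarrow> real"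
      proof -
        have [measurable]: "\<phi> \<in> borel_measurable borel"
          by (rule borel_measurable_continuous_onI[OF Ck_fun_continuous_on[OF that(1)]])
        have "2 * (\<integral>\<^sup>+x. ennreal (\<phi> x) \<partial>\<mu> q) \<le> (\<integral>\<^sup>+x. ennreal (\<phi> x) \<partial>M)"
          by (rule le_M[OF q(1)]) measurable
        with \<delta>(2)[OF that] show ?thesis by (rule order_trans)
      qed
      with \<delta>(1) show ?thesis by blast
    next
      case False
      have "open (- frontier D)" by (simp add: frontier_closed open_Compl)
      then obtain \<delta> where \<delta>: "\<delta> > 0" "ball p \<delta> \<subseteq> - frontier D" using False open_contains_ball by blast
      have "(\<integral>\<^sup>+x. ennreal (\<phi> x) \<partial>?\<nu>) \<le> (\<integral>\<^sup>+x. ennreal (\<phi> x) \<partial>M)"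
        if "Ck_fun (Suc 0) \<phi>" "\<forall>x. x \<notin> ball p \<delta> \<longrightarrow> \<phi> x = 0" for \<phi> :: "'a \<Rightarrow> real"
      proof -
        have [measurable]: "\<phi> \<in> borel_measurable borel"
          by (rule borel_measurable_continuous_onI[OF Ck_fun_continuous_on[OF that(1)]])
        have "(\<integral>\<^sup>+x. ennreal (\<phi> x) \<partial>?\<nu>) = 0"
        proof (rule c.nn_integral_graph_measure_off_frontier)
          show "ennreal (\<phi> x) = 0" if "x \<in> frontier D \<inter> ball x1 r1" for x
          proof -
            have "x \<notin> ball p \<delta>" using that \<delta>(2) by blast
            then show ?thesis using \<open>\<forall>x. x \<notin> ball p \<delta> \<longrightarrow> \<phi> x = 0\<close> by simp
          qed
        qed measurable
        then show ?thesis by simp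
      qed
      with \<delta>(1) show ?thesis by blast
    qed
    have open_le: "emeasure ?\<nu> U \<le> emeasure M U" if "open U" "U \<subseteq> ball x1 r1" for U
    proof (cases "U = {}")
      case False
      show ?thesis
        by (rule emeasure_open_le_of_local_test[OF _ setsM that(1) False local]) (use that(2) in auto)
    qed simp
    have conc: "emeasure ?\<nu> (- ball x1 r1) = 0"
    proof -
      have "(\<integral>\<^sup>+x. indicator (- ball x1 r1) x \<partial>?\<nu>) = 0"
        by (rule c.nn_integral_graph_measure_off_frontier) (auto intro!: borel_measurable_indicator)
      then show ?thesis by (subst (asm) nn_integral_indicator) auto
    qed
    show ?thesis
    proof (subst le_measure)
      show "sets ?\<nu> = sets M" by (simp add: setsM)
      show "\<forall>A\<in>sets ?\<nu>. emeasure ?\<nu> A \<le> emeasure M A"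
      proof
        fix A assume "A \<in> sets ?\<nu>"
        then have A: "A \<in> sets borel" by simp
        have "emeasure ?\<nu> A \<le> emeasure M U" if U: "A \<subseteq> U" "open U" for U
        proof -
          have "emeasure ?\<nu> A \<le> emeasure ?\<nu> ((U \<inter> ball x1 r1) \<union> - ball x1 r1)"
            using U by (intro emeasure_mono) auto
          also have "\<dots> \<le> emeasure ?\<nu> (U \<inter> ball x1 r1) + emeasure ?\<nu> (- ball x1 r1)"
            using U by (intro emeasure_subadditive) auto
          also have "\<dots> \<le> emeasure M (U \<inter> ball x1 r1)"
            using open_le[of "U \<inter> ball x1 r1"] U conc by auto
          also have "\<dots> \<le> emeasure M U" using U setsM by (intro emeasure_mono) auto
          finally show ?thesis .
        qed
        \<comment> \<open>So far only open sets are compared. Outer regularity of the finite measure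
          \<open>M\<close> carries the inequality to all Borel sets.\<close>
        then have "emeasure ?\<nu> A \<le> (INF U\<in>{U. A \<subseteq> U \<and> open U}. emeasure M U)"
          by (intro INF_greatest) auto
        also have "\<dots> = emeasure M A"
          by (rule outer_regular[symmetric, OF setsM _ A])
            (use finM sets_eq_imp_space_eq[OF setsM] in auto)
        finally show "emeasure ?\<nu> A \<le> emeasure M A" .
      qed
    qed
  qed
  then have "surface_measure D \<le> M"
    unfolding surface_measure_def by (intro Sup_least) auto
  then have "emeasure (surface_measure D) UNIV \<le> emeasure M UNIV"
    by (rule le_measureD3) (simp add: sets setsM)
  also have "\<dots> < \<infinity>" by (rule finM)
  finally show "emeasure (surface_measure D) UNIV < \<infinity>" .
qed

section \<open>Energy estimates\<close>

text \<open>The flux inequality is applied to w times its gradient, whose divergence is w \<Delta>w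
  plus the squared gradient. \<open>W\<close> stands for the gradient extended continuously to the
  closure, so the field is defined on the boundary.\<close>

lemma green_flux_bound:
  fixes D :: "'a::euclidean_space set" and w :: "'a \<Rightarrow> real" and W :: "'a \<Rightarrow> 'a \<Rightarrow> real"
  assumes D: "open D" "bounded D" "D \<noteq> {}" and k: "1 \<le> k" "Ck_boundary k D"
    and cw: "continuous_on (closure D) w" and cW: "\<And>b. b \<in> Basis \<Longrightarrow> continuous_on (closure D) (W b)"
    and dw: "\<And>x. x \<in> D \<Longrightarrow> (w has_derivative w' x) (at x)"
    and wW: "\<And>x b. x \<in> D \<Longrightarrow> b \<in> Basis \<Longrightarrow> w' x b = W b x"
    and dW: "\<And>x b. x \<in> D \<Longrightarrow> b \<in> Basis \<Longrightarrow> (W b has_derivative W' b x) (at x)"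
    and cW': "\<And>b. b \<in> Basis \<Longrightarrow> continuous_on D (\<lambda>x. W' b x b)"
    and L: "set_integrable lborel D (\<lambda>x. \<Sum>b\<in>Basis. W' b x b)"
    and K: "0 \<le> K" "\<And>x. x \<in> frontier D \<Longrightarrow> (\<Sum>b\<in>Basis. \<bar>W b x\<bar>) \<le> K"
  shows "set_integrable lborel D (\<lambda>x. w x * (\<Sum>b\<in>Basis. W' b x b))"
    and "(LINT x:D|lborel. w x * (\<Sum>b\<in>Basis. W' b x b)) \<le> K * (LINT x:frontier D|surface_measure D. \<bar>w x\<bar>)"
proof -
  let ?S = "surface_measure D" and ?L = "\<lambda>x. \<Sum>b\<in>Basis. W' b x b"
  define F where "F = (\<lambda>x. \<Sum>b\<in>Basis. (w x * W b x) *\<^sub>R b)"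
  define F' where "F' = (\<lambda>x h. \<Sum>b\<in>Basis. (w x * W' b x h + w' x h * W b x) *\<^sub>R b)"
  have cwD: "continuous_on D w" and cWD: "\<And>b. b \<in> Basis \<Longrightarrow> continuous_on D (W b)"
    using continuous_on_subset[OF cw closure_subset] continuous_on_subset[OF cW closure_subset] by auto
  have cF: "continuous_on (closure D) F"
    unfolding F_def by (intro continuous_on_sum continuous_on_scaleR continuous_on_mult cw cW continuous_on_const)
  have dF: "(F has_derivative F' x) (at x)" if "x \<in> D" for x
    unfolding F_def F'_def
    by (intro has_derivative_sum has_derivative_scaleR_left has_derivative_mult dw dW that)
  have F'b: "F' x b \<bullet> b = w x * W' b x b + W b x * W b x" if "x \<in> D" "b \<in> Basis" for x b
    using that by (simp add: F'_def wW)
  have cF': "continuous_on D (\<lambda>x. F' x b \<bullet> b)" if b: "b \<in> Basis" for b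
  proof (rule continuous_on_eq)
    show "continuous_on D (\<lambda>x. w x * W' b x b + W b x * W b x)"
      by (intro continuous_on_add continuous_on_mult cwD cWD[OF b] cW'[OF b])
  qed (simp add: F'b b)
  have div: "divergence F' x = w x * ?L x + (\<Sum>b\<in>Basis. W b x * W b x)" if "x \<in> D" for x
    unfolding divergence_def using that by (simp add: F'b sum.distrib sum_distrib_left)
  obtain C where "0 \<le> C" and C: "\<And>x. x \<in> closure D \<Longrightarrow> norm (w x) \<le> C"
    by (rule continuous_on_compact_bound[OF compact_closure[THEN iffD2, OF D(2)] cw]) (rule that)
  show I1: "set_integrable lborel D (\<lambda>x. w x * ?L x)"
  proof (rule set_integrable_mult_bounded[OF L])
    show "(\<lambda>x. indicator D x *\<^sub>R w x) \<in> borel_measurable lborel"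
      using borel_measurable_continuous_on_indicator[OF _ cwD] D(1) by simp
    show "\<bar>w x\<bar> \<le> C" if "x \<in> D" for x using C closure_subset that by force
  qed
  have I2: "set_integrable lborel D (\<lambda>x. \<Sum>b\<in>Basis. W b x * W b x)"
    by (intro set_integrable_continuous_closure D continuous_on_sum continuous_on_mult cW)
  have I3: "set_integrable lborel D (divergence F')"
    using set_integral_add(1)[OF I1 I2] unfolding set_integrable_def
    by (subst Bochner_Integration.integrable_cong[OF refl, where g = "\<lambda>x. indicator D x *\<^sub>R (w x * ?L x + (\<Sum>b\<in>Basis. W b x * W b x))"])
      (auto simp: indicator_def div)
  have field: "C1_field D F F'" unfolding C1_field_def using cF dF cF' I3 by blast
  have sets_S: "sets ?S = sets borel" and fin_S: "emeasure ?S UNIV < \<infinity>"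
    by (rule surface_measure_finite[OF D k])+
  \<comment> \<open>Finiteness of the surface measure enters here: it turns the boundary integral in
    \<open>ennreal\<close> into a real-valued one.\<close>
  have intS: "set_integrable ?S (frontier D) (\<lambda>x. \<bar>w x\<bar>)"
    unfolding set_integrable_def
  proof (rule finite_measure.integrable_const_bound)
    show "finite_measure ?S" using fin_S sets_eq_imp_space_eq[OF sets_S] by (intro finite_measureI) auto
    show "AE x in ?S. norm (indicat_real (frontier D) x *\<^sub>R \<bar>w x\<bar>) \<le> \<bar>C\<bar>"
    proof (rule AE_I2)
      fix x show "norm (indicat_real (frontier D) x *\<^sub>R \<bar>w x\<bar>) \<le> \<bar>C\<bar>"
        using C[of x] by (cases "x \<in> frontier D") (auto simp: frontier_def)
    qed
    have "continuous_on (frontier D) (\<lambda>x. \<bar>w x\<bar>)"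
      by (intro continuous_on_rabs continuous_on_subset[OF cw]) (simp add: frontier_def)
    then have "(\<lambda>x. indicator (frontier D) x *\<^sub>R \<bar>w x\<bar>) \<in> borel_measurable borel"
      by (intro borel_measurable_continuous_on_indicator) auto
    then show "(\<lambda>x. indicator (frontier D) x *\<^sub>R \<bar>w x\<bar>) \<in> borel_measurable ?S"
      by (subst measurable_cong_sets[OF sets_S refl])
  qed
  have nn: "0 \<le> (LINT x:frontier D|?S. \<bar>w x\<bar>)"
    by (rule set_integral_ge_0) simp
  \<comment> \<open>The integral of the squared gradient is added for free because it is
    nonnegative.\<close>
  have "(LINT x:D|lborel. w x * ?L x) \<le> (LINT x:D|lborel. w x * ?L x) + (LINT x:D|lborel. \<Sum>b\<in>Basis. W b x * W b x)"
    by (simp, rule set_integral_ge_0) (simp add: sum_nonneg)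
  also have "\<dots> = (LINT x:D|lborel. divergence F' x)"
    unfolding set_integral_add(2)[OF I1 I2, symmetric]
    using D(1) by (intro set_lebesgue_integral_cong) (auto simp: div)
  finally have "ennreal (LINT x:D|lborel. w x * ?L x) \<le> ennreal (LINT x:D|lborel. divergence F' x)"
    by (rule ennreal_leI)
  also have "\<dots> \<le> boundary_integral D ?S F"
    by (rule divergence_le_flux[OF D k field])
  also have "\<dots> \<le> (\<integral>\<^sup>+x. ennreal (K * (indicator (frontier D) x *\<^sub>R \<bar>w x\<bar>)) \<partial>?S)"
  proof (rule nn_integral_mono)
    fix x
    have "norm (F x) \<le> (\<Sum>b\<in>Basis. norm ((w x * W b x) *\<^sub>R b))" unfolding F_def by (rule norm_sum)
    also have "\<dots> = \<bar>w x\<bar> * (\<Sum>b\<in>Basis. \<bar>W b x\<bar>)" by (simp add: abs_mult sum_distrib_left)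
    finally have "x \<in> frontier D \<Longrightarrow> norm (F x) \<le> \<bar>w x\<bar> * K"
      using mult_left_mono[OF K(2), of x "\<bar>w x\<bar>"] by fastforce
    then show "indicator (frontier D) x * ennreal (norm (F x)) \<le> ennreal (K * (indicator (frontier D) x *\<^sub>R \<bar>w x\<bar>))"
      by (simp add: indicator_def ennreal_leI mult.commute)
  qed
  also have "\<dots> = ennreal (K * (LINT x:frontier D|?S. \<bar>w x\<bar>))"
    unfolding set_lebesgue_integral_def integral_mult_right_zero[symmetric]
    using intS K(1) unfolding set_integrable_def
    by (intro nn_integral_eq_integral integrable_mult_right) (auto simp: indicator_def)
  finally show "(LINT x:D|lborel. w x * ?L x) \<le> K * (LINT x:frontier D|?S. \<bar>w x\<bar>)"
    using K(1) nn by (simp add: ennreal_le_iff)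
qed

text \<open>The integral of (f - c)^2 is a nonnegative quadratic polynomial in c; its value at the
  mean of f is the claim.\<close>

lemma set_integral_squared_le:
  fixes f :: "'a \<Rightarrow> real"
  assumes A: "A \<in> sets M" "emeasure M A < \<infinity>"
    and f: "set_integrable M A f" "set_integrable M A (\<lambda>x. (f x)\<^sup>2)"
  shows "(LINT x:A|M. f x)\<^sup>2 \<le> measure M A * (LINT x:A|M. (f x)\<^sup>2)"
proof -
  define m where "m = measure M A"
  define I where "I = (LINT x:A|M. f x)"
  define Q where "Q = (LINT x:A|M. (f x)\<^sup>2)"
  have one: "set_integrable M A (\<lambda>x. 1::real)" "(LINT x:A|M. (1::real)) = m"
    using A by (simp_all add: set_integrable_def set_lebesgue_integral_def m_def)
  have *: "0 \<le> Q - 2 * c * I + c\<^sup>2 * m" for c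
  proof -
    have i1: "set_integrable M A (\<lambda>x. (2 * c) * f x)" by (intro set_integrable_mult_right f(1))
    have i2: "set_integrable M A (\<lambda>x. c\<^sup>2 * 1)" by (intro set_integrable_mult_right one(1))
    have i3: "(LINT x:A|M. c\<^sup>2) = c\<^sup>2 * m"
      using set_integral_mult_right[where M = M and A = A and a = "c\<^sup>2" and f = "\<lambda>_. 1::real"] one(2) by simp
    have "0 \<le> (LINT x:A|M. (f x - c)\<^sup>2)"
      by (rule set_integral_ge_0) simp
    also have "(\<lambda>x. (f x - c)\<^sup>2) = (\<lambda>x. ((f x)\<^sup>2 - (2 * c) * f x) + c\<^sup>2 * 1)"
      by (simp add: fun_eq_iff power2_diff)
    also have "(LINT x:A|M. ((f x)\<^sup>2 - (2 * c) * f x) + c\<^sup>2 * 1) = Q - 2 * c * I + c\<^sup>2 * m"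
      using set_integral_add(2)[OF set_integral_diff(1)[OF f(2) i1] i2] set_integral_diff(2)[OF f(2) i1] i3
      by (simp add: Q_def I_def)
    finally show ?thesis .
  qed
  have "0 \<le> m" by (simp add: m_def)
  show ?thesis
  proof (cases "m = 0")
    case True
    have "I = 0"
    proof (rule ccontr)
      assume "I \<noteq> 0"
      \<comment> \<open>For measure 0 the polynomial is affine in c; this c gives it the value
        -1.\<close>
      then show False using *[of "(Q + 1) / (2 * I)"] True by simp
    qed
    then show ?thesis using True by (simp add: I_def m_def)
  next
    case False
    then have "0 < m" using \<open>0 \<le> m\<close> by simp
    have "0 \<le> m * (Q - 2 * (I / m) * I + (I / m)\<^sup>2 * m)" using *[of "I / m"] \<open>0 < m\<close> by (intro mult_nonneg_nonneg) auto
    also have "\<dots> = m * Q - I\<^sup>2" using \<open>0 < m\<close> by (simp add: field_simps power2_eq_square)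
    finally show ?thesis by (simp add: I_def m_def Q_def)
  qed
qed

text \<open>The right-hand side of the hypothesis, multiplied by \<open>exp (a - t)\<close>, is
  nonincreasing and starts at \<open>A\<close>.\<close>

lemma gronwall_integral:
  fixes E :: "real \<Rightarrow> real"
  assumes ab: "a \<le> b" and cont: "continuous_on {a..b} E"
    and le: "\<And>t. t \<in> {a..b} \<Longrightarrow> E t \<le> A + integral {a..t} E" and t: "t \<in> {a..b}"
  shows "E t \<le> A * exp (t - a)"
proof -
  define Z where "Z = (\<lambda>t. integral {a..t} E)"
  define Y where "Y = (\<lambda>t. (A + Z t) * exp (a - t))"
  have intE: "E integrable_on {a..b}" using cont by (rule integrable_continuous_real)
  have contZ: "continuous_on {a..b} Z"
    unfolding Z_def by (rule indefinite_integral_continuous_1[OF intE])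
  have contY: "continuous_on {a..b} Y" unfolding Y_def by (intro continuous_intros contZ)
  have "Y t \<le> Y a"
  proof (cases "a < t")
    case True
    show ?thesis
    proof (rule DERIV_nonpos_imp_decreasing_open[OF less_imp_le[OF True]])
      show "continuous_on {a..t} Y" using continuous_on_subset[OF contY] t by auto
      fix s assume s: "a < s" "s < t"
      have "(Z has_real_derivative E s) (at s within {a..b})"
        unfolding Z_def by (rule integral_has_real_derivative[OF cont]) (use s t in auto)
      moreover have "at s within {a..b} = at s"
        using s t by (intro at_within_interior) (auto simp: interior_atLeastAtMost_real)
      ultimately have dZ: "(Z has_real_derivative E s) (at s)" by simp
      have "(Y has_real_derivative (E s * exp (a - s) + (A + Z s) * (exp (a - s) * (- 1)))) (at s)"
        unfolding Y_def by (rule derivative_eq_intros dZ refl | simp)+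
      moreover have "E s * exp (a - s) + (A + Z s) * (exp (a - s) * (- 1)) \<le> 0"
      proof -
        have "E s \<le> A + Z s" using le[of s] s t by (simp add: Z_def)
        then have "E s * exp (a - s) \<le> (A + Z s) * exp (a - s)" by (rule mult_right_mono) simp
        then show ?thesis by simp
      qed
      ultimately show "\<exists>y. (Y has_real_derivative y) (at s) \<and> y \<le> 0" by blast
    qed
  next
    case False
    then show ?thesis using t by simp
  qed
  also have "Y a = A" by (simp add: Y_def Z_def)
  finally have "(A + Z t) * exp (a - t) * exp (t - a) \<le> A * exp (t - a)"
    unfolding Y_def by (rule mult_right_mono) simp
  moreover have "exp (a - t) * exp (t - a) = 1" by (simp add: exp_add[symmetric])
  ultimately have "A + Z t \<le> A * exp (t - a)" by (simp add: mult.assoc)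
  then show ?thesis using le[OF t] by (simp add: Z_def)
qed

abbreviation sq_integral :: "'a::euclidean_space set \<Rightarrow> ('a \<Rightarrow> real) \<Rightarrow> ennreal" where
  "sq_integral D p \<equiv> \<integral>\<^sup>+x\<in>D. ennreal (\<bar>p x\<bar>\<^sup>2) \<partial>lborel"

text \<open>Fubini for an integrand bounded on a set of finite measure. The compact set
  \<open>C\<close> is separate from \<open>A\<close> to cover both uses: \<open>D\<close> inside its
  closure with Lebesgue measure, and the frontier with the surface measure.\<close>

lemma space_time_integral:
  fixes f :: "'a::euclidean_space \<times> real \<Rightarrow> real"
  assumes M: "sigma_finite_measure M" "sets M = sets borel" and A: "A \<in> sets borel" "emeasure M A < \<infinity>"
    and C: "A \<subseteq> C" "compact C" and f: "continuous_on (C \<times> {a..b}) f"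
  shows "t \<in> {a..b} \<Longrightarrow> set_integrable M A (\<lambda>x. f (x, t))"
    and "set_integrable lborel {a..b} (\<lambda>t. LINT x:A|M. f (x, t))"
    and "(LINT t:{a..b}|lborel. LINT x:A|M. f (x, t)) = (LINT x:A|M. LINT t:{a..b}|lborel. f (x, t))"
proof -
  interpret M: sigma_finite_measure M by (rule M(1))
  interpret pair_sigma_finite M "lborel :: real measure" ..
  obtain c where "0 \<le> c" and c: "\<And>z. z \<in> C \<times> {a..b} \<Longrightarrow> norm (f z) \<le> c"
    by (rule continuous_on_compact_bound[OF compact_Times[OF C(2) compact_Icc] f]) (rule that)
  have clC: "closed C" using C(2) by (rule compact_imp_closed)
  show "set_integrable M A (\<lambda>x. f (x, t))" if t: "t \<in> {a..b}"
    unfolding set_integrable_def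
  proof (rule integrableI_bounded_set)
    show "A \<in> sets M" "emeasure M A < \<infinity>" using A M(2) by auto
    have "continuous_on C (\<lambda>x. f (x, t))"
      by (rule continuous_on_compose2[OF f]) (use t in \<open>auto intro!: continuous_intros\<close>)
    then have "(\<lambda>x. indicator C x *\<^sub>R f (x, t)) \<in> borel_measurable borel"
      using clC by (intro borel_measurable_continuous_on_indicator) auto
    then have "(\<lambda>x. indicator A x *\<^sub>R (indicator C x *\<^sub>R f (x, t))) \<in> borel_measurable borel"
      by (rule borel_measurable_scaleR[OF borel_measurable_indicator[OF A(1)]])
    also have "(\<lambda>x. indicator A x *\<^sub>R (indicator C x *\<^sub>R f (x, t))) = (\<lambda>x. indicat_real A x *\<^sub>R f (x, t))"
      using C(1) by (auto simp: fun_eq_iff indicator_def)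
    finally show "(\<lambda>x. indicat_real A x *\<^sub>R f (x, t)) \<in> borel_measurable M"
      by (subst measurable_cong_sets[OF M(2) refl])
    show "AE x in M. x \<in> A \<longrightarrow> norm (indicat_real A x *\<^sub>R f (x, t)) \<le> c"
      using c C(1) t by (intro AE_I2) (auto simp: indicator_def)
    show "AE x in M. x \<notin> A \<longrightarrow> indicat_real A x *\<^sub>R f (x, t) = 0" by simp
  qed
  have sp: "sets (M \<Otimes>\<^sub>M (lborel :: real measure)) = sets borel"
    using sets_pair_measure_cong[OF M(2) sets_lborel[where 'a = real]] by (simp only: borel_prod)
  have int: "integrable (M \<Otimes>\<^sub>M lborel) (\<lambda>(x, t). indicat_real {a..b} t * (indicat_real A x * f (x, t)))"
  proof (rule integrableI_bounded_set)
    show "A \<times> {a..b} \<in> sets (M \<Otimes>\<^sub>M lborel)" using A(1) M(2) by (intro pair_measureI) auto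
    show "emeasure (M \<Otimes>\<^sub>M lborel) (A \<times> {a..b}) < \<infinity>"
      using A M(2) emeasure_bounded_finite[OF bounded_closed_interval, of a b]
      by (subst lborel.emeasure_pair_measure_Times) (auto simp: ennreal_mult_less_top)
    have "C \<times> {a..b} \<in> sets borel" by (intro borel_closed closed_Times clC closed_atLeastAtMost)
    then have "(\<lambda>z. indicator (C \<times> {a..b}) z *\<^sub>R f z) \<in> borel_measurable borel"
      by (rule borel_measurable_continuous_on_indicator[OF _ f])
    then have 1: "(\<lambda>z. indicator (C \<times> {a..b}) z *\<^sub>R f z) \<in> borel_measurable (M \<Otimes>\<^sub>M lborel)"
      by (subst measurable_cong_sets[OF sp refl])
    have "(\<lambda>z. indicat_real (A \<times> {a..b}) z *\<^sub>R (indicator (C \<times> {a..b}) z *\<^sub>R f z)) \<in> borel_measurable (M \<Otimes>\<^sub>M lborel)"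
      by (rule borel_measurable_scaleR[OF borel_measurable_indicator 1]) fact
    also have "(\<lambda>z. indicat_real (A \<times> {a..b}) z *\<^sub>R (indicator (C \<times> {a..b}) z *\<^sub>R f z)) =
        (\<lambda>(x, t). indicat_real {a..b} t * (indicat_real A x * f (x, t)))"
      using C(1) by (auto simp: fun_eq_iff indicator_def)
    finally show "(\<lambda>(x, t). indicat_real {a..b} t * (indicat_real A x * f (x, t))) \<in> borel_measurable (M \<Otimes>\<^sub>M lborel)" .
    show "AE z in M \<Otimes>\<^sub>M lborel. z \<in> A \<times> {a..b} \<longrightarrow>
        norm (case z of (x, t) \<Rightarrow> indicat_real {a..b} t * (indicat_real A x * f (x, t))) \<le> c"
      using c C(1) by (intro AE_I2) (auto simp: indicator_def)
    show "AE z in M \<Otimes>\<^sub>M lborel. z \<notin> A \<times> {a..b} \<longrightarrow>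
        (case z of (x, t) \<Rightarrow> indicat_real {a..b} t * (indicat_real A x * f (x, t))) = 0"
      by (intro AE_I2) (auto simp: indicator_def)
  qed
  have "integrable lborel (\<lambda>t. LINT x|M. indicat_real {a..b} t * (indicat_real A x * f (x, t)))"
    using integrable_snd[OF int] .
  then show "set_integrable lborel {a..b} (\<lambda>t. LINT x:A|M. f (x, t))"
    by (simp add: set_integrable_def set_lebesgue_integral_def)
  have t_part: "(LINT x|M. indicat_real {a..b} t * (indicat_real A x * f (x, t))) =
      indicat_real {a..b} t * (LINT x|M. indicat_real A x * f (x, t))" for t
    by simp
  have x_part: "(LINT t|lborel. indicat_real {a..b} t * (indicat_real A x * f (x, t))) =
      indicat_real A x * (LINT t|lborel. indicat_real {a..b} t * f (x, t))" for x
    unfolding mult.left_commute[of "indicat_real {a..b} _" "indicat_real A x"] by simp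
  have "(LINT t|lborel. LINT x|M. indicat_real {a..b} t * (indicat_real A x * f (x, t))) =
      (LINT x|M. LINT t|lborel. indicat_real {a..b} t * (indicat_real A x * f (x, t)))"
    using Fubini_integral[OF int] .
  then show "(LINT t:{a..b}|lborel. LINT x:A|M. f (x, t)) = (LINT x:A|M. LINT t:{a..b}|lborel. f (x, t))"
    unfolding t_part x_part by (simp add: set_lebesgue_integral_def)
qed

lemma set_integral_Icc_mono:
  fixes f :: "real \<Rightarrow> real"
  assumes "set_integrable lborel {a..b} f" "AE t in lborel. t \<in> {a..b} \<longrightarrow> 0 \<le> f t" "\<tau> \<in> {a..b}"
  shows "(LINT t:{a..\<tau>}|lborel. f t) \<le> (LINT t:{a..b}|lborel. f t)"
proof -
  have "set_integrable lborel {a..\<tau>} f"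
    by (rule set_integrable_subset[OF assms(1)]) (use assms(3) in auto)
  then show ?thesis
    using assms unfolding set_lebesgue_integral_def set_integrable_def
    by (intro integral_mono_AE) (auto simp: indicator_def elim!: eventually_mono)
qed

text \<open>On the bounded set \<open>D\<close> the square integrable residual \<open>R\<close> is
  integrable, hence so is the Laplacian g - R, where \<open>g\<close> is the time derivative. Then
  Green's inequality applies to w times the Laplacian, and 2 w R is at most w^2 + R^2.\<close>

lemma energy_inequality_fixed_time:
  fixes D :: "'a::euclidean_space set" and w :: "'a \<Rightarrow> real" and W :: "'a \<Rightarrow> 'a \<Rightarrow> real"
  assumes D: "open D" "bounded D" "D \<noteq> {}" and k: "1 \<le> k" "Ck_boundary k D"
    and cw: "continuous_on (closure D) w" and cW: "\<And>b. b \<in> Basis \<Longrightarrow> continuous_on (closure D) (W b)"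
    and dw: "\<And>x. x \<in> D \<Longrightarrow> (w has_derivative w' x) (at x)"
    and wW: "\<And>x b. x \<in> D \<Longrightarrow> b \<in> Basis \<Longrightarrow> w' x b = W b x"
    and dW: "\<And>x b. x \<in> D \<Longrightarrow> b \<in> Basis \<Longrightarrow> (W b has_derivative W' b x) (at x)"
    and cW': "\<And>b. b \<in> Basis \<Longrightarrow> continuous_on D (\<lambda>x. W' b x b)"
    and K: "0 \<le> K" "\<And>x. x \<in> frontier D \<Longrightarrow> (\<Sum>b\<in>Basis. \<bar>W b x\<bar>) \<le> K"
    and cg: "continuous_on (closure D) g"
    and R: "R = (\<lambda>x. g x - (\<Sum>b\<in>Basis. W' b x b))"
    and fin: "(\<integral>\<^sup>+x. ennreal (indicator D x * (R x)\<^sup>2) \<partial>lborel) < \<infinity>"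
  shows "(LINT x:D|lborel. 2 * w x * g x) \<le> (LINT x:D|lborel. (w x)\<^sup>2) +
    enn2real (\<integral>\<^sup>+x. ennreal (indicator D x * (R x)\<^sup>2) \<partial>lborel) + 2 * K * (LINT x:frontier D|surface_measure D. \<bar>w x\<bar>)"
proof -
  let ?L = "\<lambda>x. \<Sum>b\<in>Basis. W' b x b"
  have cR: "continuous_on D R"
    unfolding R by (intro continuous_on_diff continuous_on_sum cW' continuous_on_subset[OF cg closure_subset])
  have mR: "(\<lambda>x. indicator D x *\<^sub>R R x) \<in> borel_measurable borel"
    using cR D(1) by (intro borel_measurable_continuous_on_indicator) auto
  have "(\<lambda>x. indicator D x *\<^sub>R (R x)\<^sup>2) \<in> borel_measurable borel"
    using cR D(1) by (intro borel_measurable_continuous_on_indicator continuous_on_power) auto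
  then have R2: "integrable lborel (\<lambda>x. indicator D x * (R x)\<^sup>2)"
    by (intro integrableI_nonneg) (use fin in auto)
  then have IR2: "set_integrable lborel D (\<lambda>x. (R x)\<^sup>2)" by (simp add: set_integrable_def)
  have I1: "set_integrable lborel D (\<lambda>x. 1::real)"
    by (intro set_integrable_continuous_closure D continuous_on_const)
  have IR: "set_integrable lborel D R"
    unfolding set_integrable_def
  proof (rule Bochner_Integration.integrable_bound)
    show "integrable lborel (\<lambda>x. indicator D x *\<^sub>R (1 + (R x)\<^sup>2))"
      using set_integral_add(1)[OF I1 IR2] by (simp add: set_integrable_def)
    show "(\<lambda>x. indicat_real D x *\<^sub>R R x) \<in> borel_measurable lborel" using mR by simp
    have "\<bar>y\<bar> \<le> 1 + y\<^sup>2" for y :: real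
      using sum_squares_bound[of "\<bar>y\<bar>" 1] zero_le_power2[of y] by (simp add: power2_eq_square) 
    then show "AE x in lborel. norm (indicat_real D x *\<^sub>R R x) \<le> norm (indicat_real D x *\<^sub>R (1 + (R x)\<^sup>2))"
      by (intro AE_I2) (simp add: indicator_def)
  qed
  have Ig: "set_integrable lborel D g" by (intro set_integrable_continuous_closure D cg)
  have "set_integrable lborel D (\<lambda>x. g x - R x)" by (rule set_integral_diff(1)[OF Ig IR])
  then have IL: "set_integrable lborel D ?L" by (simp add: R)
  note green = green_flux_bound[OF D k cw cW dw wW dW cW' IL K]
  have Iwg: "set_integrable lborel D (\<lambda>x. w x * g x)"
    by (intro set_integrable_continuous_closure D continuous_on_mult cw cg)
  have IwR: "set_integrable lborel D (\<lambda>x. w x * R x)"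
    using set_integral_diff(1)[OF Iwg green(1)] by (simp add: R right_diff_distrib)
  have Iw2: "set_integrable lborel D (\<lambda>x. (w x)\<^sup>2)"
    by (intro set_integrable_continuous_closure D continuous_on_power cw)
  have "(\<lambda>x. w x * g x) = (\<lambda>x. w x * ?L x + w x * R x)"
    by (simp add: R fun_eq_iff right_diff_distrib)
  then have "(LINT x:D|lborel. w x * g x) = (LINT x:D|lborel. w x * ?L x) + (LINT x:D|lborel. w x * R x)"
    using set_integral_add(2)[OF green(1) IwR] by metis
  moreover have "2 * (LINT x:D|lborel. w x * R x) \<le> (LINT x:D|lborel. (w x)\<^sup>2) + (LINT x:D|lborel. (R x)\<^sup>2)"
    unfolding set_integral_add(2)[OF Iw2 IR2, symmetric] set_integral_mult_right[symmetric]
  proof (rule set_integral_mono)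
    show "set_integrable lborel D (\<lambda>x. 2 * (w x * R x))" by (intro set_integrable_mult_right IwR)
    show "set_integrable lborel D (\<lambda>x. (w x)\<^sup>2 + (R x)\<^sup>2)" by (rule set_integral_add(1)[OF Iw2 IR2])
    show "2 * (w x * R x) \<le> (w x)\<^sup>2 + (R x)\<^sup>2" for x
      using sum_squares_bound[of "w x" "R x"] by (simp add: mult.assoc)
  qed
  moreover have "(LINT x:D|lborel. (R x)\<^sup>2) = enn2real (\<integral>\<^sup>+x. ennreal (indicator D x * (R x)\<^sup>2) \<partial>lborel)"
    using nn_integral_eq_integral[OF R2] by (simp add: set_lebesgue_integral_def integral_nonneg_AE)
  moreover have "(LINT x:D|lborel. 2 * w x * g x) = 2 * (LINT x:D|lborel. w x * g x)"
    by (simp add: mult.assoc)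
  ultimately show ?thesis using green(2) by simp
qed

text \<open>The fixed-time inequality is integrated over the block and Gronwall is applied to the
  energy \<open>E\<close>. The boundary term is integrated over the whole block and enters the
  constant \<open>A\<close>.\<close>

lemma energy_block:
  fixes D :: "'a::euclidean_space set" and w g :: "'a \<times> real \<Rightarrow> real" and W :: "'a \<Rightarrow> 'a \<times> real \<Rightarrow> real"
  assumes D: "open D" "bounded D" "D \<noteq> {}" and k: "1 \<le> k" "Ck_boundary k D" and ab: "a \<le> b"
    and cw: "continuous_on (closure D \<times> {a..b}) w" and cg: "continuous_on (closure D \<times> {a..b}) g"
    and cW: "\<And>c. c \<in> Basis \<Longrightarrow> continuous_on (closure D \<times> {a..b}) (W c)"
    and dt: "\<And>x t. x \<in> D \<Longrightarrow> t \<in> {a<..<b} \<Longrightarrow> ((\<lambda>s. w (x, s)) has_real_derivative g (x, t)) (at t)"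
    and dw: "\<And>x t. x \<in> D \<Longrightarrow> t \<in> {a<..<b} \<Longrightarrow> ((\<lambda>y. w (y, t)) has_derivative w' (x, t)) (at x)"
    and wW: "\<And>x t c. x \<in> D \<Longrightarrow> t \<in> {a<..<b} \<Longrightarrow> c \<in> Basis \<Longrightarrow> w' (x, t) c = W c (x, t)"
    and dW: "\<And>x t c. x \<in> D \<Longrightarrow> t \<in> {a<..<b} \<Longrightarrow> c \<in> Basis \<Longrightarrow>
      ((\<lambda>y. W c (y, t)) has_derivative W' c (x, t)) (at x)"
    and cW': "\<And>c. c \<in> Basis \<Longrightarrow> continuous_on (D \<times> {a<..<b}) (\<lambda>z. W' c z c)"
    and K: "0 \<le> K" "\<And>x t. x \<in> frontier D \<Longrightarrow> t \<in> {a..b} \<Longrightarrow> (\<Sum>c\<in>Basis. \<bar>W c (x, t)\<bar>) \<le> K"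
    and \<tau>: "\<tau> \<in> {a..b}"
  shows "sq_integral D (\<lambda>x. w (x, \<tau>)) \<le>
    (sq_integral D (\<lambda>x. w (x, a)) +
     (\<integral>\<^sup>+t\<in>{a..b}. sq_integral D (\<lambda>x. g (x, t) - (\<Sum>c\<in>Basis. W' c (x, t) c)) \<partial>lborel) +
     ennreal (2 * K * sqrt (measure (surface_measure D) (frontier D)) * sqrt (b - a) *
       sqrt (LINT t:{a..b}|lborel. LINT y:frontier D|surface_measure D. \<bar>w (y, t)\<bar>\<^sup>2))) * ennreal (exp (b - a))"
    (is "_ \<le> (_ + ?\<rho> + ennreal ?X) * _")
proof (cases "?\<rho> = \<infinity>")
  \<comment> \<open>The right-hand side is infinite as well, since the exponential factor is
    positive.\<close>
  case True
  then show ?thesis by (simp add: ennreal_top_mult)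
next
  case fin: False
  let ?S = "surface_measure D"
  define R where "R = (\<lambda>z. g z - (\<Sum>c\<in>Basis. W' c z c))"
  \<comment> \<open>The residual is continuous in the open block; cutting off there gives joint
    measurability, and the two end times form a null set.\<close>
  define Q where "Q = (\<lambda>z. indicator (D \<times> {a<..<b}) z *\<^sub>R (R z)\<^sup>2)"
  have sets_S: "sets ?S = sets borel" and fin_S: "emeasure ?S UNIV < \<infinity>"
    by (rule surface_measure_finite[OF D k])+
  have fmS: "finite_measure ?S" using fin_S sets_eq_imp_space_eq[OF sets_S] by (intro finite_measureI) auto
  interpret S: finite_measure ?S by (rule fmS)
  have sfS: "sigma_finite_measure ?S" by unfold_locales
  have cD: "compact (closure D)" using D(2) by (simp add: compact_closure)
  have cF: "compact (frontier D)" using D(2) by (rule compact_frontier_bounded)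
  have finD: "emeasure lborel D < \<infinity>" using emeasure_bounded_finite[OF D(2)] by simp
  have finF: "emeasure ?S (frontier D) < \<infinity>" by (simp add: less_top[symmetric])
  have Db: "D \<in> sets borel" and Fb: "frontier D \<in> sets borel" using D(1) by auto
  note st = space_time_integral[OF sigma_finite_lborel sets_lborel Db finD closure_subset cD]
  note stF = space_time_integral[OF sfS sets_S Fb finF subset_refl cF]
  have FD: "frontier D \<times> {a..b} \<subseteq> closure D \<times> {a..b}" by (auto simp: frontier_def)
  define E where "E = (\<lambda>t. LINT x:D|lborel. (w (x, t))\<^sup>2)"
  define G where "G = (\<lambda>t. LINT x:D|lborel. 2 * w (x, t) * g (x, t))"
  define B where "B = (\<lambda>t. LINT x:frontier D|?S. \<bar>w (x, t)\<bar>)"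
  define B2 where "B2 = (\<lambda>t. LINT x:frontier D|?S. \<bar>w (x, t)\<bar>\<^sup>2)"
  define q where "q = (\<lambda>t. \<integral>\<^sup>+x. ennreal (Q (x, t)) \<partial>lborel)"
  define r where "r = (\<lambda>t. enn2real (q t))"
  have cw2: "continuous_on (closure D \<times> {a..b}) (\<lambda>z. (w z)\<^sup>2)" by (intro continuous_on_power cw)
  have cwg: "continuous_on (closure D \<times> {a..b}) (\<lambda>z. 2 * w z * g z)"
    by (intro continuous_on_mult continuous_on_const cw cg)
  have cwF: "continuous_on (frontier D \<times> {a..b}) (\<lambda>z. \<bar>w z\<bar>)"
    by (intro continuous_on_rabs continuous_on_subset[OF cw FD])
  have cwF2: "continuous_on (frontier D \<times> {a..b}) (\<lambda>z. \<bar>w z\<bar>\<^sup>2)"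
    by (intro continuous_on_power cwF)
  have IE: "set_integrable lborel {a..b} E" unfolding E_def by (rule st(2)[OF cw2])
  have IG: "set_integrable lborel {a..b} G" unfolding G_def by (rule st(2)[OF cwg])
  have IB: "set_integrable lborel {a..b} B" unfolding B_def by (rule stF(2)[OF cwF])
  have IB2: "set_integrable lborel {a..b} B2" unfolding B2_def by (rule stF(2)[OF cwF2])
  have E0: "0 \<le> E t" for t
    unfolding E_def by (rule set_integral_ge_0) simp
  have B0: "0 \<le> B t" for t
    unfolding B_def by (rule set_integral_ge_0) simp
  \<comment> \<open>Fubini reduces this to the fundamental theorem for each fixed x, which only asks
    for the time derivative inside the interval. Nothing is differentiated under the
    integral.\<close>
  have E_eq: "E t = E a + (LINT s:{a..t}|lborel. G s)" if t: "t \<in> {a..b}" for t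
  proof -
    have sub: "closure D \<times> {a..t} \<subseteq> closure D \<times> {a..b}" using t by auto
    have "(LINT s:{a..t}|lborel. G s) = (LINT x:D|lborel. LINT s:{a..t}|lborel. 2 * w (x, s) * g (x, s))"
      unfolding G_def by (rule st(3)[OF continuous_on_subset[OF cwg sub]])
    also have "\<dots> = (LINT x:D|lborel. (w (x, t))\<^sup>2 - (w (x, a))\<^sup>2)"
    proof (rule set_lebesgue_integral_cong)
      show "\<forall>x. x \<in> D \<longrightarrow> (LINT s:{a..t}|lborel. 2 * w (x, s) * g (x, s)) = (w (x, t))\<^sup>2 - (w (x, a))\<^sup>2"
      proof (intro allI impI)
        fix x assume x: "x \<in> D"
        then have xc: "x \<in> closure D" using closure_subset by blast
        have cs: "continuous_on {a..t} (\<lambda>s. f (x, s))" if "continuous_on (closure D \<times> {a..b}) f" for f :: "'a \<times> real \<Rightarrow> real"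
          by (rule continuous_on_compose2[OF that]) (use t xc in \<open>auto intro!: continuous_intros\<close>)
        have "((\<lambda>s. 2 * w (x, s) * g (x, s)) has_integral (w (x, t))\<^sup>2 - (w (x, a))\<^sup>2) {a..t}"
        proof (rule fundamental_theorem_of_calculus_interior)
          show "a \<le> t" using t by simp
          show "continuous_on {a..t} (\<lambda>s. (w (x, s))\<^sup>2)" by (rule cs[OF cw2])
          fix s assume "s \<in> {a<..<t}"
          then have s: "s \<in> {a<..<b}" using t by auto
          have "((\<lambda>s. (w (x, s))\<^sup>2) has_real_derivative 2 * w (x, s) * g (x, s)) (at s)"
            using DERIV_power[OF dt[OF x s], of 2] by (simp add: mult_ac)
          then show "((\<lambda>s. (w (x, s))\<^sup>2) has_vector_derivative 2 * w (x, s) * g (x, s)) (at s)"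
            by (simp add: has_real_derivative_iff_has_vector_derivative)
        qed
        moreover have "set_integrable lborel {a..t} (\<lambda>s. 2 * w (x, s) * g (x, s))"
          by (rule borel_integrable_atLeastAtMost'[OF cs[OF cwg]])
        ultimately show "(LINT s:{a..t}|lborel. 2 * w (x, s) * g (x, s)) = (w (x, t))\<^sup>2 - (w (x, a))\<^sup>2"
          using set_borel_integral_eq_integral(2) integral_unique by metis
      qed
    qed (use Db in simp)
    also have "\<dots> = E t - E a"
      unfolding E_def by (rule set_integral_diff(2)) (use t ab in \<open>auto intro!: st(1)[OF cw2]\<close>)
    finally show ?thesis by simp
  qed
  have cRD: "continuous_on (D \<times> {a<..<b}) R"
    unfolding R_def
    by (intro continuous_on_diff continuous_on_sum cW' continuous_on_subset[OF cg])
      (use closure_subset[of D] in auto)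
  have "D \<times> {a<..<b} \<in> sets borel" by (intro borel_open open_Times D(1) open_greaterThanLessThan)
  then have "Q \<in> borel_measurable borel"
    unfolding Q_def by (intro borel_measurable_continuous_on_indicator continuous_on_power cRD)
  then have mQ [measurable]: "Q \<in> borel_measurable (lborel \<Otimes>\<^sub>M lborel)" by (simp add: lborel_prod)
  have mq [measurable]: "q \<in> borel_measurable lborel"
  proof -
    have "(\<lambda>(t, x). ennreal (Q (x, t))) \<in> borel_measurable (lborel \<Otimes>\<^sub>M lborel)" by measurable
    then show ?thesis unfolding q_def by (rule lborel.borel_measurable_nn_integral)
  qed
  have q_le: "(\<integral>\<^sup>+t. q t \<partial>lborel) \<le> ?\<rho>"
  proof (rule nn_integral_mono)
    fix t
    show "q t \<le> sq_integral D (\<lambda>x. g (x, t) - (\<Sum>c\<in>Basis. W' c (x, t) c)) * indicator {a..b} t"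
    proof (cases "t \<in> {a<..<b}")
      case True
      then have "q t = sq_integral D (\<lambda>x. g (x, t) - (\<Sum>c\<in>Basis. W' c (x, t) c))"
        unfolding q_def by (intro nn_integral_cong) (auto simp: Q_def R_def indicator_def)
      then show ?thesis using True by simp
    next
      case False
      then have "Q (x, t) = 0" for x by (simp add: Q_def)
      then have "q t = 0" by (simp add: q_def)
      then show ?thesis by simp
    qed
  qed
  then have q_fin: "(\<integral>\<^sup>+t. q t \<partial>lborel) < \<infinity>" using fin by (simp add: top.not_eq_extremum order_le_less_trans)
  then have AEq: "AE t in lborel. q t \<noteq> \<infinity>" by (intro nn_integral_noteq_infinite mq) auto
  \<comment> \<open>\<open>enn2real\<close> sends infinity to 0, so agreement holds at the times
    where the residual integral is finite.\<close>
  have qr: "AE t in lborel. ennreal (r t) = q t"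
    using AEq by eventually_elim (simp add: r_def top.not_eq_extremum)
  have nr: "(\<integral>\<^sup>+t. ennreal (r t) \<partial>lborel) = (\<integral>\<^sup>+t. q t \<partial>lborel)" by (rule nn_integral_cong_AE[OF qr])
  have r0: "0 \<le> r t" for t by (simp add: r_def)
  have mr: "r \<in> borel_measurable lborel" unfolding r_def by measurable
  have Ir: "integrable lborel r"
    by (intro integrableI_nonneg mr AE_I2 r0) (use nr q_fin in simp)
  have Ir': "set_integrable lborel A r" if "A \<in> sets borel" for A
    unfolding set_integrable_def using that by (intro integrable_mult_indicator Ir) auto
  define \<rho> where "\<rho> = (LINT t|lborel. r t)"
  have rho: "ennreal \<rho> \<le> ?\<rho>"
    using nn_integral_eq_integral[OF Ir AE_I2[OF r0]] nr q_le by (simp add: \<rho>_def)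
  have rho0: "0 \<le> \<rho>" unfolding \<rho>_def by (intro integral_nonneg_AE AE_I2 r0)
  have key: "AE t in lborel. t \<in> {a..b} \<longrightarrow> G t \<le> E t + r t + 2 * K * B t"
    using AEq AE_lborel_singleton[of a] AE_lborel_singleton[of b]
  proof eventually_elim
    case (elim t)
    show ?case
    proof
      assume t: "t \<in> {a..b}"
      then have ti: "t \<in> {a<..<b}" using elim by auto
      have sec: "continuous_on (closure D) (\<lambda>x. f (x, t))" if "continuous_on (closure D \<times> {a..b}) f" for f :: "'a \<times> real \<Rightarrow> real"
        by (rule continuous_on_compose2[OF that]) (use t in \<open>auto intro!: continuous_intros\<close>)
      have q_eq: "q t = (\<integral>\<^sup>+x. ennreal (indicator D x * (R (x, t))\<^sup>2) \<partial>lborel)"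
        unfolding q_def using ti by (intro nn_integral_cong) (auto simp: Q_def indicator_def)
      show "G t \<le> E t + r t + 2 * K * B t"
        unfolding G_def E_def r_def B_def q_eq
      proof (rule energy_inequality_fixed_time[OF D k sec[OF cw] sec[OF cW] dw[OF _ ti] wW[OF _ ti] dW[OF _ ti] _ K(1) K(2)[OF _ t] sec[OF cg]])
        show "continuous_on D (\<lambda>x. W' c (x, t) c)" if c: "c \<in> Basis" for c
          by (rule continuous_on_compose2[OF cW'[OF c]]) (use ti in \<open>auto intro!: continuous_intros\<close>)
        show "(\<lambda>x. R (x, t)) = (\<lambda>x. g (x, t) - (\<Sum>b\<in>Basis. W' b (x, t) b))" by (simp add: R_def)
        show "(\<integral>\<^sup>+x. ennreal (indicator D x * (R (x, t))\<^sup>2) \<partial>lborel) < \<infinity>"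
          using elim(1) unfolding q_eq by (simp add: top.not_eq_extremum)
      qed
    qed
  qed
  define \<beta> where "\<beta> = (LINT t:{a..b}|lborel. B t)"
  have beta0: "0 \<le> \<beta>"
    unfolding \<beta>_def by (rule set_integral_ge_0) (rule B0)
  define A where "A = E a + \<rho> + 2 * K * \<beta>"
  have HK: "(LINT s:{a..t}|lborel. f s) = integral {a..t} f" if "set_integrable lborel {a..b} f" "t \<in> {a..b}" for f :: "real \<Rightarrow> real" and t
    by (rule set_borel_integral_eq_integral(2)[OF set_integrable_subset[OF that(1)]]) (use that(2) in auto)
  have contE: "continuous_on {a..b} E"
  proof (rule continuous_on_eq)
    show "continuous_on {a..b} (\<lambda>t. E a + integral {a..t} G)"
      by (intro continuous_on_add continuous_on_const indefinite_integral_continuous_1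
          set_borel_integral_eq_integral(1)[OF IG])
    show "E a + integral {a..t} G = E t" if "t \<in> {a..b}" for t
      using E_eq[OF that] HK[OF IG that] by simp
  qed
  have E_le: "E t \<le> A + integral {a..t} E" if t: "t \<in> {a..b}" for t
  proof -
    have sub: "{a..t} \<subseteq> {a..b}" using t by auto
    have I: "set_integrable lborel {a..t} G" "set_integrable lborel {a..t} E" "set_integrable lborel {a..t} B"
      by (rule set_integrable_subset[OF IG] set_integrable_subset[OF IE] set_integrable_subset[OF IB]; use sub in simp)+
    have IKB: "set_integrable lborel {a..t} (\<lambda>s. 2 * K * B s)" by (intro set_integrable_mult_right I(3))
    have Ir2: "set_integrable lborel {a..t} r" by (rule Ir') simp
    note IEr = set_integral_add[OF I(2) Ir2]
    note IErB = set_integral_add[OF IEr(1) IKB]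
    have "(LINT s:{a..t}|lborel. G s) \<le> (LINT s:{a..t}|lborel. E s + r s + 2 * K * B s)"
      unfolding set_lebesgue_integral_def
    proof (rule integral_mono_AE)
      show "integrable lborel (\<lambda>s. indicat_real {a..t} s *\<^sub>R G s)" using I(1) by (simp add: set_integrable_def)
      show "integrable lborel (\<lambda>s. indicat_real {a..t} s *\<^sub>R (E s + r s + 2 * K * B s))"
        using IErB(1) by (simp add: set_integrable_def)
      show "AE s in lborel. indicat_real {a..t} s *\<^sub>R G s \<le> indicat_real {a..t} s *\<^sub>R (E s + r s + 2 * K * B s)"
        using key
      proof eventually_elim
        case (elim s)
        then show ?case using sub by (auto simp: indicator_def)
      qed
    qed
    also have "\<dots> = (LINT s:{a..t}|lborel. E s) + (LINT s:{a..t}|lborel. r s) + 2 * K * (LINT s:{a..t}|lborel. B s)"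
      using IErB(2) IEr(2) by simp
    also have "(LINT s:{a..t}|lborel. r s) \<le> \<rho>"
      unfolding set_lebesgue_integral_def \<rho>_def
      using Ir2 r0 unfolding set_integrable_def
      by (intro integral_mono Ir) (simp_all add: indicator_def)
    also have "2 * K * (LINT s:{a..t}|lborel. B s) \<le> 2 * K * \<beta>"
      unfolding \<beta>_def using K(1) B0 by (intro mult_left_mono set_integral_Icc_mono[OF IB _ t]) auto
    finally show ?thesis
      using E_eq[OF t] HK[OF IE t] by (simp add: A_def)
  qed
  have "E \<tau> \<le> A * exp (\<tau> - a)" by (rule gronwall_integral[OF ab contE E_le \<tau>])
  also have "\<dots> \<le> A * exp (b - a)"
    using \<tau> E0[of a] rho0 beta0 K(1) by (intro mult_left_mono) (simp_all add: A_def)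
  finally have main: "E \<tau> \<le> A * exp (b - a)" .
  define m where "m = measure ?S (frontier D)"
  \<comment> \<open>Cauchy-Schwarz on the boundary, the source of the root of its surface
    measure.\<close>
  have B_sq: "(B t)\<^sup>2 \<le> m * B2 t" if t: "t \<in> {a..b}" for t
    unfolding B_def B2_def m_def
    by (rule set_integral_squared_le[OF _ finF stF(1)[OF cwF t] stF(1)[OF cwF2 t]]) (simp add: sets_S)
  have IBsq: "set_integrable lborel {a..b} (\<lambda>t. (B t)\<^sup>2)"
    unfolding set_integrable_def
  proof (rule Bochner_Integration.integrable_bound)
    show "integrable lborel (\<lambda>t. m * (indicat_real {a..b} t *\<^sub>R B2 t))"
      using IB2 unfolding set_integrable_def by (rule integrable_mult_right)
    have "(\<lambda>t. (indicat_real {a..b} t *\<^sub>R B t)\<^sup>2) \<in> borel_measurable lborel"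
      using IB unfolding set_integrable_def by (intro borel_measurable_power borel_measurable_integrable)
    also have "(\<lambda>t. (indicat_real {a..b} t *\<^sub>R B t)\<^sup>2) = (\<lambda>t. indicat_real {a..b} t *\<^sub>R (B t)\<^sup>2)"
      by (auto simp: indicator_def fun_eq_iff)
    finally show "(\<lambda>t. indicat_real {a..b} t *\<^sub>R (B t)\<^sup>2) \<in> borel_measurable lborel" .
    show "AE t in lborel. norm (indicat_real {a..b} t *\<^sub>R (B t)\<^sup>2) \<le> norm (m * (indicat_real {a..b} t *\<^sub>R B2 t))"
    proof (rule AE_I2)
      fix t
      show "norm (indicat_real {a..b} t *\<^sub>R (B t)\<^sup>2) \<le> norm (m * (indicat_real {a..b} t *\<^sub>R B2 t))"
        using B_sq[of t] by (cases "t \<in> {a..b}") auto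
    qed
  qed
  \<comment> \<open>Cauchy-Schwarz in time, the source of the root of the block length.\<close>
  have "\<beta>\<^sup>2 \<le> measure lborel {a..b} * (LINT t:{a..b}|lborel. (B t)\<^sup>2)"
    unfolding \<beta>_def
    by (rule set_integral_squared_le[OF _ _ IB IBsq])
      (use emeasure_bounded_finite[OF bounded_closed_interval, of a b] in auto)
  also have "\<dots> \<le> (b - a) * (LINT t:{a..b}|lborel. m * B2 t)"
    using ab by (intro mult_mono set_integral_mono[OF IBsq] set_integrable_mult_right IB2 B_sq)
      (auto simp: set_lebesgue_integral_def intro!: integral_nonneg_AE)
  also have "\<dots> = m * (b - a) * (LINT t:{a..b}|lborel. B2 t)" by simp
  finally have "\<beta>\<^sup>2 \<le> m * (b - a) * (LINT t:{a..b}|lborel. B2 t)" .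
  then have "sqrt (\<beta>\<^sup>2) \<le> sqrt (m * (b - a) * (LINT t:{a..b}|lborel. B2 t))" by (rule real_sqrt_le_mono)
  then have beta: "\<beta> \<le> sqrt m * sqrt (b - a) * sqrt (LINT t:{a..b}|lborel. B2 t)"
    using beta0 by (simp add: real_sqrt_mult)
  have "2 * K * \<beta> \<le> ?X"
    using mult_left_mono[OF beta, of "2 * K"] K(1) unfolding m_def B2_def by (simp add: mult.assoc)
  then have X: "ennreal (2 * K * \<beta>) \<le> ennreal ?X" by (rule ennreal_leI)
  have nnE: "sq_integral D (\<lambda>x. w (x, t)) = ennreal (E t)" if t: "t \<in> {a..b}" for t
  proof -
    have "sq_integral D (\<lambda>x. w (x, t)) = (\<integral>\<^sup>+x. ennreal (indicat_real D x *\<^sub>R (w (x, t))\<^sup>2) \<partial>lborel)"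
      by (intro nn_integral_cong) (simp add: indicator_def)
    also have "\<dots> = ennreal (E t)"
      unfolding E_def set_lebesgue_integral_def
      using st(1)[OF cw2 t] unfolding set_integrable_def
      by (intro nn_integral_eq_integral) (auto simp: indicator_def)
    finally show ?thesis .
  qed
  have "ennreal (E \<tau>) \<le> ennreal (A * exp (b - a))" by (rule ennreal_leI[OF main])
  also have "\<dots> = (ennreal (E a) + ennreal \<rho> + ennreal (2 * K * \<beta>)) * ennreal (exp (b - a))"
    using E0[of a] rho0 beta0 K(1) by (simp add: A_def ennreal_mult ennreal_plus)
  also have "\<dots> \<le> (ennreal (E a) + ?\<rho> + ennreal ?X) * ennreal (exp (b - a))"
    by (intro mult_right_mono add_mono rho X order_refl) simp
  finally show ?thesis using nnE[OF \<tau>] nnE[of a] ab by simp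
qed

section \<open>The error of the network\<close>

text \<open>On \<open>S\<close> the limit in \<open>partial_ext\<close> is the value of the
  continuous extension. Continuity on the compact closure bounds the sets whose suprema form the
  norm, so each supremum is an upper bound.\<close>

lemma C1_norm_bounds:
  fixes Q S :: "('a::euclidean_space \<times> real) set"
  assumes Q: "bounded Q" and S: "S \<subseteq> closure Q - Q" "S \<noteq> {}"
    and cv: "continuous_on (closure Q) v"
    and g: "\<And>b. b \<in> Basis \<Longrightarrow> continuous_on (closure Q) (g b)"
      "\<And>b z. b \<in> Basis \<Longrightarrow> z \<in> Q \<Longrightarrow> g b z = frechet_derivative v (at z) b"
  shows "0 \<le> C1_norm Q S v" and "z \<in> S \<Longrightarrow> (\<Sum>c\<in>Basis. \<bar>g (c, 0) z\<bar>) \<le> C1_norm Q S v"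
proof -
  have bdd: "bdd_above ((\<lambda>z. \<bar>f z\<bar>) ` S)" if cf: "continuous_on (closure Q) f" for f :: "'a \<times> real \<Rightarrow> real"
  proof -
    obtain c where "0 \<le> c" "\<And>z. z \<in> closure Q \<Longrightarrow> norm (f z) \<le> c"
      by (rule continuous_on_compact_bound[OF compact_closure[THEN iffD2, OF Q] cf]) (rule that)
    then show ?thesis using S(1) by (intro bdd_aboveI2[of _ _ c]) (metis DiffD1 real_norm_def subsetD)
  qed
  have ext: "partial_ext Q v b z = g b z" if "b \<in> Basis" "z \<in> S" for b z
    unfolding partial_ext_def
  proof (rule tendsto_Lim)
    \<comment> \<open>A point of the closure outside \<open>Q\<close> is a limit point of
      \<open>Q\<close>; this makes \<open>Lim\<close> well determined.\<close>
    have z: "z \<in> closure Q" "z \<notin> Q" using S(1) that(2) by auto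
    then have "z islimpt Q" unfolding closure_def by blast
    then show "\<not> trivial_limit (at z within Q)" by (simp add: trivial_limit_within)
    have "(g b \<longlongrightarrow> g b z) (at z within closure Q)"
      using g(1)[OF that(1)] z(1) unfolding continuous_on_def by (rule bspec)
    then have "(g b \<longlongrightarrow> g b z) (at z within Q)"
      by (rule tendsto_within_subset[OF _ closure_subset])
    moreover have "\<forall>\<^sub>F w in at z within Q. g b w = frechet_derivative v (at w) b"
      using g(2)[OF that(1)] by (simp add: eventually_at_filter)
    ultimately show "((\<lambda>w. frechet_derivative v (at w) b) \<longlongrightarrow> g b z) (at z within Q)"
      by (rule Lim_transform_eventually)
  qed
  have le: "\<bar>g b z\<bar> \<le> (SUP z\<in>S. \<bar>partial_ext Q v b z\<bar>)" if "b \<in> Basis" "z \<in> S" for b z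
  proof -
    have "(\<lambda>z. \<bar>partial_ext Q v b z\<bar>) ` S = (\<lambda>z. \<bar>g b z\<bar>) ` S"
      by (rule image_cong) (simp_all add: ext that(1))
    then show ?thesis
      using cSUP_upper[OF that(2) bdd[OF g(1)[OF that(1)]]] by simp
  qed
  obtain z0 where z0: "z0 \<in> S" using S(2) by blast
  have sup0: "0 \<le> (SUP z\<in>S. \<bar>v z\<bar>)"
    using cSUP_upper[OF z0 bdd[OF cv]] by linarith
  have part0: "0 \<le> (SUP z\<in>S. \<bar>partial_ext Q v b z\<bar>)" if "b \<in> Basis" for b
    using le[OF that z0] by linarith
  then show "0 \<le> C1_norm Q S v"
    unfolding C1_norm_def by (intro add_nonneg_nonneg sup0 sum_nonneg)
  show "(\<Sum>c\<in>Basis. \<bar>g (c, 0) z\<bar>) \<le> C1_norm Q S v" if z: "z \<in> S"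
  proof -
    \<comment> \<open>Space directions embed into the space-time basis, and the summand for the time
      direction is nonnegative.\<close>
    have sub: "(\<lambda>c. (c, 0)) ` Basis \<subseteq> (Basis :: ('a \<times> real) set)" by (auto simp: Basis_prod_def)
    have "(\<Sum>c\<in>Basis. \<bar>g (c, 0) z\<bar>) = (\<Sum>b\<in>(\<lambda>c. (c, 0)) ` Basis. \<bar>g b z\<bar>)"
      by (subst sum.reindex) (auto simp: inj_on_def)
    also have "\<dots> \<le> (\<Sum>b\<in>Basis. \<bar>g b z\<bar>)"
      by (rule sum_mono2[OF finite_Basis sub]) simp
    also have "\<dots> \<le> (\<Sum>b\<in>Basis. SUP z\<in>S. \<bar>partial_ext Q v b z\<bar>)"
      by (rule sum_mono) (rule le[OF _ z])
    finally show ?thesis unfolding C1_norm_def using sup0 by linarith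
  qed
qed

text \<open>\<open>C1_closure\<close> speaks about the joint derivative in space-time, whereas
  \<open>dt\<close> and \<open>dx\<close> differentiate along slices. The chain rule translates
  between them.\<close>

lemma slice_derivatives:
  fixes v :: "'a::euclidean_space \<times> real \<Rightarrow> real"
  assumes "v differentiable (at z)"
  shows "((\<lambda>y. v (y, snd z)) has_derivative (\<lambda>h. frechet_derivative v (at z) (h, 0))) (at (fst z))"
    and "((\<lambda>s. v (fst z, s)) has_real_derivative frechet_derivative v (at z) (0, 1)) (at (snd z))"
    and "dx c v z = frechet_derivative v (at z) (c, 0)"
    and "dt v z = frechet_derivative v (at z) (0, 1)"
proof -
  have d: "(v has_derivative frechet_derivative v (at z)) (at z)"
    using assms by (simp add: frechet_derivative_works)
  have lin: "linear (frechet_derivative v (at z))" by (rule has_derivative_linear[OF d])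
  have d': "(v has_derivative frechet_derivative v (at z)) (at (fst z, snd z))" using d by simp
  show x: "((\<lambda>y. v (y, snd z)) has_derivative (\<lambda>h. frechet_derivative v (at z) (h, 0))) (at (fst z))"
    by (rule has_derivative_compose[where f = "\<lambda>y. (y, snd z)" and g = v, OF _ d'])
      (intro has_derivative_Pair has_derivative_ident has_derivative_const)
  have s: "((\<lambda>s. v (fst z, s)) has_derivative (\<lambda>h. frechet_derivative v (at z) (0, h))) (at (snd z))"
    by (rule has_derivative_compose[where f = "\<lambda>s. (fst z, s)" and g = v, OF _ d'])
      (intro has_derivative_Pair has_derivative_ident has_derivative_const)
  have eq: "(\<lambda>h. frechet_derivative v (at z) (0, h)) = (*) (frechet_derivative v (at z) (0, 1))"
  proof
    fix h
    show "frechet_derivative v (at z) (0, h) = frechet_derivative v (at z) (0, 1) * h"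
      using linear_cmul[OF lin, of h "(0, 1)"] by (simp add: mult.commute)
  qed
  show t: "((\<lambda>s. v (fst z, s)) has_real_derivative frechet_derivative v (at z) (0, 1)) (at (snd z))"
    unfolding has_field_derivative_def using s unfolding eq .
  show "dx c v z = frechet_derivative v (at z) (c, 0)"
    unfolding dx_def frechet_derivative_at[OF x, symmetric] ..
  show "dt v z = frechet_derivative v (at z) (0, 1)"
    unfolding dt_def by (rule DERIV_imp_deriv[OF t])
qed

lemma space_direction_Basis: "c \<in> Basis \<Longrightarrow> (c, 0) \<in> Basis" and time_direction_Basis: "(0, 1::real) \<in> Basis"
  by (auto simp: Basis_prod_def)

abbreviation interior_residual where
  "interior_residual D f v a b \<equiv>
     \<integral>\<^sup>+t\<in>{a..b}. sq_integral D (\<lambda>x. dt v (x, t) - laplace v (x, t) - f (x, t)) \<partial>lborel"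

abbreviation lateral_bound where
  "lateral_bound D u_d u v a b \<equiv> 2 *
     (C1_norm (D \<times> {0<..<b}) (frontier D \<times> {0..b}) u + C1_norm (D \<times> {0<..<b}) (frontier D \<times> {0..b}) v) *
     sqrt (measure (surface_measure D) (frontier D)) * sqrt (b - a) *
     sqrt (LINT t:{a..b}|lborel. LINT y:frontier D|surface_measure D. \<bar>v (y, t) - u_d (y, t)\<bar>\<^sup>2)"

text \<open>The energy estimate is applied to v - u, with the first derivatives of \<open>u\<close>
  replaced by their continuous extensions \<open>g\<close>. The heat equation identifies the
  resulting defect with the interior residual of \<open>v\<close>.\<close>

lemma heat_error_block:
  fixes D :: "'a::euclidean_space set" and u v :: "'a \<times> real \<Rightarrow> real"
  assumes D: "open D" "bounded D" "D \<noteq> {}" and k: "1 \<le> k" "Ck_boundary k D"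
    and ab: "0 \<le> a" "a < b" "b \<le> T"
    and sol: "classical_heat_solution D T f u_in u_d u"
    and C1: "C1_closure (D \<times> {0<..<b}) u" and v: "Ck_fun (Suc (Suc 0)) v" and \<tau>: "\<tau> \<in> {a..b}"
  shows "sq_integral D (\<lambda>x. v (x, \<tau>) - u (x, \<tau>)) \<le>
    (sq_integral D (\<lambda>x. v (x, a) - u (x, a)) +
     interior_residual D f v a b +
     ennreal (lateral_bound D u_d u v a b)) * ennreal (exp (b - a))"
proof -
  define Q where "Q = D \<times> {0<..<b}"
  define S where "S = frontier D \<times> {0..b}"
  have b0: "0 < b" using ab by simp
  have clQ: "closure Q = closure D \<times> {0..b}"
    unfolding Q_def using b0 by (simp add: closure_Times)
  have bQ: "bounded Q" unfolding Q_def using D(2) by (intro bounded_Times) auto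
  have sub: "closure D \<times> {a..b} \<subseteq> closure Q" using ab unfolding clQ by auto
  have "D \<noteq> UNIV" using D(2) not_bounded_UNIV by metis
  then have frne: "frontier D \<noteq> {}" using D(3) frontier_not_empty by blast
  have frD: "frontier D \<inter> D = {}" using D(1) by (auto simp: frontier_def interior_open)
  have "S \<subseteq> closure Q" unfolding S_def clQ by (auto simp: frontier_def)
  moreover have "S \<inter> Q = {}" unfolding S_def Q_def using frD by blast
  ultimately have S: "S \<subseteq> closure Q - Q" by blast
  have Sne: "S \<noteq> {}" unfolding S_def using frne b0 by simp
  let ?dv = "\<lambda>z. frechet_derivative v (at z)" and ?du = "\<lambda>z. frechet_derivative u (at z)"
  have vdiff: "v differentiable (at z)" for z
    using v unfolding Ck_fun.simps(2) by blast
  have cdv: "continuous_on X (\<lambda>z. ?dv z \<beta>)" if "\<beta> \<in> Basis" for X \<beta>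
    by (rule Ck_fun_continuous_on[OF Ck_fun_SucD(2)[OF v that]])
  have cv: "continuous_on X v" for X by (rule Ck_fun_continuous_on[OF v])
  have udiff: "u differentiable (at z)" if "z \<in> Q" for z
    using C1 that unfolding C1_closure_def Q_def by blast
  have cu: "continuous_on (closure Q) u"
    using C1 unfolding C1_closure_def Q_def by blast
  obtain g where cg: "\<And>\<beta>. \<beta> \<in> Basis \<Longrightarrow> continuous_on (closure Q) (g \<beta>)"
    and g: "\<And>\<beta> z. \<beta> \<in> Basis \<Longrightarrow> z \<in> Q \<Longrightarrow> g \<beta> z = ?du z \<beta>"
    using C1 unfolding C1_closure_def Q_def by metis
  have QT: "z \<in> D \<times> {0<..<T}" if "z \<in> Q" for z using that ab unfolding Q_def by auto
  have inQ: "(x, t) \<in> Q" if "x \<in> D" "t \<in> {a<..<b}" for x t using that ab unfolding Q_def by auto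
  have C21: "C21_on (D \<times> {0<..<T}) u" and heat: "\<And>z. z \<in> D \<times> {0<..<T} \<Longrightarrow> dt u z - laplace u z = f z"
    and bc: "\<And>z. z \<in> frontier D \<times> {0..T} \<Longrightarrow> u z = u_d z"
    using sol unfolding classical_heat_solution_def by blast+
  define w where "w = (\<lambda>z. v z - u z)"
  define G where "G = (\<lambda>z. ?dv z (0, 1) - g (0, 1) z)"
  define W where "W = (\<lambda>c z. ?dv z (c, 0) - g (c, 0) z)"
  define w' where "w' = (\<lambda>z h. ?dv z (h, 0) - ?du z (h, 0))"
  \<comment> \<open>Second derivatives are taken along spatial slices, the form in which
    \<open>C21_on\<close> provides them for \<open>u\<close>.\<close>
  define W' where "W' = (\<lambda>c z h. frechet_derivative (\<lambda>y. dx c v (y, snd z)) (at (fst z)) h -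
      frechet_derivative (\<lambda>y. dx c u (y, snd z)) (at (fst z)) h)"
  define K where "K = C1_norm Q S u + C1_norm Q S v"
  have dxv: "dx c v = (\<lambda>z. ?dv z (c, 0))" for c
    by (intro ext slice_derivatives(3) vdiff)
  have dxv_diff: "dx c v differentiable (at z)" if "c \<in> Basis" for c z
  proof -
    have "Ck_fun (Suc 0) (\<lambda>z. ?dv z (c, 0))" by (rule Ck_fun_SucD(2)[OF v space_direction_Basis[OF that]])
    then show ?thesis unfolding dxv Ck_fun.simps by blast
  qed
  have cdxxv: "continuous_on X (dx c (dx c v))" if c: "c \<in> Basis" for X c
  proof -
    have "Ck_fun (Suc 0) (dx c v)" unfolding dxv by (rule Ck_fun_SucD(2)[OF v space_direction_Basis[OF c]])
    then have "continuous_on X (\<lambda>z. frechet_derivative (dx c v) (at z) (c, 0))"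
      by (rule Ck_fun_continuous_on[OF Ck_fun_SucD(2)]) (rule space_direction_Basis[OF c])
    then show ?thesis using slice_derivatives(3)[OF dxv_diff[OF c]] by (simp cong: continuous_on_cong)
  qed
  have W'cc: "W' c z c = dx c (dx c v) z - dx c (dx c u) z" for c z
    by (simp add: W'_def dx_def[of c "dx c v"] dx_def[of c "dx c u"])
  have sumW': "(\<Sum>c\<in>Basis. W' c z c) = laplace v z - laplace u z" for z
    by (simp add: W'cc laplace_def sum_subtractf)
  have block: "sq_integral D (\<lambda>x. w (x, \<tau>)) \<le>
    (sq_integral D (\<lambda>x. w (x, a)) +
     (\<integral>\<^sup>+t\<in>{a..b}. sq_integral D (\<lambda>x. G (x, t) - (\<Sum>c\<in>Basis. W' c (x, t) c)) \<partial>lborel) +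
     ennreal (2 * K * sqrt (measure (surface_measure D) (frontier D)) * sqrt (b - a) *
       sqrt (LINT t:{a..b}|lborel. LINT y:frontier D|surface_measure D. \<bar>w (y, t)\<bar>\<^sup>2))) * ennreal (exp (b - a))"
  proof (rule energy_block[where w = w and g = G and W = W and w' = w' and W' = W' and K = K, OF D k])
    show "a \<le> b" using ab by simp
    show "continuous_on (closure D \<times> {a..b}) w"
      unfolding w_def by (intro continuous_on_diff cv continuous_on_subset[OF cu sub])
    show "continuous_on (closure D \<times> {a..b}) G"
      unfolding G_def
      by (intro continuous_on_diff cdv continuous_on_subset[OF cg sub] time_direction_Basis)
    show "continuous_on (closure D \<times> {a..b}) (W c)" if "c \<in> Basis" for c
      unfolding W_def
      by (intro continuous_on_diff cdv continuous_on_subset[OF cg sub] space_direction_Basis that)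
    show "((\<lambda>s. w (x, s)) has_real_derivative G (x, t)) (at t)" if "x \<in> D" "t \<in> {a<..<b}" for x t
      using DERIV_diff[OF slice_derivatives(2)[OF vdiff[of "(x, t)"]] slice_derivatives(2)[OF udiff[OF inQ[OF that]]]]
        g[OF time_direction_Basis inQ[OF that]]
      by (simp add: w_def G_def)
    show "((\<lambda>y. w (y, t)) has_derivative w' (x, t)) (at x)" if "x \<in> D" "t \<in> {a<..<b}" for x t
      using has_derivative_diff[OF slice_derivatives(1)[OF vdiff[of "(x, t)"]] slice_derivatives(1)[OF udiff[OF inQ[OF that]]]]
      by (simp add: w_def w'_def)
    show "w' (x, t) c = W c (x, t)" if "x \<in> D" "t \<in> {a<..<b}" "c \<in> Basis" for x t c
      using g[OF space_direction_Basis[OF that(3)] inQ[OF that(1,2)]] by (simp add: w'_def W_def)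
    show "((\<lambda>y. W c (y, t)) has_derivative W' c (x, t)) (at x)" if xt: "x \<in> D" "t \<in> {a<..<b}" and c: "c \<in> Basis" for x t c
    proof (rule has_derivative_transform_within_open[OF _ D(1) xt(1)])
      have "((\<lambda>y. dx c v (y, t)) has_derivative (\<lambda>h. frechet_derivative (dx c v) (at (x, t)) (h, 0))) (at x)"
        using slice_derivatives(1)[OF dxv_diff[OF c], of "(x, t)"] by simp
      then have "(\<lambda>y. dx c v (y, t)) differentiable (at x)" by (rule differentiableI)
      then have 1: "((\<lambda>y. dx c v (y, t)) has_derivative frechet_derivative (\<lambda>y. dx c v (y, t)) (at x)) (at x)"
        by (simp add: frechet_derivative_works)
      have "(\<lambda>y. dx c u (y, t)) differentiable (at x)"
        using C21 QT[OF inQ[OF xt]] c unfolding C21_on_def by blast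
      then have 2: "((\<lambda>y. dx c u (y, t)) has_derivative frechet_derivative (\<lambda>y. dx c u (y, t)) (at x)) (at x)"
        by (simp add: frechet_derivative_works)
      show "((\<lambda>y. dx c v (y, t) - dx c u (y, t)) has_derivative W' c (x, t)) (at x)"
        using has_derivative_diff[OF 1 2] by (simp add: W'_def)
      show "dx c v (y, t) - dx c u (y, t) = W c (y, t)" if y: "y \<in> D" for y
        using slice_derivatives(3)[OF udiff[OF inQ[OF y xt(2)]], of c] g[OF space_direction_Basis[OF c] inQ[OF y xt(2)]]
        by (simp add: W_def dxv)
    qed
    show "continuous_on (D \<times> {a<..<b}) (\<lambda>z. W' c z c)" if c: "c \<in> Basis" for c
      unfolding W'cc
    proof (intro continuous_on_diff cdxxv c)
      have "continuous_on (D \<times> {0<..<T}) (dx c (dx c u))"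
        using C21 c unfolding C21_on_def by blast
      then show "continuous_on (D \<times> {a<..<b}) (dx c (dx c u))"
        by (rule continuous_on_subset) (use ab in auto)
    qed
    have Nu: "0 \<le> C1_norm Q S u" "\<And>z. z \<in> S \<Longrightarrow> (\<Sum>c\<in>Basis. \<bar>g (c, 0) z\<bar>) \<le> C1_norm Q S u"
      using C1_norm_bounds[where g = g, OF bQ S Sne cu] cg g by blast+
    have Nv: "0 \<le> C1_norm Q S v" "\<And>z. z \<in> S \<Longrightarrow> (\<Sum>c\<in>Basis. \<bar>?dv z (c, 0)\<bar>) \<le> C1_norm Q S v"
      using C1_norm_bounds[where g = "\<lambda>b z. ?dv z b", OF bQ S Sne cv] cdv by blast+
    show "0 \<le> K" using Nu(1) Nv(1) by (simp add: K_def)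
    show "(\<Sum>c\<in>Basis. \<bar>W c (x, t)\<bar>) \<le> K" if "x \<in> frontier D" "t \<in> {a..b}" for x t
    proof -
      have z: "(x, t) \<in> S" using that ab by (simp add: S_def)
      have "(\<Sum>c\<in>Basis. \<bar>W c (x, t)\<bar>) \<le> (\<Sum>c\<in>Basis. \<bar>?dv (x, t) (c, 0)\<bar> + \<bar>g (c, 0) (x, t)\<bar>)"
        unfolding W_def by (intro sum_mono abs_triangle_ineq4)
      also have "\<dots> \<le> C1_norm Q S v + C1_norm Q S u"
        unfolding sum.distrib by (intro add_mono Nu(2)[OF z] Nv(2)[OF z])
      finally show ?thesis by (simp add: K_def)
    qed
    show "\<tau> \<in> {a..b}" by (rule \<tau>)
  qed
  have res: "G (x, t) - (\<Sum>c\<in>Basis. W' c (x, t) c) = dt v (x, t) - laplace v (x, t) - f (x, t)"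
    if "x \<in> D" "t \<in> {a<..<b}" for x t
  proof -
    have z: "(x, t) \<in> Q" by (rule inQ[OF that])
    have "G (x, t) = dt v (x, t) - dt u (x, t)"
      using slice_derivatives(4)[OF vdiff[of "(x, t)"]] slice_derivatives(4)[OF udiff[OF z]] g[OF time_direction_Basis z]
      by (simp add: G_def)
    then show ?thesis using heat[OF QT[OF z]] by (simp add: sumW')
  qed
  \<comment> \<open>The heat equation is available at inner times, and \<open>b\<close> may be the
    final time; the end points are a null set.\<close>
  have "(\<integral>\<^sup>+t\<in>{a..b}. sq_integral D (\<lambda>x. G (x, t) - (\<Sum>c\<in>Basis. W' c (x, t) c)) \<partial>lborel) =
      interior_residual D f v a b"
  proof (rule nn_integral_cong_AE)
    show "AE t in lborel. sq_integral D (\<lambda>x. G (x, t) - (\<Sum>c\<in>Basis. W' c (x, t) c)) * indicator {a..b} t =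
        sq_integral D (\<lambda>x. dt v (x, t) - laplace v (x, t) - f (x, t)) * indicator {a..b} t"
      using AE_lborel_singleton[of a] AE_lborel_singleton[of b]
    proof eventually_elim
      case (elim t)
      show ?case
      proof (cases "t \<in> {a..b}")
        case True
        then have t: "t \<in> {a<..<b}" using elim by auto
        have "sq_integral D (\<lambda>x. G (x, t) - (\<Sum>c\<in>Basis. W' c (x, t) c)) =
            sq_integral D (\<lambda>x. dt v (x, t) - laplace v (x, t) - f (x, t))"
        proof (rule nn_integral_cong)
          fix x
          show "ennreal (\<bar>G (x, t) - (\<Sum>c\<in>Basis. W' c (x, t) c)\<bar>\<^sup>2) * indicator D x =
              ennreal (\<bar>dt v (x, t) - laplace v (x, t) - f (x, t)\<bar>\<^sup>2) * indicator D x"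
            using res[OF _ t, of x] by (cases "x \<in> D") auto
        qed
        then show ?thesis by simp
      qed simp
    qed
  qed
  moreover have "(LINT t:{a..b}|lborel. LINT y:frontier D|surface_measure D. \<bar>w (y, t)\<bar>\<^sup>2) =
      (LINT t:{a..b}|lborel. LINT y:frontier D|surface_measure D. \<bar>v (y, t) - u_d (y, t)\<bar>\<^sup>2)"
  proof (rule set_lebesgue_integral_cong)
    show "\<forall>t. t \<in> {a..b} \<longrightarrow> (LINT y:frontier D|surface_measure D. \<bar>w (y, t)\<bar>\<^sup>2) =
        (LINT y:frontier D|surface_measure D. \<bar>v (y, t) - u_d (y, t)\<bar>\<^sup>2)"
    proof (intro allI impI set_lebesgue_integral_cong)
      fix t y assume "t \<in> {a..b}" "y \<in> frontier D"
      then have "u (y, t) = u_d (y, t)" using ab by (intro bc) auto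
      then show "\<bar>w (y, t)\<bar>\<^sup>2 = \<bar>v (y, t) - u_d (y, t)\<bar>\<^sup>2" by (simp add: w_def)
    next
      show "frontier D \<in> sets (surface_measure D)"
        using surface_measure_finite(1)[OF D k] by simp
    qed
  qed simp
  ultimately show ?thesis
    using block unfolding K_def w_def Q_def S_def by (simp only:)
qed

section \<open>The recursion over the time blocks\<close>

lemma C1_closure_subset: "C1_closure Q v \<Longrightarrow> Q' \<subseteq> Q \<Longrightarrow> C1_closure Q' v"
  unfolding C1_closure_def by (meson closure_mono continuous_on_subset subsetD)

text \<open>This is the source of the factor 2 at the initial residual and at the previous constant:
  q will be the network of the previous block.\<close>

lemma sq_integral_diff_le:
  fixes p q r :: "'a::euclidean_space \<Rightarrow> real"
  assumes D: "open D" and cont: "continuous_on D p" "continuous_on D q" "continuous_on D r"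
  shows "sq_integral D (\<lambda>x. p x - r x) \<le> 2 * sq_integral D (\<lambda>x. p x - q x) + 2 * sq_integral D (\<lambda>x. q x - r x)"
proof -
  have meas: "(\<lambda>x. ennreal (\<bar>f x\<bar>\<^sup>2) * indicator D x) \<in> borel_measurable lborel"
    if "continuous_on D f" for f :: "'a \<Rightarrow> real"
  proof -
    have "(\<lambda>x. indicator D x *\<^sub>R f x) \<in> borel_measurable borel"
      using D that by (intro borel_measurable_continuous_on_indicator) auto
    then have "(\<lambda>x. ennreal (\<bar>indicator D x *\<^sub>R f x\<bar>\<^sup>2)) \<in> borel_measurable lborel" by measurable
    also have "(\<lambda>x. ennreal (\<bar>indicator D x *\<^sub>R f x\<bar>\<^sup>2)) = (\<lambda>x. ennreal (\<bar>f x\<bar>\<^sup>2) * indicator D x)"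
      by (auto simp: fun_eq_iff indicator_def)
    finally show ?thesis .
  qed
  have m: "(\<lambda>x. ennreal (\<bar>p x - q x\<bar>\<^sup>2) * indicator D x) \<in> borel_measurable lborel"
    "(\<lambda>x. ennreal (\<bar>q x - r x\<bar>\<^sup>2) * indicator D x) \<in> borel_measurable lborel"
    by (intro meas continuous_on_diff cont)+
  have "sq_integral D (\<lambda>x. p x - r x) \<le> (\<integral>\<^sup>+x. 2 * (ennreal (\<bar>p x - q x\<bar>\<^sup>2) * indicator D x) +
      2 * (ennreal (\<bar>q x - r x\<bar>\<^sup>2) * indicator D x) \<partial>lborel)"
  proof (rule nn_integral_mono)
    fix x
    have "(\<alpha> + \<beta>)\<^sup>2 \<le> 2 * \<alpha>\<^sup>2 + 2 * \<beta>\<^sup>2" for \<alpha> \<beta> :: real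
      using sum_squares_bound[of \<alpha> \<beta>] by (simp add: power2_sum)
    from this[of "p x - q x" "q x - r x"]
    have "\<bar>p x - r x\<bar>\<^sup>2 \<le> 2 * \<bar>p x - q x\<bar>\<^sup>2 + 2 * \<bar>q x - r x\<bar>\<^sup>2" by simp
    then have "ennreal (\<bar>p x - r x\<bar>\<^sup>2) \<le> ennreal (2 * \<bar>p x - q x\<bar>\<^sup>2 + 2 * \<bar>q x - r x\<bar>\<^sup>2)"
      by (rule ennreal_leI)
    also have "\<dots> = 2 * ennreal (\<bar>p x - q x\<bar>\<^sup>2) + 2 * ennreal (\<bar>q x - r x\<bar>\<^sup>2)"
      by (simp add: ennreal_plus ennreal_mult)
    finally show "ennreal (\<bar>p x - r x\<bar>\<^sup>2) * indicator D x \<le>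
        2 * (ennreal (\<bar>p x - q x\<bar>\<^sup>2) * indicator D x) + 2 * (ennreal (\<bar>q x - r x\<bar>\<^sup>2) * indicator D x)"
      by (cases "x \<in> D") simp_all
  qed
  also have "\<dots> = 2 * sq_integral D (\<lambda>x. p x - q x) + 2 * sq_integral D (\<lambda>x. q x - r x)"
    using m by (subst nn_integral_add) (simp_all add: nn_integral_cmult)
  finally show ?thesis .
qed

text \<open>The bound on the initial error is a hypothesis because its origin differs: the first
  block compares with \<open>u_in\<close>, later ones with the preceding network.\<close>

lemma heat_error_step:
  fixes D :: "'a::euclidean_space set" and u :: "'a \<times> real \<Rightarrow> real" and v :: "nat \<Rightarrow> 'a \<times> real \<Rightarrow> real"
  assumes D: "open D" "bounded D" "D \<noteq> {}" and k: "1 \<le> k" "Ck_boundary k D"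
    and h: "0 < h" and sol: "classical_heat_solution D T f u_in u_d u"
    and T: "real (Suc n) * h \<le> T" and C1: "C1_closure (D \<times> {0<..<block_time h (Suc n)}) u"
    and v: "Ck_fun (Suc (Suc 0)) (v (Suc n))" and \<tau>: "\<tau> \<in> {block_time h n..block_time h (Suc n)}"
    and init: "sq_integral D (\<lambda>x. v (Suc n) (x, block_time h n) - u (x, block_time h n)) \<le>
      2 * sq_integral D (R_tb u_in v h (Suc n) (Suc n)) + 2 * C_G D f u_in u_d u v h n * ennreal (exp h)"
  shows "sq_integral D (\<lambda>x. v (Suc n) (x, \<tau>) - u (x, \<tau>)) \<le> C_G D f u_in u_d u v h (Suc n) * ennreal (exp h)"
proof -
  define a b where "a = block_time h n" and "b = block_time h (Suc n)"
  have ab: "0 \<le> a" "a < b" "b \<le> T" "b - a = h"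
    using h T by (simp_all add: a_def b_def block_time_def algebra_simps)
  let ?R = "\<lambda>j. sq_integral D (R_tb u_in v h (Suc n) j)" and ?v = "v (Suc n)"
  have "sq_integral D (\<lambda>x. ?v (x, a) - u (x, a)) \<le> 2 * ?R (Suc n) + 2 * C_G D f u_in u_d u v h n * ennreal (exp h)"
    using init by (simp only: a_def)
  \<comment> \<open>The residual at the start of this block is the last summand, and all summands
    are nonnegative.\<close>
  also have "\<dots> \<le> 2 * (\<Sum>j = 1..Suc n. ?R j) + 2 * C_G D f u_in u_d u v h n * ennreal (exp h)"
    by (intro add_right_mono mult_left_mono member_le_sum) auto
  finally have start: "sq_integral D (\<lambda>x. ?v (x, a) - u (x, a)) \<le>
      2 * (\<Sum>j = 1..Suc n. ?R j) + 2 * C_G D f u_in u_d u v h n * ennreal (exp h)" .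
  have CG: "C_G D f u_in u_d u v h (Suc n) = 2 * (\<Sum>j = 1..Suc n. ?R j) +
      interior_residual D f ?v a b + ennreal (lateral_bound D u_d u ?v a b) +
      2 * C_G D f u_in u_d u v h n * ennreal (exp h)"
    unfolding C_G.simps(2) C_G_tilde_def C_bd_def R_int_def R_sb_def Let_def
      ab(4) diff_Suc_1 a_def[symmetric] b_def[symmetric]
    using h by (simp only: abs_of_pos mult_ac)
  have "sq_integral D (\<lambda>x. ?v (x, \<tau>) - u (x, \<tau>)) \<le> (sq_integral D (\<lambda>x. ?v (x, a) - u (x, a)) +
      interior_residual D f ?v a b + ennreal (lateral_bound D u_d u ?v a b)) * ennreal (exp (b - a))"
    using C1 \<tau> by (intro heat_error_block[OF D k ab(1,2,3) sol _ v]) (simp_all only: a_def b_def)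
  also have "\<dots> \<le> C_G D f u_in u_d u v h (Suc n) * ennreal (exp h)"
    unfolding CG ab(4)
    by (intro mult_right_mono) (use add_right_mono[OF start] in \<open>simp_all add: add_ac add_mono\<close>)
  finally show ?thesis .
qed

lemma heat_error_bound:
  fixes D :: "'a::euclidean_space set" and u :: "'a \<times> real \<Rightarrow> real" and v :: "nat \<Rightarrow> 'a \<times> real \<Rightarrow> real"
  assumes D: "open D" "bounded D" "D \<noteq> {}" and k: "1 \<le> k" "Ck_boundary k D"
    and h: "0 < h" and sol: "classical_heat_solution D T f u_in u_d u"
  shows "real (Suc n) * h \<le> T \<Longrightarrow> C1_closure (D \<times> {0<..<block_time h (Suc n)}) u \<Longrightarrow>
    (\<And>j. 1 \<le> j \<Longrightarrow> j \<le> Suc n \<Longrightarrow> Ck_fun (Suc (Suc 0)) (v j)) \<Longrightarrow>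
    \<tau> \<in> {block_time h n..block_time h (Suc n)} \<Longrightarrow>
    sq_integral D (\<lambda>x. v (Suc n) (x, \<tau>) - u (x, \<tau>)) \<le> C_G D f u_in u_d u v h (Suc n) * ennreal (exp h)"
proof (induction n arbitrary: \<tau>)
  case (0 \<tau>)
  have "u (x, 0) = u_in x" if "x \<in> D" for x
    using sol that unfolding classical_heat_solution_def by blast
  then have "sq_integral D (\<lambda>x. v (Suc 0) (x, block_time h 0) - u (x, block_time h 0)) =
      sq_integral D (R_tb u_in v h (Suc 0) (Suc 0))"
    by (intro nn_integral_cong) (auto simp: R_tb_def block_time_def indicator_def)
  \<comment> \<open>Doubling brings the first block into the form required of later ones; the
    recursion term is 0 there because \<open>C_G\<close> starts at 0.\<close>
  also have "\<dots> \<le> 2 * sq_integral D (R_tb u_in v h (Suc 0) (Suc 0))" by (simp add: mult_2)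
  finally show ?case
    using 0 by (intro heat_error_step[OF D k h sol]) simp_all
next
  case (Suc n \<tau>)
  define a where "a = block_time h (Suc n)"
  let ?i = "Suc (Suc n)"
  have a: "0 < a" "a \<le> block_time h ?i" "a \<in> {block_time h n..block_time h (Suc n)}" "a \<le> T"
    using h Suc.prems(1) by (simp_all add: a_def block_time_def algebra_simps add_pos_nonneg)
  \<comment> \<open>The end time of one block is the start time of the next, and the induction
    hypothesis includes it.\<close>
  have IH: "sq_integral D (\<lambda>x. v (Suc n) (x, a) - u (x, a)) \<le> C_G D f u_in u_d u v h (Suc n) * ennreal (exp h)"
  proof (rule Suc.IH)
    show "real (Suc n) * h \<le> T" using a(4) by (simp add: a_def block_time_def)
    show "C1_closure (D \<times> {0<..<block_time h (Suc n)}) u"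
      by (rule C1_closure_subset[OF Suc.prems(2)]) (use a(2) in \<open>auto simp: a_def\<close>)
    show "Ck_fun (Suc (Suc 0)) (v j)" if "1 \<le> j" "j \<le> Suc n" for j
      using that by (intro Suc.prems(3)) auto
  qed (rule a(3))
  have cv: "continuous_on D (\<lambda>x. v j (x, a))" if "1 \<le> j" "j \<le> ?i" for j
    by (rule continuous_on_compose2[OF Ck_fun_continuous_on[OF Suc.prems(3)[OF that], of UNIV]])
      (auto intro!: continuous_intros)
  have "continuous_on (closure (D \<times> {0<..<block_time h ?i})) u"
    using Suc.prems(2) unfolding C1_closure_def by blast
  then have cu: "continuous_on D (\<lambda>x. u (x, a))"
  proof (rule continuous_on_compose2)
    show "continuous_on D (\<lambda>x. (x, a))" by (intro continuous_intros)
    have "a \<in> closure {0<..<block_time h ?i}" using a by simp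
    then show "(\<lambda>x. (x, a)) ` D \<subseteq> closure (D \<times> {0<..<block_time h ?i})"
      unfolding closure_Times using closure_subset[of D] by blast
  qed
  have R: "R_tb u_in v h ?i ?i = (\<lambda>x. v ?i (x, a) - v (Suc n) (x, a))"
    by (simp add: R_tb_def a_def fun_eq_iff)
  have "sq_integral D (\<lambda>x. v ?i (x, a) - u (x, a)) \<le>
      2 * sq_integral D (\<lambda>x. v ?i (x, a) - v (Suc n) (x, a)) + 2 * sq_integral D (\<lambda>x. v (Suc n) (x, a) - u (x, a))"
    by (intro sq_integral_diff_le D(1) cv cu) auto
  also have "\<dots> \<le> 2 * sq_integral D (R_tb u_in v h ?i ?i) + 2 * (C_G D f u_in u_d u v h (Suc n) * ennreal (exp h))"
    unfolding R by (intro add_left_mono mult_left_mono IH) simp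
  finally have init: "sq_integral D (\<lambda>x. v ?i (x, block_time h (Suc n)) - u (x, block_time h (Suc n))) \<le>
      2 * sq_integral D (R_tb u_in v h ?i ?i) + 2 * C_G D f u_in u_d u v h (Suc n) * ennreal (exp h)"
    by (simp only: a_def mult.assoc)
  show ?case
    by (rule heat_error_step[OF D k h sol Suc.prems(1,2) _ Suc.prems(4) init]) (rule Suc.prems(3); simp)
qed

theorem theorem3p3:
  fixes D :: "'a::euclidean_space set"
    and T \<tau> \<Delta>t :: real and k l i :: nat
    and f u_d u :: "'a \<times> real \<Rightarrow> real" and u_in :: "'a \<Rightarrow> real"
    and \<theta> :: "nat \<Rightarrow> hlconc"
  assumes "open D" and "connected D" and "bounded D"
    and "1 \<le> k" and "Ck_boundary k D"
    and "0 < T" and "1 \<le> l" and "\<Delta>t = T / real l"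
    and "1 \<le> i" and "i \<le> l"
    and "classical_heat_solution D T f u_in u_d u"
    and "C1_closure (D \<times> {0<..<block_time \<Delta>t i}) u"
    and "\<And>j. 1 \<le> j \<Longrightarrow> j \<le> i \<Longrightarrow> is_HLConcPINN (DIM('a) + 1) 1 (\<theta> j)"
    and "block_time \<Delta>t (i - 1) \<le> \<tau>" and "\<tau> \<le> block_time \<Delta>t i"
  shows "(\<integral>\<^sup>+x\<in>D. ennreal (\<bar>net (\<theta> i) (x, \<tau>) - u (x, \<tau>)\<bar>\<^sup>2) \<partial>lborel)
           \<le> C_G D f u_in u_d u (\<lambda>j. net (\<theta> j)) \<Delta>t i * ennreal (exp \<Delta>t) \<and>
         (\<integral>\<^sup>+t\<in>{block_time \<Delta>t (i - 1)..block_time \<Delta>t i}.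
            (\<integral>\<^sup>+x\<in>D. ennreal (\<bar>net (\<theta> i) (x, t) - u (x, t)\<bar>\<^sup>2) \<partial>lborel) \<partial>lborel)
           \<le> C_G D f u_in u_d u (\<lambda>j. net (\<theta> j)) \<Delta>t i * ennreal \<Delta>t * ennreal (exp \<Delta>t)"
\<comment> \<open>For empty \<open>D\<close> both left-hand sides are 0. A nonempty bounded domain
  has boundary charts, on which the facts about the surface measure rest.\<close>
proof (cases "D = {}")
  case True
  then show ?thesis by simp
next
  case False
  obtain n where n: "i = Suc n" using \<open>1 \<le> i\<close> by (cases i) auto
  have dt0: "0 < \<Delta>t" using assms(6-8) by simp
  have "real (Suc n) * \<Delta>t \<le> real l * \<Delta>t" using n \<open>i \<le> l\<close> dt0 by (intro mult_right_mono) auto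
  also have "\<dots> = T" using assms(7,8) by simp
  finally have T: "real (Suc n) * \<Delta>t \<le> T" .
  let ?C = "C_G D f u_in u_d u (\<lambda>j. net (\<theta> j)) \<Delta>t i"
  have bound: "sq_integral D (\<lambda>x. net (\<theta> i) (x, t) - u (x, t)) \<le> ?C * ennreal (exp \<Delta>t)"
    if "t \<in> {block_time \<Delta>t (i - 1)..block_time \<Delta>t i}" for t
    unfolding n
  proof (rule heat_error_bound[OF assms(1,3) False assms(4,5) dt0 assms(11) T])
    show "C1_closure (D \<times> {0<..<block_time \<Delta>t (Suc n)}) u" using assms(12) n by simp
    show "Ck_fun (Suc (Suc 0)) (net (\<theta> j) :: 'a \<times> real \<Rightarrow> real)" if "1 \<le> j" "j \<le> Suc n" for j
      using that n by (intro Ck_fun_net[OF assms(13)]) auto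
    show "t \<in> {block_time \<Delta>t n..block_time \<Delta>t (Suc n)}" using that n by simp
  qed
  have len: "block_time \<Delta>t i - block_time \<Delta>t (i - 1) = \<Delta>t" "block_time \<Delta>t (i - 1) \<le> block_time \<Delta>t i"
    using dt0 by (simp_all add: n block_time_def algebra_simps)
  \<comment> \<open>The first estimate is uniform over the block, so integrating it in time
    contributes the block length as a factor.\<close>
  have "(\<integral>\<^sup>+t\<in>{block_time \<Delta>t (i - 1)..block_time \<Delta>t i}.
      sq_integral D (\<lambda>x. net (\<theta> i) (x, t) - u (x, t)) \<partial>lborel)
    \<le> (\<integral>\<^sup>+t. (?C * ennreal (exp \<Delta>t)) * indicator {block_time \<Delta>t (i - 1)..block_time \<Delta>t i} t \<partial>lborel)"
  proof (rule nn_integral_mono)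
    fix t
    show "sq_integral D (\<lambda>x. net (\<theta> i) (x, t) - u (x, t)) *
          indicator {block_time \<Delta>t (i - 1)..block_time \<Delta>t i} t
        \<le> (?C * ennreal (exp \<Delta>t)) * indicator {block_time \<Delta>t (i - 1)..block_time \<Delta>t i} t"
      using bound[of t] by (cases "t \<in> {block_time \<Delta>t (i - 1)..block_time \<Delta>t i}") auto
  qed
  also have "\<dots> = (?C * ennreal (exp \<Delta>t)) * emeasure lborel {block_time \<Delta>t (i - 1)..block_time \<Delta>t i}"
    by (rule nn_integral_cmult_indicator) simp
  also have "\<dots> = ?C * ennreal \<Delta>t * ennreal (exp \<Delta>t)"
    using len by (simp add: mult_ac)
  finally show ?thesis using bound[of \<tau>] assms(14,15) by simp
qed

end
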